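(* For any Coxeter group $W$ the ideal $\underline{\mathbf{J}}(W)$ of $\hat{\mathbf{H}}(W)$ generated by all $\mathbf{K}_{ij}(W)$, $i,j\in I$, $i\ne j$, is a Hopf ideal; therefore, the quotient algebra $\mathbf{H}(W)=\hat{\mathbf{H}}(W)/\underline{\mathbf{J}}(W)$ is a Hopf algebra.
   Context: A Coxeter group $W$ is generated by $s_i$, $i\in I$, subject to relations $(s_is_j)^{m_{ij}}=1$, where $m_{ij}=m_{ji}\in\mathbb{Z}_{\ge 0}$ are such that $m_{ij}=1$ iff $i=j$ ($m_{ij}=0$ imposes no relation). $\hat{\mathbf{H}}(W)$ is the (unital associative) $\mathbb{Z}$-algebra generated by $s_i,D_i$, $i\in I$, subject to relations: (i) $s_i^2=1$, $D_i^2=D_i$, $s_iD_i+D_is_i=s_i-1$ for $i\in I$; (ii) $(s_is_j)^{m_{ij}}=1$; (iii) $\underbrace{D_is_js_i\cdots s_{j'}}_{m_{ij}}=\underbrace{s_j\cdots s_{i'}s_{j'}D_{i'}}_{m_{ij}}$ for all distinct $i,j\in I$ with $m_{ij}\ne 0$, where $i'=i$ if $m_{ij}$ is even, $i'=j$ if $m_{ij}$ is odd, and $\{i',j'\}=\{i,j\}$ (each side has $m_{ij}$ factors with indices alternating between $i$ and $j$). It is a Hopf algebra over $\mathbb{Z}$ with $\Delta(s_i)=s_i\otimes s_i$, $\Delta(D_i)=D_i\otimes 1+s_i\otimes D_i$, $\varepsilon(s_i)=1$, $\varepsilon(D_i)=0$, $S(s_i)=s_i$, $S(D_i)=-s_iD_i$.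 $\mathcal{S}:=\{ws_iw^{-1}\mid w\in W,i\in I\}$ is the set of reflections. For each $s\in\mathcal{S}$ there is a unique element $D_s\in\hat{\mathbf{H}}(W)$ such that $D_{s_i}=D_i$ for $i\in I$ and $D_{s_iss_i}=s_iD_ss_i$ for any $i\in I$, $s\in\mathcal{S}\setminus\{s_i\}$. $\hat{\mathbf{D}}(W)$ is the subalgebra of $\hat{\mathbf{H}}(W)$ generated by all $D_s$, $s\in\mathcal{S}$, and $\mathbf{K}(W):=\bigcap_{w\in W}w\hat{\mathbf{D}}(W)w^{-1}$. For $J\subset I$, $W_J$ is the subgroup of $W$ generated by $s_j$, $j\in J$, which is a Coxeter group; $\hat{\mathbf{D}}(W_J)$ is identified with the subalgebra of $\hat{\mathbf{D}}(W)$ generated by all $D_s$ with $s\in\mathcal{S}\cap W_J$. $\hat{\mathbf{D}}(W)$ is filtered by $\deg D_s=1$ for $s\in\mathcal{S}$ (degree at most $r$ means: lies in the $\mathbb{Z}$-span of products of at most $r$ of the $D_s$). For distinct $i,j\in I$, $\mathbf{K}_{ij}(W)$ is the set of all elements of $\mathbf{K}(W_{\{i,j\}})\cap\operatorname{Ker}\varepsilon\subset\hat{\mathbf{D}}(W_{\{i,j\}})$ having degree at most $m_{ij}$ (so $\mathbf{K}_{ij}(W)=\{0\}$ if $m_{ij}=0$). *)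

theory Defs
  imports "HOL-Algebra.QuotRing" "HOL-Algebra.IntRing" "HOL-Algebra.Generated_Rings"
    "HOL-Algebra.Free_Abelian_Groups"
begin

section \<open>Integral monoid rings and extension by additivity\<close>

definition monoid_ring :: "('a, 'b) monoid_scheme \<Rightarrow> ('a \<Rightarrow>\<^sub>0 int) ring" where
  "monoid_ring G =
    \<lparr>carrier = {p. Poly_Mapping.keys p \<subseteq> carrier G},
     monoid.mult = (\<lambda>p q. frag_extend (\<lambda>x. frag_extend (\<lambda>y. frag_of (x \<otimes>\<^bsub>G\<^esub> y)) q) p),
     one = frag_of \<one>\<^bsub>G\<^esub>,
     ring.zero = 0,
     ring.add = (+)\<rparr>"

text \<open>The additive map into \<open>C\<close> that sends the basis element \<open>k\<close> to \<open>f k\<close>.\<close>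

definition additive_ext :: "('c, 'd) ring_scheme \<Rightarrow> ('k \<Rightarrow> 'c) \<Rightarrow> ('k \<Rightarrow>\<^sub>0 int) \<Rightarrow> 'c" where
  "additive_ext C f p =
    (\<Oplus>\<^bsub>C\<^esub>k\<in>Poly_Mapping.keys p. add_pow C (Poly_Mapping.lookup p k) (f k))"

text \<open>The map on cosets induced by a map \<open>f\<close> on representatives. It is meaningful only if \<open>f\<close> is
  constant on each coset; in every use below this is part of what has to be proved.\<close>

definition descend :: "('a \<Rightarrow> 'b) \<Rightarrow> 'a set \<Rightarrow> 'b" where
  "descend f X = the_elem (f ` X)"

definition list_prod :: "('a, 'b) monoid_scheme \<Rightarrow> 'a list \<Rightarrow> 'a" where
  "list_prod G xs = foldr (monoid.mult G) xs \<one>\<^bsub>G\<^esub>"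

definition int_span :: "('a, 'b) ring_scheme \<Rightarrow> 'a set \<Rightarrow> 'a set" where
  "int_span R X = generate (add_monoid R) X"


section \<open>The tensor product of two rings over the integers\<close>

definition tensor_relations ::
  "('a, 'm) ring_scheme \<Rightarrow> ('b, 'n) ring_scheme \<Rightarrow> ('a \<times> 'b \<Rightarrow>\<^sub>0 int) set" where
  "tensor_relations A B =
     {frag_of (a \<oplus>\<^bsub>A\<^esub> a', b) - frag_of (a, b) - frag_of (a', b) | a a' b.
        a \<in> carrier A \<and> a' \<in> carrier A \<and> b \<in> carrier B} \<union>
     {frag_of (a, b \<oplus>\<^bsub>B\<^esub> b') - frag_of (a, b) - frag_of (a, b') | a b b'.
        a \<in> carrier A \<and> b \<in> carrier B \<and> b' \<in> carrier B}"

text \<open>The subgroup spanned by the bilinearity relations is automatically an ideal of the monoid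
  ring of the multiplicative monoid of \<open>A \<times> B\<close>, so the quotient by the ideal they generate is
  the usual tensor product, with componentwise multiplication of pure tensors.\<close>

definition tensor_ideal ::
  "('a, 'm) ring_scheme \<Rightarrow> ('b, 'n) ring_scheme \<Rightarrow> ('a \<times> 'b \<Rightarrow>\<^sub>0 int) set" where
  "tensor_ideal A B = Idl\<^bsub>monoid_ring (A \<times>\<times> B)\<^esub> (tensor_relations A B)"

definition tensor ::
  "('a, 'm) ring_scheme \<Rightarrow> ('b, 'n) ring_scheme \<Rightarrow> ('a \<times> 'b \<Rightarrow>\<^sub>0 int) set ring" where
  "tensor A B = monoid_ring (A \<times>\<times> B) Quot tensor_ideal A B"

definition pure_tensor ::
  "('a, 'm) ring_scheme \<Rightarrow> ('b, 'n) ring_scheme \<Rightarrow> 'a \<Rightarrow> 'b \<Rightarrow> ('a \<times> 'b \<Rightarrow>\<^sub>0 int) set" where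
  "pure_tensor A B a b = tensor_ideal A B +>\<^bsub>monoid_ring (A \<times>\<times> B)\<^esub> frag_of (a, b)"

text \<open>The additive map on the tensor product induced by a biadditive map \<open>f\<close> into \<open>C\<close>.\<close>

definition tensor_lift ::
  "('c, 'd) ring_scheme \<Rightarrow> ('a \<Rightarrow> 'b \<Rightarrow> 'c) \<Rightarrow> ('a \<times> 'b \<Rightarrow>\<^sub>0 int) set \<Rightarrow> 'c" where
  "tensor_lift C f = descend (additive_ext C (\<lambda>(a, b). f a b))"


section \<open>Hopf algebras over the integers and Hopf ideals\<close>

locale hopf_algebra = ring A for A (structure) +
  fixes comult :: "'a \<Rightarrow> ('a \<times> 'a \<Rightarrow>\<^sub>0 int) set"
    and counit :: "'a \<Rightarrow> int"
    and antipode :: "'a \<Rightarrow> 'a"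
  assumes comult_hom: "comult \<in> ring_hom A (tensor A A)"
    and counit_hom: "counit \<in> ring_hom A \<Z>"
    and antipode_additive: "antipode \<in> hom (add_monoid A) (add_monoid A)"
    and coassociative: "x \<in> carrier A \<Longrightarrow>
      tensor_lift (tensor A (tensor A A))
        (\<lambda>a b. tensor_lift (tensor A (tensor A A))
                 (\<lambda>a' a''. pure_tensor A (tensor A A) a' (pure_tensor A A a'' b)) (comult a))
        (comult x) =
      tensor_lift (tensor A (tensor A A))
        (\<lambda>a b. pure_tensor A (tensor A A) a (comult b)) (comult x)"
    and counit_left: "x \<in> carrier A \<Longrightarrow>
      tensor_lift A (\<lambda>a b. add_pow A (counit a) b) (comult x) = x"
    and counit_right: "x \<in> carrier A \<Longrightarrow>
      tensor_lift A (\<lambda>a b. add_pow A (counit b) a) (comult x) = x"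
    and antipode_left: "x \<in> carrier A \<Longrightarrow>
      tensor_lift A (\<lambda>a b. antipode a \<otimes> b) (comult x) = add_pow A (counit x) \<one>"
    and antipode_right: "x \<in> carrier A \<Longrightarrow>
      tensor_lift A (\<lambda>a b. a \<otimes> antipode b) (comult x) = add_pow A (counit x) \<one>"

locale hopf_ideal = ideal J A + hopf_algebra A comult counit antipode
  for J and A (structure) and comult counit antipode +
  assumes comult_ideal: "comult ` J \<subseteq>
      int_span (tensor A A)
        ({pure_tensor A A j a | j a. j \<in> J \<and> a \<in> carrier A} \<union>
         {pure_tensor A A a j | a j. a \<in> carrier A \<and> j \<in> J})"
    and counit_ideal: "counit ` J \<subseteq> {0}"
    and antipode_ideal: "antipode ` J \<subseteq> J"

definition quotient_comult ::
  "('a, 'm) ring_scheme \<Rightarrow> 'a set \<Rightarrow> ('a \<Rightarrow> ('a \<times> 'a \<Rightarrow>\<^sub>0 int) set) \<Rightarrow>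
    'a set \<Rightarrow> ('a set \<times> 'a set \<Rightarrow>\<^sub>0 int) set" where
  "quotient_comult A J comult =
    descend (\<lambda>x. tensor_lift (tensor (A Quot J) (A Quot J))
      (\<lambda>a b. pure_tensor (A Quot J) (A Quot J) (J +>\<^bsub>A\<^esub> a) (J +>\<^bsub>A\<^esub> b)) (comult x))"

definition quotient_counit :: "('a \<Rightarrow> int) \<Rightarrow> 'a set \<Rightarrow> int" where
  "quotient_counit counit = descend counit"

definition quotient_antipode ::
  "('a, 'm) ring_scheme \<Rightarrow> 'a set \<Rightarrow> ('a \<Rightarrow> 'a) \<Rightarrow> 'a set \<Rightarrow> 'a set" where
  "quotient_antipode A J antipode = descend (\<lambda>x. J +>\<^bsub>A\<^esub> antipode x)"


section \<open>Coxeter groups\<close>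

text \<open>The entry \<open>0\<close> plays the role of infinity.\<close>

definition coxeter_matrix :: "'i set \<Rightarrow> ('i \<Rightarrow> 'i \<Rightarrow> nat) \<Rightarrow> bool" where
  "coxeter_matrix I m \<longleftrightarrow>
    (\<forall>i\<in>I. \<forall>j\<in>I. m i j = m j i \<and> (m i j = 1 \<longleftrightarrow> i = j))"

text \<open>The congruence on words over \<open>I\<close> generated by the Coxeter relations. As \<open>m i i = 1\<close>
  contributes \<open>s\<^sub>i\<^sup>2 = 1\<close>, the monoid so presented is the group with the same presentation.\<close>

inductive coxeter_cong :: "'i set \<Rightarrow> ('i \<Rightarrow> 'i \<Rightarrow> nat) \<Rightarrow> 'i list \<Rightarrow> 'i list \<Rightarrow> bool"
  for I m where
    rel: "\<lbrakk>i \<in> I; j \<in> I; u \<in> lists I; v \<in> lists I\<rbrakk> \<Longrightarrow>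
      coxeter_cong I m (u @ concat (replicate (m i j) [i, j]) @ v) (u @ v)"
  | refl: "u \<in> lists I \<Longrightarrow> coxeter_cong I m u u"
  | sym: "coxeter_cong I m u v \<Longrightarrow> coxeter_cong I m v u"
  | trans: "\<lbrakk>coxeter_cong I m u v; coxeter_cong I m v w\<rbrakk> \<Longrightarrow> coxeter_cong I m u w"

definition cox_class :: "'i set \<Rightarrow> ('i \<Rightarrow> 'i \<Rightarrow> nat) \<Rightarrow> 'i list \<Rightarrow> 'i list set" where
  "cox_class I m u = {v. coxeter_cong I m u v}"

definition coxeter_group :: "'i set \<Rightarrow> ('i \<Rightarrow> 'i \<Rightarrow> nat) \<Rightarrow> 'i list set monoid" where
  "coxeter_group I m =
    \<lparr>carrier = cox_class I m ` lists I,
     monoid.mult = (\<lambda>X Y. \<Union>x\<in>X. \<Union>y\<in>Y. cox_class I m (x @ y)),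
     one = cox_class I m []\<rparr>"

definition simple_refl :: "'i set \<Rightarrow> ('i \<Rightarrow> 'i \<Rightarrow> nat) \<Rightarrow> 'i \<Rightarrow> 'i list set" where
  "simple_refl I m i = cox_class I m [i]"

definition reflections :: "'i set \<Rightarrow> ('i \<Rightarrow> 'i \<Rightarrow> nat) \<Rightarrow> 'i list set set" where
  "reflections I m =
    {w \<otimes>\<^bsub>coxeter_group I m\<^esub> simple_refl I m i \<otimes>\<^bsub>coxeter_group I m\<^esub> inv\<^bsub>coxeter_group I m\<^esub> w | w i.
       w \<in> carrier (coxeter_group I m) \<and> i \<in> I}"

definition parabolic :: "'i set \<Rightarrow> ('i \<Rightarrow> 'i \<Rightarrow> nat) \<Rightarrow> 'i set \<Rightarrow> 'i list set set" where
  "parabolic I m J = generate (coxeter_group I m) (simple_refl I m ` J)"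


section \<open>The algebra Hhat(W)\<close>

datatype 'i gen = GenS 'i | GenD 'i

definition free_monoid :: "'x set \<Rightarrow> 'x list monoid" where
  "free_monoid X = \<lparr>carrier = lists X, mult = (@), one = []\<rparr>"

definition free_algebra :: "'i set \<Rightarrow> ('i gen list \<Rightarrow>\<^sub>0 int) ring" where
  "free_algebra I = monoid_ring (free_monoid (GenS ` I \<union> GenD ` I))"

text \<open>The word of length \<open>n\<close> in which \<open>i\<close> and \<open>j\<close> alternate, starting with \<open>i\<close>.\<close>

definition alternating :: "'i \<Rightarrow> 'i \<Rightarrow> nat \<Rightarrow> 'i list" where
  "alternating i j n = map (\<lambda>k. if even k then i else j) [0..<n]"

text \<open>In the last family the left word is \<open>D\<^sub>i s\<^sub>j s\<^sub>i \<dots>\<close> and the right word is \<open>s\<^sub>j \<dots> s\<^sub>j' D\<^sub>i'\<close>, where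
  \<open>i'\<close> is the last letter of the alternating word of length \<open>m i j\<close> starting with \<open>j\<close>.\<close>

definition hat_relations ::
  "'i set \<Rightarrow> ('i \<Rightarrow> 'i \<Rightarrow> nat) \<Rightarrow> ('i gen list \<Rightarrow>\<^sub>0 int) set" where
  "hat_relations I m =
     {frag_of [GenS i, GenS i] - frag_of [] | i. i \<in> I} \<union>
     {frag_of [GenD i, GenD i] - frag_of [GenD i] | i. i \<in> I} \<union>
     {frag_of [GenS i, GenD i] + frag_of [GenD i, GenS i] - (frag_of [GenS i] - frag_of [])
        | i. i \<in> I} \<union>
     {frag_of (concat (replicate (m i j) [GenS i, GenS j])) - frag_of []
        | i j. i \<in> I \<and> j \<in> I} \<union>
     {frag_of (GenD i # map GenS (tl (alternating i j (m i j)))) -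
      frag_of (map GenS (butlast (alternating j i (m i j))) @
               [GenD (last (alternating j i (m i j)))])
        | i j. i \<in> I \<and> j \<in> I \<and> i \<noteq> j \<and> m i j \<noteq> 0}"

definition hat_ideal ::
  "'i set \<Rightarrow> ('i \<Rightarrow> 'i \<Rightarrow> nat) \<Rightarrow> ('i gen list \<Rightarrow>\<^sub>0 int) set" where
  "hat_ideal I m = Idl\<^bsub>free_algebra I\<^esub> (hat_relations I m)"

definition hatH ::
  "'i set \<Rightarrow> ('i \<Rightarrow> 'i \<Rightarrow> nat) \<Rightarrow> ('i gen list \<Rightarrow>\<^sub>0 int) set ring" where
  "hatH I m = free_algebra I Quot hat_ideal I m"

definition hat_gen ::
  "'i set \<Rightarrow> ('i \<Rightarrow> 'i \<Rightarrow> nat) \<Rightarrow> 'i gen \<Rightarrow> ('i gen list \<Rightarrow>\<^sub>0 int) set" where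
  "hat_gen I m g = hat_ideal I m +>\<^bsub>free_algebra I\<^esub> frag_of [g]"

abbreviation hat_s ::
  "'i set \<Rightarrow> ('i \<Rightarrow> 'i \<Rightarrow> nat) \<Rightarrow> 'i \<Rightarrow> ('i gen list \<Rightarrow>\<^sub>0 int) set" where
  "hat_s I m i \<equiv> hat_gen I m (GenS i)"

abbreviation hat_D ::
  "'i set \<Rightarrow> ('i \<Rightarrow> 'i \<Rightarrow> nat) \<Rightarrow> 'i \<Rightarrow> ('i gen list \<Rightarrow>\<^sub>0 int) set" where
  "hat_D I m i \<equiv> hat_gen I m (GenD i)"

text \<open>The structure maps are determined by their values on generators: the coproduct and the counit
  as algebra homomorphisms, the antipode as an algebra anti-homomorphism.\<close>

fun comult_gen :: "'i set \<Rightarrow> ('i \<Rightarrow> 'i \<Rightarrow> nat) \<Rightarrow> 'i gen \<Rightarrow>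
    (('i gen list \<Rightarrow>\<^sub>0 int) set \<times> ('i gen list \<Rightarrow>\<^sub>0 int) set \<Rightarrow>\<^sub>0 int) set" where
  "comult_gen I m (GenS i) = pure_tensor (hatH I m) (hatH I m) (hat_s I m i) (hat_s I m i)"
| "comult_gen I m (GenD i) =
     pure_tensor (hatH I m) (hatH I m) (hat_D I m i) \<one>\<^bsub>hatH I m\<^esub>
       \<oplus>\<^bsub>tensor (hatH I m) (hatH I m)\<^esub>
     pure_tensor (hatH I m) (hatH I m) (hat_s I m i) (hat_D I m i)"

fun counit_gen :: "'i gen \<Rightarrow> int" where
  "counit_gen (GenS i) = 1"
| "counit_gen (GenD i) = 0"

fun antipode_gen ::
  "'i set \<Rightarrow> ('i \<Rightarrow> 'i \<Rightarrow> nat) \<Rightarrow> 'i gen \<Rightarrow> ('i gen list \<Rightarrow>\<^sub>0 int) set" where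
  "antipode_gen I m (GenS i) = hat_s I m i"
| "antipode_gen I m (GenD i) = \<ominus>\<^bsub>hatH I m\<^esub> (hat_s I m i \<otimes>\<^bsub>hatH I m\<^esub> hat_D I m i)"

definition hat_comult :: "'i set \<Rightarrow> ('i \<Rightarrow> 'i \<Rightarrow> nat) \<Rightarrow> ('i gen list \<Rightarrow>\<^sub>0 int) set \<Rightarrow>
    (('i gen list \<Rightarrow>\<^sub>0 int) set \<times> ('i gen list \<Rightarrow>\<^sub>0 int) set \<Rightarrow>\<^sub>0 int) set" where
  "hat_comult I m = descend (additive_ext (tensor (hatH I m) (hatH I m))
     (\<lambda>u. list_prod (tensor (hatH I m) (hatH I m)) (map (comult_gen I m) u)))"

definition hat_counit :: "('i gen list \<Rightarrow>\<^sub>0 int) set \<Rightarrow> int" where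
  "hat_counit = descend (additive_ext \<Z> (\<lambda>u. list_prod \<Z> (map counit_gen u)))"

definition hat_antipode :: "'i set \<Rightarrow> ('i \<Rightarrow> 'i \<Rightarrow> nat) \<Rightarrow>
    ('i gen list \<Rightarrow>\<^sub>0 int) set \<Rightarrow> ('i gen list \<Rightarrow>\<^sub>0 int) set" where
  "hat_antipode I m = descend (additive_ext (hatH I m)
     (\<lambda>u. list_prod (hatH I m) (map (antipode_gen I m) (rev u))))"


section \<open>The subalgebras Dhat(\<open>W\<^sub>J\<close>), K(\<open>W\<^sub>J\<close>) and the ideal J(W)\<close>



definition hat_of_group :: "'i set \<Rightarrow> ('i \<Rightarrow> 'i \<Rightarrow> nat) \<Rightarrow>
    'i list set \<Rightarrow> ('i gen list \<Rightarrow>\<^sub>0 int) set" where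
  "hat_of_group I m = descend (\<lambda>u. list_prod (hatH I m) (map (hat_s I m) u))"

text \<open>The unique family \<open>D\<^sub>s\<close>, \<open>s\<close> a reflection, with the defining properties; outside the
  reflections it is \<open>undefined\<close>.\<close>

definition refl_D :: "'i set \<Rightarrow> ('i \<Rightarrow> 'i \<Rightarrow> nat) \<Rightarrow>
    'i list set \<Rightarrow> ('i gen list \<Rightarrow>\<^sub>0 int) set" where
  "refl_D I m = (THE d.
     d \<in> reflections I m \<rightarrow>\<^sub>E carrier (hatH I m) \<and>
     (\<forall>i\<in>I. d (simple_refl I m i) = hat_D I m i) \<and>
     (\<forall>i\<in>I. \<forall>s\<in>reflections I m - {simple_refl I m i}.
        d (simple_refl I m i \<otimes>\<^bsub>coxeter_group I m\<^esub> s \<otimes>\<^bsub>coxeter_group I m\<^esub> simple_refl I m i) =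
        hat_s I m i \<otimes>\<^bsub>hatH I m\<^esub> d s \<otimes>\<^bsub>hatH I m\<^esub> hat_s I m i))"

definition D_gens ::
  "'i set \<Rightarrow> ('i \<Rightarrow> 'i \<Rightarrow> nat) \<Rightarrow> 'i set \<Rightarrow> ('i gen list \<Rightarrow>\<^sub>0 int) set set" where
  "D_gens I m J = refl_D I m ` (reflections I m \<inter> parabolic I m J)"

definition hatD ::
  "'i set \<Rightarrow> ('i \<Rightarrow> 'i \<Rightarrow> nat) \<Rightarrow> 'i set \<Rightarrow> ('i gen list \<Rightarrow>\<^sub>0 int) set set" where
  "hatD I m J = generate_ring (hatH I m) (D_gens I m J)"

definition hatD_degree_le ::
  "'i set \<Rightarrow> ('i \<Rightarrow> 'i \<Rightarrow> nat) \<Rightarrow> 'i set \<Rightarrow> nat \<Rightarrow> ('i gen list \<Rightarrow>\<^sub>0 int) set set" where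
  "hatD_degree_le I m J r =
    int_span (hatH I m) {list_prod (hatH I m) ds | ds. set ds \<subseteq> D_gens I m J \<and> length ds \<le> r}"

definition K_alg ::
  "'i set \<Rightarrow> ('i \<Rightarrow> 'i \<Rightarrow> nat) \<Rightarrow> 'i set \<Rightarrow> ('i gen list \<Rightarrow>\<^sub>0 int) set set" where
  "K_alg I m J =
    (\<Inter>w\<in>parabolic I m J.
       (\<lambda>x. hat_of_group I m w \<otimes>\<^bsub>hatH I m\<^esub> x
              \<otimes>\<^bsub>hatH I m\<^esub> hat_of_group I m (inv\<^bsub>coxeter_group I m\<^esub> w)) ` hatD I m J)"

definition K_pair ::
  "'i set \<Rightarrow> ('i \<Rightarrow> 'i \<Rightarrow> nat) \<Rightarrow> 'i \<Rightarrow> 'i \<Rightarrow> ('i gen list \<Rightarrow>\<^sub>0 int) set set" where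
  "K_pair I m i j =
    {x \<in> K_alg I m {i, j}. hat_counit x = 0 \<and> x \<in> hatD_degree_le I m {i, j} (m i j)}"

definition J_ideal ::
  "'i set \<Rightarrow> ('i \<Rightarrow> 'i \<Rightarrow> nat) \<Rightarrow> ('i gen list \<Rightarrow>\<^sub>0 int) set set" where
  "J_ideal I m =
    Idl\<^bsub>hatH I m\<^esub> (\<Union>i\<in>I. \<Union>j\<in>I - {i}. K_pair I m i j)"

end

theory Submission
  imports Defs Complex_Main
begin

text \<open>
  Let \<open>x \<in> K(W\<^sub>i\<^sub>j)\<close> have degree at most \<open>m = m\<^sub>i\<^sub>j\<close>. As \<open>\<Delta>(D\<^sub>s) = D\<^sub>s \<otimes> 1 + s \<otimes> D\<^sub>s\<close>, the subalgebra \<open>D(W\<^sub>i\<^sub>j)\<close>,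
  its conjugates under \<open>W\<^sub>i\<^sub>j\<close> and its part of degree at most \<open>m\<close> are left coideals, so \<open>\<Delta>(x)\<close>
  lies in \<open>H \<otimes> L\<close> for each of these subgroups \<open>L\<close>. Since \<open>H\<close> is a free abelian group, \<open>\<Delta>(x)\<close> then lies
  in \<open>H \<otimes> L\<close> for their intersection \<open>L\<close> too, and removing the counit gives
  \<open>\<Delta>(x) - x \<otimes> 1 \<in> H \<otimes> K\<^sub>i\<^sub>j\<close> if \<open>\<epsilon>(x) = 0\<close>. Hence the ideal generated by the \<open>K\<^sub>i\<^sub>j\<close> is a coideal, and the
  antipode axiom turns this into \<open>S(x) \<in> H K\<^sub>i\<^sub>j\<close>.

  A basis of \<open>H\<close> consists of the products of a word in the \<open>D\<^sub>s\<close> without equal adjacent letters and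
  an element of \<open>W\<close>. Independence is seen after the substitution \<open>D\<^sub>s = E\<^sub>s + (1 - s) / 2\<close> over the
  reals, for which \<open>E\<^sub>s\<^sup>2 = 0\<close> and conjugation permutes the \<open>E\<^sub>s\<close> up to sign. The sign is the cocycle by
  which \<open>W\<close> acts on its root system, realised as the set of pairs of a reflection and a sign.
\<close>

section \<open>Additive extension and monoid rings\<close>

text \<open>Two obstacles shape the proof. First, over the integers tensor products do not in
  general respect inclusions or intersections, and \<open>K_alg\<close> intersects one conjugate for
  each element of a possibly infinite group. No complement of \<open>L\<close> in \<open>H\<close>
  is at hand; the freeness of the left tensor factor replaces it, since coordinates there cut an
  element of H tensor H into slices. Second, freeness needs \<open>D t\<close> to be independent of
  the element that conjugates a simple reflection to \<open>t\<close>. The defining relations give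
  this only for certain words in two letters; the general case follows by an induction over elements
  carrying a simple root to a simple root. Both this induction and the representation of
  \<open>H\<close> need the product of two simple reflections to have no smaller order than
  \<open>m i j\<close>, which a presentation does not show; a linear representation of the group
  supplies it.

  The shift by (1 - s) / 2 is forced: it turns s D + D s = s - 1 into s E + E s = 0, and then D D =
  D into E E = 0. Relations without lower order terms can be realised directly on words.\<close>

context abelian_group
begin

lemma int_add_pow_zero [simp]: "add_pow G (0::int) x = \<zero>"
  using int_pow_0[of "add_monoid G"] by (simp add: add_pow_def)

lemma int_add_pow_one [simp]: "x \<in> carrier G \<Longrightarrow> add_pow G (1::int) x = x"
  using add.int_pow_1[of x] by (simp add: add_pow_def)

lemma int_add_pow_closed [simp]: "x \<in> carrier G \<Longrightarrow> add_pow G (n::int) x \<in> carrier G"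
  using add.int_pow_closed[of x n] by (simp add: add_pow_def)

lemma int_add_pow_add:
  "x \<in> carrier G \<Longrightarrow> add_pow G (n + k::int) x = add_pow G n x \<oplus> add_pow G k x"
  using add.int_pow_mult[of x n k] by (simp add: add_pow_def)

lemma int_add_pow_minus:
  "x \<in> carrier G \<Longrightarrow> add_pow G (- n::int) x = \<ominus> add_pow G n x"
  using add.int_pow_neg[of x n] by (simp add: add_pow_def a_inv_def)

lemma int_add_pow_pow:
  "x \<in> carrier G \<Longrightarrow> add_pow G (n::int) (add_pow G (k::int) x) = add_pow G (n * k) x"
  using add.int_pow_pow[of x n k] by (simp add: add_pow_def mult.commute)

lemma int_add_pow_distrib:
  "x \<in> carrier G \<Longrightarrow> y \<in> carrier G \<Longrightarrow>
    add_pow G (n::int) (x \<oplus> y) = add_pow G n x \<oplus> add_pow G n y"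
  using add.int_pow_distrib[of x y n] by (simp add: add_pow_def)

text \<open>Enlarging the index set puts mappings with different supports, such as two summands and
  their sum, over a common finite set.\<close>

lemma additive_ext_superset:
  assumes "finite K" "Poly_Mapping.keys p \<subseteq> K" "f \<in> K \<rightarrow> carrier G"
  shows "additive_ext G f p = (\<Oplus>k\<in>K. add_pow G (Poly_Mapping.lookup p k) (f k))"
  unfolding additive_ext_def
  by (rule add.finprod_mono_neutral_cong_left) (use assms in \<open>auto simp: in_keys_iff\<close>)

lemma additive_ext_zero [simp]: "additive_ext G f 0 = \<zero>"
  by (simp add: additive_ext_def)

lemma additive_ext_frag_of [simp]: "f x \<in> carrier G \<Longrightarrow> additive_ext G f (frag_of x) = f x"
  by (simp add: additive_ext_def)

lemma additive_ext_closed: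
  assumes "Poly_Mapping.keys p \<subseteq> S" "f \<in> S \<rightarrow> carrier G"
  shows "additive_ext G f p \<in> carrier G"
  unfolding additive_ext_def
  by (rule finsum_closed) (use assms in auto)

lemma additive_ext_add:
  assumes "Poly_Mapping.keys p \<subseteq> S" "Poly_Mapping.keys q \<subseteq> S" "f \<in> S \<rightarrow> carrier G"
  shows "additive_ext G f (p + q) = additive_ext G f p \<oplus> additive_ext G f q"
proof -
  let ?K = "Poly_Mapping.keys p \<union> Poly_Mapping.keys q"
  have K: "finite ?K" "f \<in> ?K \<rightarrow> carrier G" "Poly_Mapping.keys (p + q) \<subseteq> ?K"
    using assms Poly_Mapping.keys_add[of p q] by auto
  have fc: "f k \<in> carrier G" if "k \<in> ?K" for k
    using K(2) that by (rule funcset_mem)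
  have "additive_ext G f (p + q) =
      (\<Oplus>k\<in>?K. add_pow G (Poly_Mapping.lookup p k) (f k) \<oplus> add_pow G (Poly_Mapping.lookup q k) (f k))"
    unfolding additive_ext_superset[OF K(1,3,2)]
    by (rule finsum_cong') (use fc in \<open>auto simp: lookup_add int_add_pow_add simp del: Un_iff\<close>)
  also have "\<dots> = (\<Oplus>k\<in>?K. add_pow G (Poly_Mapping.lookup p k) (f k)) \<oplus>
      (\<Oplus>k\<in>?K. add_pow G (Poly_Mapping.lookup q k) (f k))"
    by (rule finsum_addf) (use fc in \<open>auto simp del: Un_iff\<close>)
  finally show ?thesis
    using K by (simp add: additive_ext_superset[of ?K])
qed

lemma additive_ext_minus:
  assumes "Poly_Mapping.keys p \<subseteq> S" "f \<in> S \<rightarrow> carrier G"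
  shows "additive_ext G f (- p) = \<ominus> additive_ext G f p"
proof -
  have "additive_ext G f p \<oplus> additive_ext G f (- p) = \<zero>"
    using additive_ext_add[of p S "- p" f] assms by simp
  moreover have "additive_ext G f p \<in> carrier G" "additive_ext G f (- p) \<in> carrier G"
    using assms by (auto intro!: additive_ext_closed[of _ S])
  ultimately show ?thesis by (metis add.inv_equality a_comm a_inv_def)
qed

lemma additive_ext_diff:
  assumes "Poly_Mapping.keys p \<subseteq> S" "Poly_Mapping.keys q \<subseteq> S" "f \<in> S \<rightarrow> carrier G"
  shows "additive_ext G f (p - q) = additive_ext G f p \<ominus> additive_ext G f q"
  using additive_ext_add[of p S "- q" f] additive_ext_minus[of q S f] assms
  by (simp add: minus_eq)

lemma int_span_subgroup: "X \<subseteq> carrier G \<Longrightarrow> subgroup (int_span G X) (add_monoid G)"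
  unfolding int_span_def by (rule add.generate_is_subgroup) simp

lemma int_span_minimal: "X \<subseteq> H \<Longrightarrow> subgroup H (add_monoid G) \<Longrightarrow> int_span G X \<subseteq> H"
  unfolding int_span_def by (rule add.generate_subgroup_incl)

lemma int_span_superset: "X \<subseteq> int_span G X"
  unfolding int_span_def by (auto intro: generate.incl)

lemma int_span_induct [consumes 2, case_names zero incl minus add]:
  assumes "t \<in> int_span G X" "X \<subseteq> carrier G" "P \<zero>" "\<And>x. x \<in> X \<Longrightarrow> P x"
    and "\<And>x. x \<in> X \<Longrightarrow> P x \<Longrightarrow> P (\<ominus> x)"
    and "\<And>x y. x \<in> carrier G \<Longrightarrow> y \<in> carrier G \<Longrightarrow> P x \<Longrightarrow> P y \<Longrightarrow> P (x \<oplus> y)"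
  shows "P t"
proof -
  have "t \<in> carrier G \<and> P t"
    using assms(1) unfolding int_span_def
  proof (induction t rule: generate.induct)
    case (inv h)
    then have "inv\<^bsub>add_monoid G\<^esub> h = \<ominus> h" by (simp add: a_inv_def)
    then show ?case using assms(2,4,5) inv by auto
  qed (use assms in auto)
  then show ?thesis ..
qed

end

lemma (in abelian_group_hom) hom_int_span_zero:
  assumes "t \<in> int_span G X" "X \<subseteq> carrier G" "\<And>x. x \<in> X \<Longrightarrow> h x = \<zero>\<^bsub>H\<^esub>"
  shows "h t = \<zero>\<^bsub>H\<^esub>"
  using assms(1,2)
  by (induction t rule: G.int_span_induct) (use assms(2,3) in auto)

lemma abelian_group_hom_mem:
  assumes "abelian_group A" "abelian_group B" "h \<in> hom (add_monoid A) (add_monoid B)"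
  shows "abelian_group_hom A B h"
  using assms by (auto intro!: abelian_group_homI simp: group_hom_def group_hom_axioms_def
      abelian_group.a_group)

lemma abelian_group_homI':
  assumes "abelian_group A" "abelian_group B"
    and "\<And>x. x \<in> carrier A \<Longrightarrow> h x \<in> carrier B"
    and "\<And>x y. x \<in> carrier A \<Longrightarrow> y \<in> carrier A \<Longrightarrow> h (x \<oplus>\<^bsub>A\<^esub> y) = h x \<oplus>\<^bsub>B\<^esub> h y"
  shows "abelian_group_hom A B h"
  using assms by (intro abelian_group_hom_mem) (auto simp: hom_def)

lemma ring_hom_abelian_group_hom:
  assumes "ring A" "ring B" "h \<in> ring_hom A B"
  shows "abelian_group_hom A B h"
  using assms by (auto intro!: abelian_group_homI' simp: ring_hom_def ring.is_abelian_group)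

lemma (in abelian_group_hom) hom_minus:
  "x \<in> carrier G \<Longrightarrow> y \<in> carrier G \<Longrightarrow> h (x \<ominus>\<^bsub>G\<^esub> y) = h x \<ominus>\<^bsub>H\<^esub> h y"
  by (simp add: G.minus_eq H.minus_eq)

section \<open>Monoid rings and their universal property\<close>

lemma monoid_ring_sel [simp]:
  "carrier (monoid_ring G) = {p. Poly_Mapping.keys p \<subseteq> carrier G}"
  "\<zero>\<^bsub>monoid_ring G\<^esub> = 0" "\<one>\<^bsub>monoid_ring G\<^esub> = frag_of \<one>\<^bsub>G\<^esub>"
  "p \<oplus>\<^bsub>monoid_ring G\<^esub> q = p + q"
  by (simp_all add: monoid_ring_def)

lemma monoid_ring_mult:
  "p \<otimes>\<^bsub>monoid_ring G\<^esub> q = frag_extend (\<lambda>x. frag_extend (\<lambda>y. frag_of (x \<otimes>\<^bsub>G\<^esub> y)) q) p"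
  by (simp add: monoid_ring_def)

lemma monoid_ring_mult_of [simp]:
  "frag_of x \<otimes>\<^bsub>monoid_ring G\<^esub> frag_of y = frag_of (x \<otimes>\<^bsub>G\<^esub> y)"
  by (simp add: monoid_ring_mult)

lemma monoid_ring_mult_zero [simp]:
  "0 \<otimes>\<^bsub>monoid_ring G\<^esub> q = 0" "p \<otimes>\<^bsub>monoid_ring G\<^esub> 0 = 0"
  by (auto simp add: monoid_ring_mult intro: frag_extend_eq_0)

lemma monoid_ring_mult_diff:
  fixes G :: "('a, 'b) monoid_scheme"
  shows "(p - p') \<otimes>\<^bsub>monoid_ring G\<^esub> q = p \<otimes>\<^bsub>monoid_ring G\<^esub> q - p' \<otimes>\<^bsub>monoid_ring G\<^esub> q"
    and "p \<otimes>\<^bsub>monoid_ring G\<^esub> (q - q') = p \<otimes>\<^bsub>monoid_ring G\<^esub> q - p \<otimes>\<^bsub>monoid_ring G\<^esub> q'"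
proof -
  show "(p - p') \<otimes>\<^bsub>monoid_ring G\<^esub> q = p \<otimes>\<^bsub>monoid_ring G\<^esub> q - p' \<otimes>\<^bsub>monoid_ring G\<^esub> q"
    by (simp add: monoid_ring_mult frag_extend_diff)
  show "p \<otimes>\<^bsub>monoid_ring G\<^esub> (q - q') = p \<otimes>\<^bsub>monoid_ring G\<^esub> q - p \<otimes>\<^bsub>monoid_ring G\<^esub> q'"
    using subset_UNIV[of "Poly_Mapping.keys p"]
    by (induction p rule: frag_induction) (simp_all add: monoid_ring_mult frag_extend_diff)
qed

lemma monoid_ring_mult_add:
  "(p + p') \<otimes>\<^bsub>monoid_ring G\<^esub> q = p \<otimes>\<^bsub>monoid_ring G\<^esub> q + p' \<otimes>\<^bsub>monoid_ring G\<^esub> q"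
  "p \<otimes>\<^bsub>monoid_ring G\<^esub> (q + q') = p \<otimes>\<^bsub>monoid_ring G\<^esub> q + p \<otimes>\<^bsub>monoid_ring G\<^esub> q'"
  using monoid_ring_mult_diff(1)[of G p "- p'" q] monoid_ring_mult_diff(2)[of G p q "- q'"]
    monoid_ring_mult_diff(1)[of G 0 "p'" q] monoid_ring_mult_diff(2)[of G p 0 "q'"] by simp_all

lemma frag_span_induct [consumes 1, case_names zero one diff]:
  assumes "Poly_Mapping.keys c \<subseteq> S" "P 0" "\<And>x. x \<in> S \<Longrightarrow> P (frag_of x)"
    and "\<And>a b. Poly_Mapping.keys a \<subseteq> S \<Longrightarrow> Poly_Mapping.keys b \<subseteq> S \<Longrightarrow> P a \<Longrightarrow> P b \<Longrightarrow> P (a - b)"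
  shows "P c"
proof -
  have "Poly_Mapping.keys c \<subseteq> S \<and> P c"
    using assms(1)
  proof (induction c rule: frag_induction)
    case (diff a b)
    then show ?case using keys_diff[of a b] assms(4)[of a b] by blast
  qed (use assms(2,3) in auto)
  then show ?thesis ..
qed

lemma keys_diff_subset:
  "Poly_Mapping.keys p \<subseteq> S \<Longrightarrow> Poly_Mapping.keys q \<subseteq> S \<Longrightarrow> Poly_Mapping.keys (p - q) \<subseteq> S"
  using keys_diff[of p q] by blast

lemma monoid_ring_mult_closed:
  assumes "monoid G" "Poly_Mapping.keys p \<subseteq> carrier G" "Poly_Mapping.keys q \<subseteq> carrier G"
  shows "Poly_Mapping.keys (p \<otimes>\<^bsub>monoid_ring G\<^esub> q) \<subseteq> carrier G"
  using assms(2)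
proof (induction p rule: frag_induction)
  case (one x)
  show ?case using assms(3)
    by (induction q rule: frag_induction)
      (use one assms(1) in \<open>simp_all add: monoid_ring_mult_diff monoid.m_closed keys_diff_subset\<close>)
qed (simp_all add: monoid_ring_mult_diff keys_diff_subset)

lemma ring_monoid_ring:
  assumes "monoid G"
  shows "ring (monoid_ring G)"
proof (rule ringI)
  show "abelian_group (monoid_ring G)"
  proof (rule abelian_groupI)
    fix p assume "p \<in> carrier (monoid_ring G)"
    then show "\<exists>y\<in>carrier (monoid_ring G). y \<oplus>\<^bsub>monoid_ring G\<^esub> p = \<zero>\<^bsub>monoid_ring G\<^esub>"
      by (intro bexI[of _ "- p"]) auto
  next
    fix p q assume "p \<in> carrier (monoid_ring G)" "q \<in> carrier (monoid_ring G)"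
    then show "p \<oplus>\<^bsub>monoid_ring G\<^esub> q \<in> carrier (monoid_ring G)"
      using Poly_Mapping.keys_add[of p q] by auto
  qed (auto simp: add.assoc add.commute)
  show "Group.monoid (monoid_ring G)"
  proof (rule monoidI)
    fix p q r
    assume "p \<in> carrier (monoid_ring G)" "q \<in> carrier (monoid_ring G)" "r \<in> carrier (monoid_ring G)"
    then have *: "Poly_Mapping.keys p \<subseteq> carrier G" "Poly_Mapping.keys q \<subseteq> carrier G"
      "Poly_Mapping.keys r \<subseteq> carrier G" by auto
    from *(1) show "p \<otimes>\<^bsub>monoid_ring G\<^esub> q \<otimes>\<^bsub>monoid_ring G\<^esub> r = p \<otimes>\<^bsub>monoid_ring G\<^esub> (q \<otimes>\<^bsub>monoid_ring G\<^esub> r)"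
    proof (induction p rule: frag_induction)
      case x: (one x)
      from *(2) show ?case
      proof (induction q rule: frag_induction)
        case y: (one y)
        from *(3) show ?case
          by (induction r rule: frag_induction)
            (use x y in \<open>auto simp: monoid_ring_mult_diff monoid.m_assoc[OF assms]\<close>)
      qed (auto simp: monoid_ring_mult_diff)
    qed (auto simp: monoid_ring_mult_diff)
  next
    fix p assume "p \<in> carrier (monoid_ring G)"
    then have *: "Poly_Mapping.keys p \<subseteq> carrier G" by simp
    from * show "\<one>\<^bsub>monoid_ring G\<^esub> \<otimes>\<^bsub>monoid_ring G\<^esub> p = p"
      by (induction p rule: frag_induction) (auto simp: monoid_ring_mult_diff monoid.l_one[OF assms])
    from * show "p \<otimes>\<^bsub>monoid_ring G\<^esub> \<one>\<^bsub>monoid_ring G\<^esub> = p"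
      by (induction p rule: frag_induction) (auto simp: monoid_ring_mult_diff monoid.r_one[OF assms])
  qed (use monoid_ring_mult_closed[OF assms] monoid.one_closed[OF assms] in auto)
qed (auto simp: monoid_ring_mult_add)

lemma monoid_ring_minus:
  assumes "monoid G" "Poly_Mapping.keys p \<subseteq> carrier G" "Poly_Mapping.keys q \<subseteq> carrier G"
  shows "p \<ominus>\<^bsub>monoid_ring G\<^esub> q = p - q"
proof -
  interpret ring "monoid_ring G" by (rule ring_monoid_ring) fact
  have "\<ominus>\<^bsub>monoid_ring G\<^esub> q = - q"
    by (rule minus_equality) (use assms in auto)
  then show ?thesis by (simp add: a_minus_def)
qed

lemma additive_ext_hom:
  assumes "monoid G" "abelian_group C" "f \<in> carrier G \<rightarrow> carrier C"
  shows "abelian_group_hom (monoid_ring G) C (additive_ext C f)"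
  using assms
  by (intro abelian_group_homI')
    (auto intro!: abelian_group.additive_ext_closed[of C _ "carrier G"]
       abelian_group.additive_ext_add[of C _ "carrier G"] ring.is_abelian_group ring_monoid_ring)

text \<open>Both sides of multiplicativity are biadditive in the two arguments, so inductions over
  the supports leave only basis elements, where it is the assumption \<open>mult\<close>.\<close>

lemma additive_ext_ring_hom:
  assumes G: "monoid G" and C: "ring C" and f: "f \<in> carrier G \<rightarrow> carrier C"
    and mult: "\<And>x y. x \<in> carrier G \<Longrightarrow> y \<in> carrier G \<Longrightarrow> f (x \<otimes>\<^bsub>G\<^esub> y) = f x \<otimes>\<^bsub>C\<^esub> f y"
    and one: "f \<one>\<^bsub>G\<^esub> = \<one>\<^bsub>C\<^esub>"
  shows "additive_ext C f \<in> ring_hom (monoid_ring G) C"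
proof -
  interpret C: ring C by fact
  interpret h: abelian_group_hom "monoid_ring G" C "additive_ext C f"
    by (rule additive_ext_hom) (use G C f C.is_abelian_group in auto)
  note cl = C.additive_ext_closed[of _ "carrier G" f, OF _ f]
  note di = C.additive_ext_diff[of _ "carrier G" _ f, OF _ _ f]
  have fc: "f x \<in> carrier C" if "x \<in> carrier G" for x using f that by auto
  have of_c: "Poly_Mapping.keys (frag_of x :: 'a \<Rightarrow>\<^sub>0 int) \<subseteq> carrier G" if "x \<in> carrier G" for x
    using that by simp
  have m: "additive_ext C f (p \<otimes>\<^bsub>monoid_ring G\<^esub> q) = additive_ext C f p \<otimes>\<^bsub>C\<^esub> additive_ext C f q"
    if p: "Poly_Mapping.keys p \<subseteq> carrier G" and q: "Poly_Mapping.keys q \<subseteq> carrier G" for p q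
    using p
  proof (induction p rule: frag_span_induct)
    case zero
    then show ?case using cl[OF q] by simp
  next
    case (one x)
    show ?case using q
    proof (induction q rule: frag_span_induct)
      case zero
      then show ?case using one fc by simp
    next
      case (one y)
      then show ?case using \<open>x \<in> carrier G\<close> fc mult G by (simp add: monoid.m_closed)
    next
      case (diff a b)
      then show ?case
        using \<open>x \<in> carrier G\<close>
        by (simp add: fc monoid_ring_mult_diff di cl monoid_ring_mult_closed[OF G] of_c
            C.minus_eq C.r_distr C.r_minus)
    qed
  next
    case (diff a b)
    then show ?case
      by (simp add: monoid_ring_mult_diff di cl q monoid_ring_mult_closed[OF G]
          C.minus_eq C.l_distr C.l_minus)
  qed
  show ?thesis
    by (rule ring_hom_memI)
      (use m one C.one_closed monoid.one_closed[OF G] fc h.hom_add in \<open>auto simp: cl\<close>)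
qed

section \<open>Maps on quotients\<close>

lemma (in ideal) quot_elem:
  assumes "X \<in> carrier (R Quot I)"
  obtains x where "x \<in> carrier R" "X = I +> x"
  using assms by (auto simp: FactRing_def A_RCOSETS_def RCOSETS_def a_r_coset_def)

lemma (in ideal) quot_simps [simp]:
  "x \<in> carrier R \<Longrightarrow> I +> x \<in> carrier (R Quot I)"
  "x \<in> carrier R \<Longrightarrow> y \<in> carrier R \<Longrightarrow> (I +> x) \<oplus>\<^bsub>R Quot I\<^esub> (I +> y) = I +> (x \<oplus> y)"
  "x \<in> carrier R \<Longrightarrow> y \<in> carrier R \<Longrightarrow> (I +> x) \<otimes>\<^bsub>R Quot I\<^esub> (I +> y) = I +> (x \<otimes> y)"
  "\<one>\<^bsub>R Quot I\<^esub> = I +> \<one>"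
  using rcos_ring_hom by (auto simp: ring_hom_def FactRing_def)

lemma (in ideal) quot_eq_zero_iff:
  "x \<in> carrier R \<Longrightarrow> I +> x = \<zero>\<^bsub>R Quot I\<^esub> \<longleftrightarrow> x \<in> I"
  using rcos_const_imp_mem[of x] a_coset_join2[OF _ a_subgroup, of x]
  unfolding FactRing_def by fastforce

text \<open>Equality of cosets becomes membership of a difference, the form in which defining
  relations are later fed into quotients.\<close>

lemma (in ideal) quot_eq_iff:
  "x \<in> carrier R \<Longrightarrow> y \<in> carrier R \<Longrightarrow> I +> x = I +> y \<longleftrightarrow> x \<ominus> y \<in> I"
  using quotient_eq_iff_same_a_r_cos[OF is_ideal] by auto

text \<open>An additive map that kills the ideal is constant on each coset, so the image of a coset
  is a singleton and \<open>the_elem\<close> picks its only element.\<close>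

lemma (in ideal) descend_coset:
  assumes "abelian_group_hom R C h" "\<And>j. j \<in> I \<Longrightarrow> h j = \<zero>\<^bsub>C\<^esub>" "x \<in> carrier R"
  shows "descend h (I +> x) = h x"
proof -
  interpret h: abelian_group_hom R C h by fact
  have "y = h x" if "y \<in> h ` (I +> x)" for y
  proof -
    obtain j where "j \<in> I" "y = h (j \<oplus> x)"
      using \<open>y \<in> _\<close> by (auto simp: a_r_coset_def r_coset_def)
    then show ?thesis using assms(2,3) Icarr by simp
  qed
  then have "h ` (I +> x) = {h x}"
    using a_rcos_self[OF assms(3)] by blast
  then show ?thesis by (simp add: descend_def)
qed

lemma (in ideal) descend_hom:
  assumes h: "abelian_group_hom R C h" and z: "\<And>j. j \<in> I \<Longrightarrow> h j = \<zero>\<^bsub>C\<^esub>"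
  shows "abelian_group_hom (R Quot I) C (descend h)"
proof -
  interpret h: abelian_group_hom R C h by fact
  interpret Q: ring "R Quot I" by (rule quotient_is_ring)
  show ?thesis
  proof (rule abelian_group_homI')
    fix X Y assume "X \<in> carrier (R Quot I)" "Y \<in> carrier (R Quot I)"
    then show "descend h (X \<oplus>\<^bsub>R Quot I\<^esub> Y) = descend h X \<oplus>\<^bsub>C\<^esub> descend h Y"
      by (elim quot_elem) (simp add: descend_coset[OF h z])
  qed (auto elim!: quot_elem simp: descend_coset[OF h z] h.H.abelian_group_axioms Q.is_abelian_group)
qed

lemma (in ideal) descend_ring_hom:
  assumes "ring C" "h \<in> ring_hom R C" and z: "\<And>j. j \<in> I \<Longrightarrow> h j = \<zero>\<^bsub>C\<^esub>"
  shows "descend h \<in> ring_hom (R Quot I) C"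
proof -
  have h: "abelian_group_hom R C h"
    by (rule ring_hom_abelian_group_hom[OF ring_axioms assms(1,2)])
  interpret d: abelian_group_hom "R Quot I" C "descend h"
    by (rule descend_hom[OF h z])
  show ?thesis
  proof (rule ring_hom_memI)
    fix X Y assume "X \<in> carrier (R Quot I)" "Y \<in> carrier (R Quot I)"
    then show "descend h (X \<otimes>\<^bsub>R Quot I\<^esub> Y) = descend h X \<otimes>\<^bsub>C\<^esub> descend h Y"
      using assms(2) by (elim quot_elem) (simp add: descend_coset[OF h z] ring_hom_mult)
  next
    fix X Y assume "X \<in> carrier (R Quot I)" "Y \<in> carrier (R Quot I)"
    then show "descend h (X \<oplus>\<^bsub>R Quot I\<^esub> Y) = descend h X \<oplus>\<^bsub>C\<^esub> descend h Y"
      by (rule d.hom_add)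
  qed (use ring_hom_one[OF assms(2)] in \<open>auto simp: descend_coset[OF h z]\<close>)
qed

lemma (in ring) genideal_kernel:
  assumes "ring C" "h \<in> ring_hom R C" "X \<subseteq> carrier R" "\<And>x. x \<in> X \<Longrightarrow> h x = \<zero>\<^bsub>C\<^esub>" "j \<in> Idl X"
  shows "h j = \<zero>\<^bsub>C\<^esub>"
proof -
  interpret h: ring_hom_ring R C h
    by (rule ring_hom_ringI2[OF ring_axioms assms(1,2)])
  have "X \<subseteq> a_kernel R C h"
    unfolding a_kernel_def' using assms(3,4) by blast
  then have "Idl X \<subseteq> a_kernel R C h"
    by (rule genideal_minimal[OF h.kernel_is_ideal])
  then show ?thesis using assms(5) unfolding a_kernel_def' by blast
qed

section \<open>Tensor products\<close>

text \<open>The kernel of a map that is only additive need not be an ideal. The argument uses the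
  largest ideal inside it, the set of elements all of whose two-sided multiples are killed. It
  serves the lift to a tensor product, where no multiplicativity is assumed.\<close>

lemma (in ring) genideal_additive_kernel:
  assumes h: "abelian_group_hom R C h" and X: "X \<subseteq> carrier R"
    and z: "\<And>q x r. q \<in> carrier R \<Longrightarrow> x \<in> X \<Longrightarrow> r \<in> carrier R \<Longrightarrow> h (q \<otimes> x \<otimes> r) = \<zero>\<^bsub>C\<^esub>"
    and j: "j \<in> Idl X"
  shows "h j = \<zero>\<^bsub>C\<^esub>"
proof -
  interpret h: abelian_group_hom R C h by fact
  let ?H = "{p \<in> carrier R. \<forall>q\<in>carrier R. \<forall>r\<in>carrier R. h (q \<otimes> p \<otimes> r) = \<zero>\<^bsub>C\<^esub>}"
  have "ideal ?H R"
  proof (rule idealI)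
    show "ring R" by (rule ring_axioms)
    show "subgroup ?H (add_monoid R)"
    proof (rule add.subgroupI)
      show "?H \<noteq> {}" by (auto intro!: exI[of _ \<zero>])
      fix a b assume a: "a \<in> ?H"
      then show "\<ominus> a \<in> ?H"
        by (auto simp: l_minus r_minus)
      assume "b \<in> ?H"
      then show "a \<oplus> b \<in> ?H" using a
        by (auto simp: l_distr r_distr)
    qed auto
    fix a x assume a: "a \<in> ?H" and x: "x \<in> carrier R"
    then show "x \<otimes> a \<in> ?H"
      by (auto simp flip: m_assoc)
    show "a \<otimes> x \<in> ?H"
    proof (intro CollectI conjI ballI)
      fix q r assume "q \<in> carrier R" "r \<in> carrier R"
      then show "h (q \<otimes> (a \<otimes> x) \<otimes> r) = \<zero>\<^bsub>C\<^esub>"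
        using a x by (auto simp: m_assoc)
    qed (use a x in auto)
  qed
  moreover have "X \<subseteq> ?H" using X z by auto
  ultimately have "j \<in> ?H" using genideal_minimal j by blast
  then have "h (\<one> \<otimes> j \<otimes> \<one>) = \<zero>\<^bsub>C\<^esub>" by blast
  with \<open>j \<in> ?H\<close> show ?thesis by simp
qed

lemma (in abelian_group_hom) hom_add_pow:
  "x \<in> carrier G \<Longrightarrow> h (add_pow G (n::int) x) = add_pow H n (h x)"
  using group_hom.hom_int_pow[OF a_group_hom, of x n] by (simp add: add_pow_def)

definition biadditive ::
  "('a, 'm) ring_scheme \<Rightarrow> ('b, 'n) ring_scheme \<Rightarrow> ('c, 'd) ring_scheme \<Rightarrow> ('a \<Rightarrow> 'b \<Rightarrow> 'c) \<Rightarrow> bool" where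
  "biadditive A B C f \<longleftrightarrow>
     (\<forall>a\<in>carrier A. abelian_group_hom B C (f a)) \<and>
     (\<forall>b\<in>carrier B. abelian_group_hom A C (\<lambda>a. f a b))"

lemma biadditiveD:
  assumes "biadditive A B C f"
  shows "a \<in> carrier A \<Longrightarrow> abelian_group_hom B C (f a)"
    and "b \<in> carrier B \<Longrightarrow> abelian_group_hom A C (\<lambda>a. f a b)"
  using assms by (auto simp: biadditive_def)

lemma biadditiveI:
  assumes "abelian_group A" "abelian_group B" "abelian_group C"
    and "\<And>a b. a \<in> carrier A \<Longrightarrow> b \<in> carrier B \<Longrightarrow> f a b \<in> carrier C"
    and "\<And>a a' b. a \<in> carrier A \<Longrightarrow> a' \<in> carrier A \<Longrightarrow> b \<in> carrier B \<Longrightarrow>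
      f (a \<oplus>\<^bsub>A\<^esub> a') b = f a b \<oplus>\<^bsub>C\<^esub> f a' b"
    and "\<And>a b b'. a \<in> carrier A \<Longrightarrow> b \<in> carrier B \<Longrightarrow> b' \<in> carrier B \<Longrightarrow>
      f a (b \<oplus>\<^bsub>B\<^esub> b') = f a b \<oplus>\<^bsub>C\<^esub> f a b'"
  shows "biadditive A B C f"
  unfolding biadditive_def
proof (intro conjI ballI)
  fix a assume "a \<in> carrier A"
  then show "abelian_group_hom B C (f a)" by (intro abelian_group_homI' assms)
next
  fix b assume "b \<in> carrier B"
  then show "abelian_group_hom A C (\<lambda>a. f a b)" by (intro abelian_group_homI' assms)
qed

locale two_rings = A: ring A + B: ring B for A (structure) and B (structure)
begin

abbreviation "AB \<equiv> monoid_ring (A \<times>\<times> B)"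
abbreviation "T \<equiv> tensor A B"
abbreviation pure (infixl "\<otimes>t" 70) where "a \<otimes>t b \<equiv> pure_tensor A B a b"

lemma monoid_AB: "monoid (A \<times>\<times> B)"
  by (rule DirProd_monoid) (rule A.monoid_axioms B.monoid_axioms)+

sublocale AB: ring AB
  by (rule ring_monoid_ring) (rule monoid_AB)

lemma tensor_relations_carrier: "tensor_relations A B \<subseteq> carrier AB"
proof
  have dc: "p - q \<in> carrier AB" if "p \<in> carrier AB" "q \<in> carrier AB" for p q
    using that keys_diff_subset by simp
  fix x assume "x \<in> tensor_relations A B"
  then show "x \<in> carrier AB"
    unfolding tensor_relations_def
    by (elim UnE CollectE exE conjE; hypsubst) (intro dc; simp)+
qed

sublocale I: ideal "tensor_ideal A B" AB
  unfolding tensor_ideal_def by (rule AB.genideal_ideal) (rule tensor_relations_carrier)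

sublocale T: ring T
  unfolding tensor_def by (rule I.quotient_is_ring)

lemma frag_carrier [simp]:
  "a \<in> carrier A \<Longrightarrow> b \<in> carrier B \<Longrightarrow> frag_of (a, b) \<in> carrier AB"
  by simp

lemma pure_closed [simp]:
  "a \<in> carrier A \<Longrightarrow> b \<in> carrier B \<Longrightarrow> a \<otimes>t b \<in> carrier T"
  unfolding pure_tensor_def tensor_def by (rule I.quot_simps) simp

lemma pure_mult [simp]:
  assumes "a \<in> carrier A" "a' \<in> carrier A" "b \<in> carrier B" "b' \<in> carrier B"
  shows "(a \<otimes>t b) \<otimes>\<^bsub>T\<^esub> (a' \<otimes>t b') = (a \<otimes>\<^bsub>A\<^esub> a') \<otimes>t (b \<otimes>\<^bsub>B\<^esub> b')"
  unfolding pure_tensor_def tensor_def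
  by (subst I.quot_simps) (use assms in \<open>auto\<close>)

lemma T_one: "\<one>\<^bsub>T\<^esub> = \<one>\<^bsub>A\<^esub> \<otimes>t \<one>\<^bsub>B\<^esub>"
  unfolding pure_tensor_def tensor_def by (simp add: one_DirProd)

lemma pure_eqI:
  assumes "p \<in> carrier AB" "q \<in> carrier AB" "r \<in> carrier AB" "p - q - r \<in> tensor_relations A B"
  shows "tensor_ideal A B +>\<^bsub>AB\<^esub> p =
    (tensor_ideal A B +>\<^bsub>AB\<^esub> q) \<oplus>\<^bsub>T\<^esub> (tensor_ideal A B +>\<^bsub>AB\<^esub> r)"
proof -
  have "p \<ominus>\<^bsub>AB\<^esub> (q \<oplus>\<^bsub>AB\<^esub> r) = p - q - r"
    using assms AB.a_closed[OF assms(2,3)]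
    by (subst monoid_ring_minus) (auto simp: monoid_AB)
  also have "\<dots> \<in> tensor_ideal A B"
    unfolding tensor_ideal_def
    using AB.genideal_self[OF tensor_relations_carrier] assms(4) by blast
  finally show ?thesis
    unfolding tensor_def using assms(1-3) AB.a_closed[OF assms(2,3)]
    by (subst I.quot_simps) (simp_all add: I.quot_eq_iff del: monoid_ring_sel)
qed

lemma pure_add_left:
  assumes "a \<in> carrier A" "a' \<in> carrier A" "b \<in> carrier B"
  shows "(a \<oplus>\<^bsub>A\<^esub> a') \<otimes>t b = a \<otimes>t b \<oplus>\<^bsub>T\<^esub> a' \<otimes>t b"
  unfolding pure_tensor_def
  by (rule pure_eqI) (use assms in \<open>auto simp: tensor_relations_def\<close>)

lemma pure_add_right:
  assumes "a \<in> carrier A" "b \<in> carrier B" "b' \<in> carrier B"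
  shows "a \<otimes>t (b \<oplus>\<^bsub>B\<^esub> b') = a \<otimes>t b \<oplus>\<^bsub>T\<^esub> a \<otimes>t b'"
  unfolding pure_tensor_def
  by (rule pure_eqI) (use assms in \<open>auto simp: tensor_relations_def\<close>)

lemma biadditive_pure: "biadditive A B T (\<otimes>t)"
  by (rule biadditiveI)
    (auto simp: pure_add_left pure_add_right A.is_abelian_group B.is_abelian_group T.is_abelian_group)

lemma pure_hom_left: "b \<in> carrier B \<Longrightarrow> abelian_group_hom A T (\<lambda>a. a \<otimes>t b)"
  and pure_hom_right: "a \<in> carrier A \<Longrightarrow> abelian_group_hom B T (\<lambda>b. a \<otimes>t b)"
  using biadditive_pure by (auto simp: biadditive_def)

lemma pure_zero [simp]:
  "b \<in> carrier B \<Longrightarrow> \<zero>\<^bsub>A\<^esub> \<otimes>t b = \<zero>\<^bsub>T\<^esub>" "a \<in> carrier A \<Longrightarrow> a \<otimes>t \<zero>\<^bsub>B\<^esub> = \<zero>\<^bsub>T\<^esub>"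
  by (auto dest: pure_hom_left[THEN abelian_group_hom.hom_zero] pure_hom_right[THEN abelian_group_hom.hom_zero])

lemma pure_minus:
  "a \<in> carrier A \<Longrightarrow> b \<in> carrier B \<Longrightarrow> (\<ominus>\<^bsub>A\<^esub> a) \<otimes>t b = \<ominus>\<^bsub>T\<^esub> (a \<otimes>t b)"
  "a \<in> carrier A \<Longrightarrow> b \<in> carrier B \<Longrightarrow> a \<otimes>t (\<ominus>\<^bsub>B\<^esub> b) = \<ominus>\<^bsub>T\<^esub> (a \<otimes>t b)"
  using pure_hom_left[THEN abelian_group_hom.hom_a_inv] pure_hom_right[THEN abelian_group_hom.hom_a_inv]
  by auto

lemma pure_add_pow:
  assumes "a \<in> carrier A" "b \<in> carrier B"
  shows "add_pow A (n::int) a \<otimes>t b = a \<otimes>t add_pow B n b"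
  using abelian_group_hom.hom_add_pow[OF pure_hom_left[OF assms(2)] assms(1)]
    abelian_group_hom.hom_add_pow[OF pure_hom_right[OF assms(1)] assms(2)] by metis

text \<open>Minus a pure tensor is again pure, so sums alone generate and no case for negatives
  arises.\<close>

lemma tensor_induct [consumes 1, case_names pure add]:
  assumes "t \<in> carrier T" and pure: "\<And>a b. a \<in> carrier A \<Longrightarrow> b \<in> carrier B \<Longrightarrow> P (a \<otimes>t b)"
    and add: "\<And>t u. t \<in> carrier T \<Longrightarrow> u \<in> carrier T \<Longrightarrow> P t \<Longrightarrow> P u \<Longrightarrow> P (t \<oplus>\<^bsub>T\<^esub> u)"
  shows "P t"
proof -
  let ?c = "\<lambda>p. tensor_ideal A B +>\<^bsub>AB\<^esub> p"
  obtain p where p: "p \<in> carrier AB" "t = ?c p"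
    using assms(1) unfolding tensor_def by (elim I.quot_elem)
  interpret c: abelian_group_hom AB T ?c
    unfolding tensor_def
    by (rule ring_hom_abelian_group_hom) (rule AB.ring_axioms I.quotient_is_ring I.rcos_ring_hom)+
  have c0: "?c 0 = \<zero>\<^bsub>T\<^esub>"
    using c.hom_zero by simp
  \<comment> \<open>Induction over supports passes through differences, hence the claim is carried
    for an element and its negative together.\<close>
  have "P (?c p) \<and> P (\<ominus>\<^bsub>T\<^esub> ?c p)"
    using p(1)[unfolded monoid_ring_sel mem_Collect_eq]
  proof (induction p rule: frag_span_induct)
    case zero
    then show ?case using pure[of "\<zero>\<^bsub>A\<^esub>" "\<zero>\<^bsub>B\<^esub>"] unfolding c0 by simp
  next
    case (one x)
    then obtain a b where "x = (a, b)" "a \<in> carrier A" "b \<in> carrier B" by auto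
    moreover from this have "P (\<ominus>\<^bsub>T\<^esub> (a \<otimes>t b))"
      using pure[of "\<ominus>\<^bsub>A\<^esub> a" b] by (simp add: pure_minus)
    ultimately show ?case using pure[of a b] by (simp add: pure_tensor_def)
  next
    case (diff p q)
    then have pq: "p \<in> carrier AB" "q \<in> carrier AB" by auto
    have "?c (p - q) = ?c p \<oplus>\<^bsub>T\<^esub> (\<ominus>\<^bsub>T\<^esub> ?c q)"
      using c.hom_minus[OF pq] monoid_ring_minus[OF monoid_AB diff(1,2)] by (simp add: T.minus_eq)
    moreover have "\<ominus>\<^bsub>T\<^esub> (?c p \<oplus>\<^bsub>T\<^esub> (\<ominus>\<^bsub>T\<^esub> ?c q)) = \<ominus>\<^bsub>T\<^esub> ?c p \<oplus>\<^bsub>T\<^esub> ?c q"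
      using c.hom_closed[OF pq(1)] c.hom_closed[OF pq(2)] by (simp add: T.minus_add)
    ultimately show ?case
      using add[of "?c p" "\<ominus>\<^bsub>T\<^esub> ?c q"] add[of "\<ominus>\<^bsub>T\<^esub> ?c p" "?c q"] diff(3,4)
        c.hom_closed[OF pq(1)] c.hom_closed[OF pq(2)] by simp
  qed
  then show ?thesis using p(2) by simp
qed

lemma tensor_hom_eqI:
  fixes C :: "('e, 'f) ring_scheme"
  assumes "abelian_group_hom T C h" "abelian_group_hom T C k" "t \<in> carrier T"
    and "\<And>a b. a \<in> carrier A \<Longrightarrow> b \<in> carrier B \<Longrightarrow> h (a \<otimes>t b) = k (a \<otimes>t b)"
  shows "h t = k t"
  using assms(3)
proof (induction t rule: tensor_induct)
  case (add t u)
  then show ?case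
    using abelian_group_hom.hom_add[OF assms(1)] abelian_group_hom.hom_add[OF assms(2)] by auto
qed (rule assms(4))

context
  fixes C :: "('e, 'f) ring_scheme" and f
  assumes f: "biadditive A B C f"
begin

lemma biadditive_codomain: "abelian_group C"
  using biadditiveD(1)[OF f A.zero_closed]
  by (simp add: abelian_group_hom_def)

lemma biadditive_closed: "a \<in> carrier A \<Longrightarrow> b \<in> carrier B \<Longrightarrow> f a b \<in> carrier C"
  using biadditiveD(1)[OF f] abelian_group_hom.hom_closed by fast

lemma ext_hom: "abelian_group_hom AB C (additive_ext C (\<lambda>(a, b). f a b))"
  by (rule additive_ext_hom) (use monoid_AB biadditive_codomain biadditive_closed in auto)

lemma ext_ideal:
  assumes "j \<in> tensor_ideal A B"
  shows "additive_ext C (\<lambda>(a, b). f a b) j = \<zero>\<^bsub>C\<^esub>"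
proof (rule AB.genideal_additive_kernel[OF ext_hom tensor_relations_carrier])
  show "j \<in> Idl\<^bsub>AB\<^esub> tensor_relations A B"
    using assms by (simp add: tensor_ideal_def)
  interpret C: abelian_group C by (rule biadditive_codomain)
  let ?h = "additive_ext C (\<lambda>(a, b). f a b)"
  interpret h: abelian_group_hom AB C ?h by (rule ext_hom)
  have hdiff: "?h (p - q) = ?h p \<ominus>\<^bsub>C\<^esub> ?h q" if "p \<in> carrier AB" "q \<in> carrier AB" for p q
    using h.hom_minus[OF that] monoid_ring_minus[OF monoid_AB, of p q] that by simp
  have dc: "p - q \<in> carrier AB" if "p \<in> carrier AB" "q \<in> carrier AB" for p q
    using that keys_diff_subset by simp
  have rel0: "?h x = \<zero>\<^bsub>C\<^esub>" if "x \<in> tensor_relations A B" for x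
    using that unfolding tensor_relations_def
  proof (elim UnE CollectE exE conjE)
    fix a a' b assume *: "x = frag_of (a \<oplus>\<^bsub>A\<^esub> a', b) - frag_of (a, b) - frag_of (a', b)"
      "a \<in> carrier A" "a' \<in> carrier A" "b \<in> carrier B"
    show ?thesis
      using biadditiveD(2)[OF f *(4), THEN abelian_group_hom.hom_add, OF *(2,3)] *
        biadditive_closed[OF *(2,4)] biadditive_closed[OF *(3,4)]
      by (simp add: hdiff dc C.minus_eq C.a_assoc C.a_comm[of "f a b"] C.r_neg del: monoid_ring_sel)
  next
    fix a b b' assume *: "x = frag_of (a, b \<oplus>\<^bsub>B\<^esub> b') - frag_of (a, b) - frag_of (a, b')"
      "a \<in> carrier A" "b \<in> carrier B" "b' \<in> carrier B"
    show ?thesis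
      using biadditiveD(1)[OF f *(2), THEN abelian_group_hom.hom_add, OF *(3,4)] *
        biadditive_closed[OF *(2,3)] biadditive_closed[OF *(2,4)]
      by (simp add: hdiff dc C.minus_eq C.a_assoc C.a_comm[of "f a b"] C.r_neg del: monoid_ring_sel)
  qed
  \<comment> \<open>A bilinearity relation multiplied by basis elements on both sides is again one,
    because multiplication in \<open>A\<close> and \<open>B\<close> distributes over addition. Two
    inductions then cover arbitrary multipliers.\<close>
  have relm: "frag_of y \<otimes>\<^bsub>AB\<^esub> x \<otimes>\<^bsub>AB\<^esub> frag_of z \<in> tensor_relations A B"
    if "y \<in> carrier (A \<times>\<times> B)" "x \<in> tensor_relations A B" "z \<in> carrier (A \<times>\<times> B)" for x y z
  proof -
    obtain y1 y2 z1 z2 where yz: "y = (y1, y2)" "z = (z1, z2)" "y1 \<in> carrier A" "z1 \<in> carrier A"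
      "y2 \<in> carrier B" "z2 \<in> carrier B"
      using \<open>y \<in> _\<close> \<open>z \<in> _\<close> by auto
    from that(2) show ?thesis unfolding tensor_relations_def
    proof (elim UnE CollectE exE conjE)
      fix a a' b assume *: "x = frag_of (a \<oplus>\<^bsub>A\<^esub> a', b) - frag_of (a, b) - frag_of (a', b)"
        "a \<in> carrier A" "a' \<in> carrier A" "b \<in> carrier B"
      show "frag_of y \<otimes>\<^bsub>AB\<^esub> x \<otimes>\<^bsub>AB\<^esub> frag_of z \<in>
        {frag_of (a \<oplus>\<^bsub>A\<^esub> a', b) - frag_of (a, b) - frag_of (a', b) | a a' b.
          a \<in> carrier A \<and> a' \<in> carrier A \<and> b \<in> carrier B} \<union>
        {frag_of (a, b \<oplus>\<^bsub>B\<^esub> b') - frag_of (a, b) - frag_of (a, b') | a b b'.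
          a \<in> carrier A \<and> b \<in> carrier B \<and> b' \<in> carrier B}"
        using * yz
        by (intro UnI1 CollectI exI[of _ "y1 \<otimes>\<^bsub>A\<^esub> a \<otimes>\<^bsub>A\<^esub> z1"] exI[of _ "y1 \<otimes>\<^bsub>A\<^esub> a' \<otimes>\<^bsub>A\<^esub> z1"]
            exI[of _ "y2 \<otimes>\<^bsub>B\<^esub> b \<otimes>\<^bsub>B\<^esub> z2"])
          (simp add: monoid_ring_mult_diff A.l_distr A.r_distr)
    next
      fix a b b' assume *: "x = frag_of (a, b \<oplus>\<^bsub>B\<^esub> b') - frag_of (a, b) - frag_of (a, b')"
        "a \<in> carrier A" "b \<in> carrier B" "b' \<in> carrier B"
      show "frag_of y \<otimes>\<^bsub>AB\<^esub> x \<otimes>\<^bsub>AB\<^esub> frag_of z \<in>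
        {frag_of (a \<oplus>\<^bsub>A\<^esub> a', b) - frag_of (a, b) - frag_of (a', b) | a a' b.
          a \<in> carrier A \<and> a' \<in> carrier A \<and> b \<in> carrier B} \<union>
        {frag_of (a, b \<oplus>\<^bsub>B\<^esub> b') - frag_of (a, b) - frag_of (a, b') | a b b'.
          a \<in> carrier A \<and> b \<in> carrier B \<and> b' \<in> carrier B}"
        using * yz
        by (intro UnI2 CollectI exI[of _ "y1 \<otimes>\<^bsub>A\<^esub> a \<otimes>\<^bsub>A\<^esub> z1"] exI[of _ "y2 \<otimes>\<^bsub>B\<^esub> b \<otimes>\<^bsub>B\<^esub> z2"]
            exI[of _ "y2 \<otimes>\<^bsub>B\<^esub> b' \<otimes>\<^bsub>B\<^esub> z2"])
          (simp add: monoid_ring_mult_diff B.l_distr B.r_distr)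
    qed
  qed
  fix q x r assume x: "x \<in> tensor_relations A B" and "q \<in> carrier AB" "r \<in> carrier AB"
  then have q: "Poly_Mapping.keys q \<subseteq> carrier (A \<times>\<times> B)" and r: "Poly_Mapping.keys r \<subseteq> carrier (A \<times>\<times> B)"
    by auto
  have xc: "x \<in> carrier AB" using x tensor_relations_carrier by blast
  from q show "?h (q \<otimes>\<^bsub>AB\<^esub> x \<otimes>\<^bsub>AB\<^esub> r) = \<zero>\<^bsub>C\<^esub>"
  proof (induction q rule: frag_span_induct)
    case (one y)
    from r show ?case
    proof (induction r rule: frag_span_induct)
      case (diff a b)
      have "frag_of y \<otimes>\<^bsub>AB\<^esub> x \<in> carrier AB"
        using one xc by (intro AB.m_closed) auto
      with diff show ?case
        by (subst monoid_ring_mult_diff, subst hdiff) (auto intro!: AB.m_closed simp: C.minus_eq simp del: monoid_ring_sel, auto)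
    qed (use relm[OF one x] rel0 h.hom_zero in auto)
  next
    case (diff a b)
    then have "a \<in> carrier AB" "b \<in> carrier AB" by auto
    with diff(3,4) \<open>r \<in> carrier AB\<close> xc show ?case
      by (simp add: monoid_ring_mult_diff hdiff C.minus_eq del: monoid_ring_sel)
  qed (use h.hom_zero in auto)
qed

lemma tensor_lift_hom: "abelian_group_hom T C (tensor_lift C f)"
  unfolding tensor_lift_def tensor_def by (rule I.descend_hom[OF ext_hom ext_ideal])

lemma tensor_lift_pure:
  assumes "a \<in> carrier A" "b \<in> carrier B"
  shows "tensor_lift C f (a \<otimes>t b) = f a b"
proof -
  interpret C: abelian_group C by (rule biadditive_codomain)
  show ?thesis
    unfolding tensor_lift_def pure_tensor_def
    using assms biadditive_closed
    by (subst I.descend_coset[OF ext_hom ext_ideal]) auto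
qed

lemma tensor_lift_ring_hom:
  assumes C: "ring C"
    and m: "\<And>a a' b b'. a \<in> carrier A \<Longrightarrow> a' \<in> carrier A \<Longrightarrow> b \<in> carrier B \<Longrightarrow> b' \<in> carrier B \<Longrightarrow>
      f (a \<otimes>\<^bsub>A\<^esub> a') (b \<otimes>\<^bsub>B\<^esub> b') = f a b \<otimes>\<^bsub>C\<^esub> f a' b'"
    and one: "f \<one>\<^bsub>A\<^esub> \<one>\<^bsub>B\<^esub> = \<one>\<^bsub>C\<^esub>"
  shows "tensor_lift C f \<in> ring_hom T C"
  unfolding tensor_lift_def tensor_def
proof (rule I.descend_ring_hom[OF C _ ext_ideal])
  show "additive_ext C (\<lambda>(a, b). f a b) \<in> ring_hom AB C"
    by (rule additive_ext_ring_hom) (use monoid_AB C m one biadditive_closed in auto)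
qed

end

end

lemma abelian_group_hom_compose:
  assumes "abelian_group_hom A B f" "abelian_group_hom B C g"
  shows "abelian_group_hom A C (\<lambda>x. g (f x))"
proof -
  interpret f: abelian_group_hom A B f by fact
  interpret g: abelian_group_hom B C g by fact
  show ?thesis
    by (rule abelian_group_homI') (auto simp: f.G.abelian_group_axioms g.H.abelian_group_axioms)
qed

section \<open>The tensor square and cube of a ring, and the maps in the Hopf axioms\<close>

locale tensor_square = ring A for A (structure)
begin

abbreviation "A2 \<equiv> tensor A A"
abbreviation "A3 \<equiv> tensor A A2"
abbreviation pure2 (infixl "\<otimes>2" 70) where "a \<otimes>2 b \<equiv> pure_tensor A A a b"
abbreviation pure3 (infixl "\<otimes>3" 70) where "a \<otimes>3 t \<equiv> pure_tensor A A2 a t"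

sublocale T2: two_rings A A ..
sublocale T2r: ring A2 by (rule T2.T.ring_axioms)
sublocale T3: two_rings A A2 ..

lemma biadditive_assoc:
  assumes "b \<in> carrier A"
  shows "biadditive A A A3 (\<lambda>a' a''. a' \<otimes>3 (a'' \<otimes>2 b))"
  using assms
  by (intro biadditiveI)
    (auto simp: is_abelian_group T3.T.is_abelian_group T3.pure_add_left T2.pure_add_left T3.pure_add_right)

lemma biadditive_counit:
  assumes "abelian_group_hom A \<Z> e"
  shows "biadditive A A A (\<lambda>a b. add_pow A (e a) b)" "biadditive A A A (\<lambda>a b. add_pow A (e b) a)"
proof -
  have "e (a \<oplus> b) = e a + e b" if "a \<in> carrier A" "b \<in> carrier A" for a b
    using abelian_group_hom.hom_add[OF assms that] by simp
  then show "biadditive A A A (\<lambda>a b. add_pow A (e a) b)" "biadditive A A A (\<lambda>a b. add_pow A (e b) a)"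
    by (auto intro!: biadditiveI simp: is_abelian_group int_add_pow_add int_add_pow_distrib)
qed

lemma biadditive_antipode:
  assumes "abelian_group_hom A A S"
  shows "biadditive A A A (\<lambda>a b. S a \<otimes> b)" "biadditive A A A (\<lambda>a b. a \<otimes> S b)"
proof -
  interpret S: abelian_group_hom A A S by fact
  show "biadditive A A A (\<lambda>a b. S a \<otimes> b)" "biadditive A A A (\<lambda>a b. a \<otimes> S b)"
    by (auto intro!: biadditiveI simp: is_abelian_group l_distr r_distr)
qed

context
  fixes \<Delta>
  assumes D: "abelian_group_hom A A2 \<Delta>"
begin

interpretation D: abelian_group_hom A A2 \<Delta> by (rule D)

lemma biadditive_coassoc_right: "biadditive A A A3 (\<lambda>a b. a \<otimes>3 \<Delta> b)"
  by (rule biadditiveI)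
    (auto simp: is_abelian_group T3.T.is_abelian_group T3.pure_add_left T3.pure_add_right)

lemma biadditive_coassoc_left:
  "biadditive A A A3 (\<lambda>a b. tensor_lift A3 (\<lambda>a' a''. a' \<otimes>3 (a'' \<otimes>2 b)) (\<Delta> a))"
  unfolding biadditive_def
proof (intro conjI ballI)
  fix b assume b: "b \<in> carrier A"
  show "abelian_group_hom A A3 (\<lambda>a. tensor_lift A3 (\<lambda>a' a''. a' \<otimes>3 (a'' \<otimes>2 b)) (\<Delta> a))"
    by (rule abelian_group_hom_compose[OF D], rule T2.tensor_lift_hom, rule biadditive_assoc, rule b)
next
  fix a assume a: "a \<in> carrier A"
  have da: "\<Delta> a \<in> carrier A2" using a by simp
  have cl: "tensor_lift A3 (\<lambda>a' a''. a' \<otimes>3 (a'' \<otimes>2 b)) (\<Delta> a) \<in> carrier A3" if "b \<in> carrier A" for b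
    by (rule abelian_group_hom.hom_closed[OF _ da], rule T2.tensor_lift_hom, rule biadditive_assoc, rule that)
  \<comment> \<open>Here \<open>b\<close> occurs inside the map being lifted, so additivity in
    \<open>b\<close> is an equality of two additive maps on the tensor square, checked on pure
    tensors.\<close>
  have *: "tensor_lift A3 (\<lambda>a' a''. a' \<otimes>3 (a'' \<otimes>2 (b \<oplus> c))) t =
      tensor_lift A3 (\<lambda>a' a''. a' \<otimes>3 (a'' \<otimes>2 b)) t \<oplus>\<^bsub>A3\<^esub>
      tensor_lift A3 (\<lambda>a' a''. a' \<otimes>3 (a'' \<otimes>2 c)) t"
    if bc: "b \<in> carrier A" "c \<in> carrier A" and t: "t \<in> carrier A2" for b c t
  proof (rule T2.tensor_hom_eqI[OF _ _ t])
    let ?F = "\<lambda>b. tensor_lift A3 (\<lambda>a' a''. a' \<otimes>3 (a'' \<otimes>2 b))"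
    interpret b: abelian_group_hom A2 A3 "?F b"
      by (rule T2.tensor_lift_hom[OF biadditive_assoc]) (use bc in auto)
    interpret c: abelian_group_hom A2 A3 "?F c"
      by (rule T2.tensor_lift_hom[OF biadditive_assoc]) (use bc in auto)
    show "abelian_group_hom A2 A3 (?F (b \<oplus> c))"
      by (rule T2.tensor_lift_hom[OF biadditive_assoc]) (use bc in auto)
    show "abelian_group_hom A2 A3 (\<lambda>t. ?F b t \<oplus>\<^bsub>A3\<^esub> ?F c t)"
      by (rule abelian_group_homI')
        (auto simp: T2.T.is_abelian_group T3.T.is_abelian_group T3.T.add.m_ac)
    fix x y assume "x \<in> carrier A" "y \<in> carrier A"
    then show "?F (b \<oplus> c) (x \<otimes>2 y) = ?F b (x \<otimes>2 y) \<oplus>\<^bsub>A3\<^esub> ?F c (x \<otimes>2 y)"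
      using bc by (simp add: T2.tensor_lift_pure[OF biadditive_assoc] T2.pure_add_right T3.pure_add_right)
  qed
  show "abelian_group_hom A A3 (\<lambda>b. tensor_lift A3 (\<lambda>a' a''. a' \<otimes>3 (a'' \<otimes>2 b)) (\<Delta> a))"
    by (rule abelian_group_homI')
      (use *[OF _ _ da] cl in \<open>auto simp: is_abelian_group T3.T.is_abelian_group\<close>)
qed

end

end

section \<open>Quotients of Hopf algebras\<close>

context hopf_ideal
begin

abbreviation "Q \<equiv> A Quot J"
abbreviation proj where "proj \<equiv> (+>) J"

sublocale A: tensor_square A ..
sublocale Qr: ring Q by (rule quotient_is_ring)
sublocale Q: tensor_square Q ..

lemma proj_hom: "abelian_group_hom A Q proj"
  by (rule ring_hom_abelian_group_hom) (rule ring_axioms Qr.ring_axioms rcos_ring_hom)+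

lemma biadditive_proj: "biadditive A A Q.A2 (\<lambda>a b. pure_tensor Q Q (proj a) (proj b))"
  by (rule biadditiveI)
    (auto simp: is_abelian_group Q.T2.T.is_abelian_group Q.T2.pure_add_left Q.T2.pure_add_right
      simp flip: quot_simps(2))

abbreviation "proj2 \<equiv> tensor_lift Q.A2 (\<lambda>a b. pure_tensor Q Q (proj a) (proj b))"

lemmas proj2_hom = A.T2.tensor_lift_hom[OF biadditive_proj]
lemmas proj2_pure = A.T2.tensor_lift_pure[OF biadditive_proj]

lemma proj2_ring_hom: "proj2 \<in> ring_hom A.A2 Q.A2"
  by (rule A.T2.tensor_lift_ring_hom[OF biadditive_proj Q.T2.T.ring_axioms])
    (simp_all add: Q.T2.T_one flip: quot_simps(3))

text \<open>Each axiom on the coproduct involves lifts of biadditive maps, evaluated at the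
  coproduct of an element. This one commuting square therefore transports all of them to the
  quotient; both ways round it are additive, so pure tensors decide.\<close>

lemma tensor_lift_proj2:
  assumes "biadditive A A C f" "biadditive Q Q D g" "abelian_group_hom C D h"
    and "\<And>a b. a \<in> carrier A \<Longrightarrow> b \<in> carrier A \<Longrightarrow> g (proj a) (proj b) = h (f a b)"
    and t: "t \<in> carrier A.A2"
  shows "tensor_lift D g (proj2 t) = h (tensor_lift C f t)"
proof (rule A.T2.tensor_hom_eqI[OF _ _ t])
  show "abelian_group_hom A.A2 D (\<lambda>t. tensor_lift D g (proj2 t))"
    by (rule abelian_group_hom_compose[OF proj2_hom Q.T2.tensor_lift_hom]) fact
  show "abelian_group_hom A.A2 D (\<lambda>t. h (tensor_lift C f t))"
    by (rule abelian_group_hom_compose[OF A.T2.tensor_lift_hom]) fact+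
  fix a b assume "a \<in> carrier A" "b \<in> carrier A"
  then show "tensor_lift D g (proj2 (pure_tensor A A a b)) = h (tensor_lift C f (pure_tensor A A a b))"
    using assms(4)
    by (simp add: proj2_pure Q.T2.tensor_lift_pure[OF assms(2)] A.T2.tensor_lift_pure[OF assms(1)])
qed

lemma comult_hom': "abelian_group_hom A A.A2 comult"
  by (rule ring_hom_abelian_group_hom) (rule ring_axioms A.T2.T.ring_axioms comult_hom)+

lemma proj2_comult_ideal:
  assumes "j \<in> J"
  shows "proj2 (comult j) = \<zero>\<^bsub>Q.A2\<^esub>"
proof -
  interpret p: abelian_group_hom A.A2 Q.A2 proj2 by (rule proj2_hom)
  let ?X = "{pure_tensor A A j a | j a. j \<in> J \<and> a \<in> carrier A} \<union>
         {pure_tensor A A a j | a j. a \<in> carrier A \<and> j \<in> J}"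
  have zero: "proj j = \<zero>\<^bsub>Q\<^esub>" if "j \<in> J" for j
    using that Icarr quot_eq_zero_iff by blast
  have X: "x \<in> carrier A.A2 \<and> proj2 x = \<zero>\<^bsub>Q.A2\<^esub>" if "x \<in> ?X" for x
    using that
    by (elim UnE CollectE exE conjE; hypsubst)
      (simp_all add: proj2_pure Icarr zero Q.T2.pure_zero)
  have "{pure_tensor A A a j | j a. a \<in> carrier A \<and> j \<in> J} =
     {pure_tensor A A a j | a j. a \<in> carrier A \<and> j \<in> J}" by blast
  then have "comult j \<in> int_span A.A2 ?X" using comult_ideal assms by auto
  then show ?thesis
    by (rule p.hom_int_span_zero) (use X in auto)
qed

lemma quotient_comult_eq: "quotient_comult A J comult = descend (\<lambda>x. proj2 (comult x))"
  by (simp add: quotient_comult_def)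

lemma proj2_comult_hom: "abelian_group_hom A Q.A2 (\<lambda>x. proj2 (comult x))"
  by (rule abelian_group_hom_compose[OF comult_hom' proj2_hom])

lemma quotient_comult_proj:
  "x \<in> carrier A \<Longrightarrow> quotient_comult A J comult (proj x) = proj2 (comult x)"
  unfolding quotient_comult_eq by (rule descend_coset[OF proj2_comult_hom proj2_comult_ideal])

lemma quotient_comult_ring_hom: "quotient_comult A J comult \<in> ring_hom Q Q.A2"
  unfolding quotient_comult_eq
proof (rule descend_ring_hom[OF Q.T2.T.ring_axioms _ proj2_comult_ideal])
  show "(\<lambda>x. proj2 (comult x)) \<in> ring_hom A Q.A2"
    using ring_hom_trans[OF comult_hom proj2_ring_hom] by (simp add: comp_def)
qed

lemma counit_hom': "abelian_group_hom A \<Z> counit"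
  by (rule ring_hom_abelian_group_hom) (use ring_axioms int.ring_axioms counit_hom in auto)

lemma counit_J: "j \<in> J \<Longrightarrow> counit j = \<zero>\<^bsub>\<Z>\<^esub>"
  using counit_ideal by auto

lemma quotient_counit_proj: "x \<in> carrier A \<Longrightarrow> quotient_counit counit (proj x) = counit x"
  unfolding quotient_counit_def by (rule descend_coset[OF counit_hom' counit_J])

lemma antipode_hom: "abelian_group_hom A A antipode"
  by (rule abelian_group_hom_mem) (use is_abelian_group antipode_additive in auto)

lemma proj_antipode_hom: "abelian_group_hom A Q (\<lambda>x. proj (antipode x))"
  by (rule abelian_group_hom_compose[OF antipode_hom proj_hom])

lemma proj_antipode_J: "j \<in> J \<Longrightarrow> proj (antipode j) = \<zero>\<^bsub>Q\<^esub>"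
  using antipode_ideal Icarr quot_eq_zero_iff by blast

lemma quotient_antipode_proj:
  "x \<in> carrier A \<Longrightarrow> quotient_antipode A J antipode (proj x) = proj (antipode x)"
  unfolding quotient_antipode_def by (rule descend_coset[OF proj_antipode_hom proj_antipode_J])

lemma quotient_antipode_hom: "abelian_group_hom Q Q (quotient_antipode A J antipode)"
  unfolding quotient_antipode_def by (rule descend_hom[OF proj_antipode_hom proj_antipode_J])

lemma biadditive_proj3: "biadditive A A.A2 Q.A3 (\<lambda>a t. pure_tensor Q Q.A2 (proj a) (proj2 t))"
proof -
  interpret p: abelian_group_hom A.A2 Q.A2 proj2 by (rule proj2_hom)
  show ?thesis
    by (rule biadditiveI)
      (auto simp: is_abelian_group A.T2.T.is_abelian_group Q.T3.T.is_abelian_group Q.T3.pure_add_left Q.T3.pure_add_right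
        simp flip: quot_simps(2))
qed

theorem hopf_algebra_quotient:
  "hopf_algebra (A Quot J) (quotient_comult A J comult) (quotient_counit counit)
    (quotient_antipode A J antipode)"
proof -
  let ?\<Delta> = "quotient_comult A J comult" and ?e = "quotient_counit counit"
    and ?S = "quotient_antipode A J antipode"
  have D: "abelian_group_hom Q Q.A2 ?\<Delta>"
    by (rule ring_hom_abelian_group_hom) (rule Qr.ring_axioms Q.T2.T.ring_axioms quotient_comult_ring_hom)+
  have e: "?e \<in> ring_hom Q \<Z>"
    unfolding quotient_counit_def
    by (rule descend_ring_hom[OF int.ring_axioms counit_hom counit_J])
  have e': "abelian_group_hom Q \<Z> ?e"
    by (rule ring_hom_abelian_group_hom) (rule Qr.ring_axioms int.ring_axioms e)+
  have cl: "comult x \<in> carrier A.A2" if "x \<in> carrier A" for x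
    using abelian_group_hom.hom_closed[OF comult_hom' that] .
  let ?p3 = "tensor_lift Q.A3 (\<lambda>a t. pure_tensor Q Q.A2 (proj a) (proj2 t))"
  note p3_hom = A.T3.tensor_lift_hom[OF biadditive_proj3]
  note p3_pure = A.T3.tensor_lift_pure[OF biadditive_proj3]
  have add_pow_proj: "add_pow Q (n::int) (proj x) = proj (add_pow A n x)" if "x \<in> carrier A" for n x
    using abelian_group_hom.hom_add_pow[OF proj_hom that] by simp
  have S: "antipode x \<in> carrier A" if "x \<in> carrier A" for x
    using abelian_group_hom.hom_closed[OF antipode_hom that] .
  show ?thesis
  proof (intro hopf_algebra.intro hopf_algebra_axioms.intro)
    show "ring Q" by (rule Qr.ring_axioms)
    show "?\<Delta> \<in> ring_hom Q Q.A2" by (rule quotient_comult_ring_hom)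
    show "?e \<in> ring_hom Q \<Z>" by (rule e)
    show "?S \<in> hom (add_monoid Q) (add_monoid Q)"
      using abelian_group_hom.a_group_hom[OF quotient_antipode_hom] by (rule group_hom.homh)
  next
    fix X assume "X \<in> carrier Q"
    then obtain x where x: "x \<in> carrier A" "X = proj x" by (rule quot_elem)
    have "tensor_lift Q.A3 (\<lambda>a b. tensor_lift Q.A3
        (\<lambda>a' a''. pure_tensor Q Q.A2 a' (pure_tensor Q Q a'' b)) (?\<Delta> a)) (proj2 (comult x)) =
      ?p3 (tensor_lift A.A3 (\<lambda>a b. tensor_lift A.A3
        (\<lambda>a' a''. pure_tensor A A.A2 a' (pure_tensor A A a'' b)) (comult a)) (comult x))"
    \<comment> \<open>The map on the left is itself a lift at \<open>comult a\<close>, so the square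
      is needed twice: for the outer lift, and inside its hypothesis for the inner one.\<close>
    proof (rule tensor_lift_proj2[OF A.biadditive_coassoc_left[OF comult_hom']
          Q.biadditive_coassoc_left[OF D] p3_hom _ cl[OF x(1)]])
      fix a b assume ab: "a \<in> carrier A" "b \<in> carrier A"
      have "tensor_lift Q.A3 (\<lambda>a' a''. pure_tensor Q Q.A2 a' (pure_tensor Q Q a'' (proj b)))
         (proj2 (comult a)) =
        ?p3 (tensor_lift A.A3 (\<lambda>a' a''. pure_tensor A A.A2 a' (pure_tensor A A a'' b)) (comult a))"
        by (rule tensor_lift_proj2[OF A.biadditive_assoc Q.biadditive_assoc p3_hom _ cl])
          (use ab in \<open>auto simp: p3_pure proj2_pure\<close>)
      then show "tensor_lift Q.A3 (\<lambda>a' a''. pure_tensor Q Q.A2 a' (pure_tensor Q Q a'' (proj b)))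
         (?\<Delta> (proj a)) =
        ?p3 (tensor_lift A.A3 (\<lambda>a' a''. pure_tensor A A.A2 a' (pure_tensor A A a'' b)) (comult a))"
        using ab by (simp add: quotient_comult_proj)
    qed
    also have "\<dots> = ?p3 (tensor_lift A.A3 (\<lambda>a b. pure_tensor A A.A2 a (comult b)) (comult x))"
      by (simp add: coassociative[OF x(1)])
    also have "\<dots> = tensor_lift Q.A3 (\<lambda>a b. pure_tensor Q Q.A2 a (?\<Delta> b)) (proj2 (comult x))"
      by (rule tensor_lift_proj2[OF A.biadditive_coassoc_right[OF comult_hom']
          Q.biadditive_coassoc_right[OF D] p3_hom _ cl[OF x(1)], symmetric])
        (simp add: p3_pure quotient_comult_proj cl)
    finally show "tensor_lift Q.A3 (\<lambda>a b. tensor_lift Q.A3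
        (\<lambda>a' a''. pure_tensor Q Q.A2 a' (pure_tensor Q Q a'' b)) (?\<Delta> a)) (?\<Delta> X) =
      tensor_lift Q.A3 (\<lambda>a b. pure_tensor Q Q.A2 a (?\<Delta> b)) (?\<Delta> X)"
      using x by (simp add: quotient_comult_proj)
  next
    fix X assume "X \<in> carrier Q"
    then obtain x where x: "x \<in> carrier A" "X = proj x" by (rule quot_elem)
    have "tensor_lift Q (\<lambda>a b. add_pow Q (?e a) b) (proj2 (comult x)) =
      proj (tensor_lift A (\<lambda>a b. add_pow A (counit a) b) (comult x))"
      by (rule tensor_lift_proj2[OF A.biadditive_counit(1)[OF counit_hom'] Q.biadditive_counit(1)[OF e']
          proj_hom _ cl[OF x(1)]]) (simp add: quotient_counit_proj add_pow_proj)
    then show "tensor_lift Q (\<lambda>a b. add_pow Q (?e a) b) (?\<Delta> X) = X"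
      using x by (simp add: quotient_comult_proj counit_left)
    have "tensor_lift Q (\<lambda>a b. add_pow Q (?e b) a) (proj2 (comult x)) =
      proj (tensor_lift A (\<lambda>a b. add_pow A (counit b) a) (comult x))"
      by (rule tensor_lift_proj2[OF A.biadditive_counit(2)[OF counit_hom'] Q.biadditive_counit(2)[OF e']
          proj_hom _ cl[OF x(1)]]) (simp add: quotient_counit_proj add_pow_proj)
    then show "tensor_lift Q (\<lambda>a b. add_pow Q (?e b) a) (?\<Delta> X) = X"
      using x by (simp add: quotient_comult_proj counit_right)
    have "tensor_lift Q (\<lambda>a b. ?S a \<otimes>\<^bsub>Q\<^esub> b) (proj2 (comult x)) =
      proj (tensor_lift A (\<lambda>a b. antipode a \<otimes> b) (comult x))"
      by (rule tensor_lift_proj2[OF A.biadditive_antipode(1)[OF antipode_hom]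
          Q.biadditive_antipode(1)[OF quotient_antipode_hom] proj_hom _ cl[OF x(1)]])
        (simp add: quotient_antipode_proj S)
    then show "tensor_lift Q (\<lambda>a b. ?S a \<otimes>\<^bsub>Q\<^esub> b) (?\<Delta> X) = add_pow Q (?e X) \<one>\<^bsub>Q\<^esub>"
      using x by (simp add: quotient_comult_proj antipode_left quotient_counit_proj add_pow_proj)
    have "tensor_lift Q (\<lambda>a b. a \<otimes>\<^bsub>Q\<^esub> ?S b) (proj2 (comult x)) =
      proj (tensor_lift A (\<lambda>a b. a \<otimes> antipode b) (comult x))"
      by (rule tensor_lift_proj2[OF A.biadditive_antipode(2)[OF antipode_hom]
          Q.biadditive_antipode(2)[OF quotient_antipode_hom] proj_hom _ cl[OF x(1)]])
        (simp add: quotient_antipode_proj S)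
    then show "tensor_lift Q (\<lambda>a b. a \<otimes>\<^bsub>Q\<^esub> ?S b) (?\<Delta> X) = add_pow Q (?e X) \<one>\<^bsub>Q\<^esub>"
      using x by (simp add: quotient_comult_proj antipode_right quotient_counit_proj add_pow_proj)
  qed
qed

end

section \<open>Words\<close>

lemma list_prod_Nil [simp]: "list_prod G [] = \<one>\<^bsub>G\<^esub>"
  and list_prod_Cons [simp]: "list_prod G (x # xs) = x \<otimes>\<^bsub>G\<^esub> list_prod G xs"
  by (simp_all add: list_prod_def)

lemma (in monoid) list_prod_closed [simp]: "set xs \<subseteq> carrier G \<Longrightarrow> list_prod G xs \<in> carrier G"
  by (induction xs) auto

lemma (in monoid) list_prod_append:
  "set xs \<subseteq> carrier G \<Longrightarrow> set ys \<subseteq> carrier G \<Longrightarrow>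
    list_prod G (xs @ ys) = list_prod G xs \<otimes> list_prod G ys"
  by (induction xs) (auto simp: m_assoc)

lemma ring_hom_list_prod:
  assumes "ring A" "ring B" "h \<in> ring_hom A B" "set xs \<subseteq> carrier A"
  shows "h (list_prod A xs) = list_prod B (map h xs)"
proof -
  interpret A: ring A by fact
  show ?thesis using assms(4)
    by (induction xs) (use assms(3) in \<open>auto simp: ring_hom_one ring_hom_mult\<close>)
qed

lemma alternating_0 [simp]: "alternating i j 0 = []"
  by (simp add: alternating_def)

lemma alternating_Suc: "alternating i j (Suc n) = i # alternating j i n"
  by (simp only: alternating_def upt_conv_Cons[OF zero_less_Suc] map_Suc_upt[symmetric])
    (auto simp: comp_def)

lemma alternating_snoc: "alternating i j (Suc n) = alternating i j n @ [if even n then i else j]"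
  by (simp add: alternating_def)

lemma length_alternating [simp]: "length (alternating i j n) = n"
  by (simp add: alternating_def)

lemma set_alternating: "set (alternating i j n) \<subseteq> {i, j}"
  by (auto simp: alternating_def)

lemma set_alternating' [simp]: "i \<in> S \<Longrightarrow> j \<in> S \<Longrightarrow> set (alternating i j n) \<subseteq> S"
  using set_alternating[of i j n] by blast

lemma alternating_double: "alternating i j (2 * n) = concat (replicate n [i, j])"
  by (induction n) (simp_all add: alternating_Suc)

text \<open>The total length 2 n is even, so counting from the right end exchanges the two
  letters.\<close>

lemma alternating_append_rev:
  "alternating i j n @ rev (alternating j i n) = alternating i j (2 * n)"
proof (rule nth_equalityI)
  fix k assume "k < length (alternating i j n @ rev (alternating j i n))"
  then have k: "k < 2 * n" by simp
  show "(alternating i j n @ rev (alternating j i n)) ! k = alternating i j (2 * n) ! k"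
  proof (cases "k < n")
    case False
    then have "n - Suc (k - n) = 2 * n - Suc k" by simp
    moreover have "even (2 * n - Suc k) \<longleftrightarrow> odd k" using k by auto
    ultimately show ?thesis using False k
      by (simp add: nth_append rev_nth) (simp add: alternating_def)
  qed (use k in \<open>simp add: nth_append alternating_def\<close>)
qed simp

lemma (in monoid) list_prod_involutions:
  assumes "\<And>i. i \<in> J \<Longrightarrow> f i \<in> carrier G" "\<And>i. i \<in> J \<Longrightarrow> f i \<otimes> f i = \<one>" "set u \<subseteq> J"
  shows "list_prod G (map f (rev u)) \<otimes> list_prod G (map f u) = \<one>"
  using assms(3)
proof (induction u)
  case (Cons i u)
  have c: "list_prod G (map f v) \<in> carrier G" if "set v \<subseteq> J" for v
    using that assms(1) by (intro list_prod_closed) auto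
  have "f ` set u \<subseteq> carrier G" "f i \<in> carrier G"
    using Cons.prems assms(1) by auto
  then have "list_prod G (map f (rev (i # u))) = list_prod G (map f (rev u)) \<otimes> f i"
    by (simp add: list_prod_append)
  then have "list_prod G (map f (rev (i # u))) \<otimes> list_prod G (map f (i # u)) =
      list_prod G (map f (rev u)) \<otimes> (f i \<otimes> f i) \<otimes> list_prod G (map f u)"
    using Cons.prems assms(1) c[of "rev u"] c[of u] by (simp add: m_assoc)
  then show ?case using Cons assms(2) c[of "rev u"] by simp
qed simp

text \<open>The relator splits as the alternating word \<open>u\<close> from \<open>i\<close> times
  the reverse \<open>w\<close> of the alternating word \<open>v\<close> from \<open>j\<close>. So
  \<open>u w\<close> and \<open>w v\<close> are both trivial, and
  \<open>u = u w v = v\<close>.\<close>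

lemma (in monoid) list_prod_braid:
  assumes f: "f i \<in> carrier G" "f j \<in> carrier G" "f i \<otimes> f i = \<one>" "f j \<otimes> f j = \<one>"
    and rel: "list_prod G (map f (concat (replicate n [i, j]))) = \<one>"
  shows "list_prod G (map f (alternating i j n)) = list_prod G (map f (alternating j i n))"
proof -
  let ?u = "list_prod G (map f (alternating i j n))"
  let ?v = "list_prod G (map f (alternating j i n))"
  let ?w = "list_prod G (map f (rev (alternating j i n)))"
  have s: "f ` set (alternating i j k) \<subseteq> carrier G" "f ` set (alternating j i k) \<subseteq> carrier G" for k
    using f(1,2) set_alternating[of i j k] set_alternating[of j i k] by blast+
  have c: "?u \<in> carrier G" "?v \<in> carrier G" "?w \<in> carrier G"
    using s by (auto intro!: list_prod_closed)
  have "?w \<otimes> ?v = \<one>"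
    by (rule list_prod_involutions[of "{i, j}"]) (use f in \<open>auto simp: subset_iff dest: set_alternating[THEN subsetD]\<close>)
  moreover have "?u \<otimes> ?w = \<one>"
    using rel s unfolding alternating_double[symmetric] alternating_append_rev[symmetric] map_append
    by (subst (asm) list_prod_append) auto
  ultimately show ?thesis
    using c by (metis m_assoc r_one l_one)
qed

section \<open>The universal property of the algebra\<close>

text \<open>The antipode reverses products, so it is a homomorphism into the opposite ring and is
  obtained from the same universal property as the coproduct and the counit.\<close>

definition opposite :: "('a, 'b) ring_scheme \<Rightarrow> ('a, 'b) ring_scheme" where
  "opposite R = R\<lparr>monoid.mult := \<lambda>x y. y \<otimes>\<^bsub>R\<^esub> x\<rparr>"

lemma opposite_sel [simp]:
  "carrier (opposite R) = carrier R" "\<one>\<^bsub>opposite R\<^esub> = \<one>\<^bsub>R\<^esub>" "\<zero>\<^bsub>opposite R\<^esub> = \<zero>\<^bsub>R\<^esub>"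
  "ring.add (opposite R) = ring.add R" "x \<otimes>\<^bsub>opposite R\<^esub> y = y \<otimes>\<^bsub>R\<^esub> x"
  by (simp_all add: opposite_def)

lemma opposite_a_inv [simp]: "\<ominus>\<^bsub>opposite R\<^esub> x = \<ominus>\<^bsub>R\<^esub> x" "x \<ominus>\<^bsub>opposite R\<^esub> y = x \<ominus>\<^bsub>R\<^esub> y"
  by (simp_all add: a_inv_def a_minus_def)

lemma opposite_additive_ext: "additive_ext (opposite R) f = additive_ext R f"
  by (simp add: additive_ext_def fun_eq_iff finsum_def add_pow_def)

lemma (in ring) ring_opposite: "ring (opposite R)"
proof (rule ringI)
  show "abelian_group (opposite R)"
    using is_abelian_group by (simp add: abelian_group_def abelian_group_axioms_def abelian_monoid_def)
  show "Group.monoid (opposite R)"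
    by (rule monoidI) (auto simp: m_assoc)
qed (auto simp: l_distr r_distr)

lemma (in ring) list_prod_opposite:
  assumes "set xs \<subseteq> carrier R"
  shows "list_prod (opposite R) xs = list_prod R (rev xs)"
  using assms by (induction xs) (auto simp: list_prod_append)

text \<open>The defining relations for a family in an arbitrary ring. The relation that mixes
  \<open>GenD\<close> with words in \<open>GenS\<close> is put in the form D x = x D, with one and
  the same word x of length \<open>m i j - 1\<close> on both sides, so that it reads as conjugation
  by x.\<close>

locale hat_family =
  fixes I :: "'i set" and m :: "'i \<Rightarrow> 'i \<Rightarrow> nat" and C (structure) and g :: "'i gen \<Rightarrow> 'a"
  assumes S_closed: "i \<in> I \<Longrightarrow> g (GenS i) \<in> carrier C"
    and D_closed: "i \<in> I \<Longrightarrow> g (GenD i) \<in> carrier C"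
    and S_square: "i \<in> I \<Longrightarrow> g (GenS i) \<otimes> g (GenS i) = \<one>"
    and D_square: "i \<in> I \<Longrightarrow> g (GenD i) \<otimes> g (GenD i) = g (GenD i)"
    and S_D: "i \<in> I \<Longrightarrow> g (GenS i) \<otimes> g (GenD i) \<oplus> g (GenD i) \<otimes> g (GenS i) = g (GenS i) \<ominus> \<one>"
    and S_word: "i \<in> I \<Longrightarrow> j \<in> I \<Longrightarrow>
      list_prod C (map (\<lambda>i. g (GenS i)) (concat (replicate (m i j) [i, j]))) = \<one>"
    and braid: "i \<in> I \<Longrightarrow> j \<in> I \<Longrightarrow> i \<noteq> j \<Longrightarrow> m i j \<noteq> 0 \<Longrightarrow>
      g (GenD i) \<otimes> list_prod C (map (\<lambda>i. g (GenS i)) (alternating j i (m i j - 1))) =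
      list_prod C (map (\<lambda>i. g (GenS i)) (alternating j i (m i j - 1))) \<otimes>
        g (GenD (if even (m i j) then i else j))"

lemmas hat_familyI = hat_family.intro
lemmas hat_familyD = hat_family.S_closed hat_family.D_closed hat_family.S_square hat_family.D_square
  hat_family.S_D hat_family.S_word hat_family.braid

locale hat =
  fixes I :: "'i set" and m :: "'i \<Rightarrow> 'i \<Rightarrow> nat"
begin

abbreviation "gens \<equiv> GenS ` I \<union> GenD ` I"
abbreviation "F \<equiv> free_algebra I"
abbreviation "H \<equiv> hatH I m"
abbreviation "gen \<equiv> hat_gen I m"
abbreviation lift where "lift C g \<equiv> descend (additive_ext C (\<lambda>u. list_prod C (map g u)))"

lemma monoid_free: "monoid (free_monoid gens)"
  by (rule monoidI) (auto simp: free_monoid_def)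

lemma free_monoid_sel [simp]:
  "carrier (free_monoid X) = lists X" "\<one>\<^bsub>free_monoid X\<^esub> = []" "x \<otimes>\<^bsub>free_monoid X\<^esub> y = x @ y"
  by (simp_all add: free_monoid_def)

sublocale F: ring F
  unfolding free_algebra_def by (rule ring_monoid_ring[OF monoid_free])

lemma F_sel [simp]: "carrier F = {p. Poly_Mapping.keys p \<subseteq> lists gens}" "\<one>\<^bsub>F\<^esub> = frag_of []"
  "\<zero>\<^bsub>F\<^esub> = 0" "p \<oplus>\<^bsub>F\<^esub> q = p + q"
  by (simp_all add: free_algebra_def)

lemma F_mult_of [simp]: "frag_of u \<otimes>\<^bsub>F\<^esub> frag_of v = frag_of (u @ v)"
  by (simp add: free_algebra_def)

lemma F_minus [simp]: "p \<in> carrier F \<Longrightarrow> q \<in> carrier F \<Longrightarrow> p \<ominus>\<^bsub>F\<^esub> q = p - q"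
  unfolding free_algebra_def by (rule monoid_ring_minus[OF monoid_free]) simp_all

lemma F_diff_closed: "p \<in> carrier F \<Longrightarrow> q \<in> carrier F \<Longrightarrow> p - q \<in> carrier F"
  using F.minus_closed[of p q] F_minus[of p q] by simp

lemma frag_of_F: "u \<in> lists gens \<Longrightarrow> frag_of u \<in> carrier F"
  by simp

lemma map_GenS_lists: "set u \<subseteq> I \<Longrightarrow> map GenS u \<in> lists gens"
  by (auto intro!: imageI)

text \<open>Deleting the first letter of the braid word from \<open>i\<close> or the last letter of
  the braid word from \<open>j\<close> leaves the same word. This is why the relation says that a
  group element conjugates one generator D into another.\<close>

lemma relation_words:
  assumes "i \<in> I" "j \<in> I" "m i j \<noteq> 0"
  shows "map GenS (tl (alternating i j (m i j))) = map GenS (alternating j i (m i j - 1))"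
    "map GenS (butlast (alternating j i (m i j))) = map GenS (alternating j i (m i j - 1))"
    "last (alternating j i (m i j)) = (if even (m i j) then i else j)"
proof -
  obtain n where n: "m i j = Suc n" using assms(3) not0_implies_Suc by blast
  show "map GenS (tl (alternating i j (m i j))) = map GenS (alternating j i (m i j - 1))"
    by (simp add: n alternating_Suc)
  show "map GenS (butlast (alternating j i (m i j))) = map GenS (alternating j i (m i j - 1))"
    "last (alternating j i (m i j)) = (if even (m i j) then i else j)"
    by (simp_all add: n alternating_snoc)
qed

lemma concat_gens:
  "concat (replicate n [GenS i, GenS j]) = map GenS (concat (replicate n [i, j]))"
  by (induction n) auto

lemma hat_relations_carrier: "hat_relations I m \<subseteq> carrier F"
proof
  note [simp del] = F_sel
  fix x assume "x \<in> hat_relations I m"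
  then show "x \<in> carrier F"
    unfolding hat_relations_def
  proof (elim UnE CollectE exE conjE)
    fix i assume "x = frag_of [GenS i, GenD i] + frag_of [GenD i, GenS i] - (frag_of [GenS i] - frag_of [])"
      "i \<in> I"
    then show ?thesis
      using F.a_closed[OF frag_of_F[of "[GenS i, GenD i]"] frag_of_F[of "[GenD i, GenS i]"]]
      by (auto intro!: F_diff_closed frag_of_F simp: F_sel(4))
  next
    fix i j assume *: "x = frag_of (concat (replicate (m i j) [GenS i, GenS j])) - frag_of []" "i \<in> I" "j \<in> I"
    show ?thesis unfolding *(1) concat_gens
      by (intro F_diff_closed frag_of_F map_GenS_lists) (use * in auto)
  next
    fix i j assume *: "x = frag_of (GenD i # map GenS (tl (alternating i j (m i j)))) -
      frag_of (map GenS (butlast (alternating j i (m i j))) @ [GenD (last (alternating j i (m i j)))])"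
      "i \<in> I" "j \<in> I" "m i j \<noteq> 0"
    show ?thesis unfolding *(1) relation_words[OF *(2-4)]
      by (intro F_diff_closed frag_of_F) (use * map_GenS_lists[OF set_alternating', of j i] in auto)
  qed (auto intro!: F_diff_closed frag_of_F)
qed

sublocale R: ideal "hat_ideal I m" F
  unfolding hat_ideal_def by (rule F.genideal_ideal[OF hat_relations_carrier])

sublocale H: ring H
  unfolding hatH_def by (rule R.quotient_is_ring)

lemma gen_closed [simp]: "x \<in> gens \<Longrightarrow> gen x \<in> carrier H"
  unfolding hat_gen_def hatH_def by (rule R.quot_simps) auto

lemma list_prod_gens:
  "u \<in> lists gens \<Longrightarrow> list_prod H (map gen u) = hat_ideal I m +>\<^bsub>F\<^esub> frag_of u"
proof (induction u)
  case (Cons x u)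
  then show ?case unfolding hatH_def hat_gen_def
    by (simp del: lists.simps F_sel, subst R.quot_simps) auto
qed (simp add: hatH_def)

lemma hat_induct [consumes 1, case_names one gen diff]:
  assumes "x \<in> carrier H" "P \<one>\<^bsub>H\<^esub>"
    and "\<And>x a. a \<in> gens \<Longrightarrow> x \<in> carrier H \<Longrightarrow> P x \<Longrightarrow> P (gen a \<otimes>\<^bsub>H\<^esub> x)"
    and "\<And>x y. x \<in> carrier H \<Longrightarrow> y \<in> carrier H \<Longrightarrow> P x \<Longrightarrow> P y \<Longrightarrow> P (x \<ominus>\<^bsub>H\<^esub> y)"
  shows "P x"
proof -
  obtain p where p: "p \<in> carrier F" "x = hat_ideal I m +>\<^bsub>F\<^esub> p"
    using assms(1) unfolding hatH_def by (elim R.quot_elem)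
  let ?c = "\<lambda>p. hat_ideal I m +>\<^bsub>F\<^esub> p"
  interpret c: abelian_group_hom F H ?c
    unfolding hatH_def
    by (rule ring_hom_abelian_group_hom) (rule F.ring_axioms R.quotient_is_ring R.rcos_ring_hom)+
  have w: "list_prod H (map gen u) \<in> carrier H \<and> P (list_prod H (map gen u))" if "u \<in> lists gens" for u
    using that
  proof (induction u)
    case (Cons a u)
    then show ?case using assms(3)[of a "list_prod H (map gen u)"] gen_closed[of a] by auto
  qed (use assms(2) in auto)
  have "P (?c p)"
    using p(1)[unfolded F_sel mem_Collect_eq]
  proof (induction p rule: frag_span_induct)
    case zero
    have "\<zero>\<^bsub>H\<^esub> = \<one>\<^bsub>H\<^esub> \<ominus>\<^bsub>H\<^esub> \<one>\<^bsub>H\<^esub>" by (simp add: H.r_neg H.minus_eq)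
    then have "P \<zero>\<^bsub>H\<^esub>" using assms(2) assms(4)[of "\<one>\<^bsub>H\<^esub>" "\<one>\<^bsub>H\<^esub>"] by simp
    then show ?case using c.hom_zero by simp
  next
    case (one u)
    then show ?case using w by (simp add: list_prod_gens)
  next
    case (diff p q)
    then have pq: "p \<in> carrier F" "q \<in> carrier F" by auto
    then show ?case
      using c.hom_minus[OF pq] assms(4)[OF c.hom_closed[OF pq(1)] c.hom_closed[OF pq(2)]] diff
      by simp
  qed
  then show ?thesis using p(2) by simp
qed

lemma hat_hom_eqI:
  assumes "ring C" "h \<in> ring_hom H C" "k \<in> ring_hom H C" "\<And>a. a \<in> gens \<Longrightarrow> h (gen a) = k (gen a)"
    and "x \<in> carrier H"
  shows "h x = k x"
proof -
  interpret h: abelian_group_hom H C h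
    by (rule ring_hom_abelian_group_hom[OF H.ring_axioms assms(1,2)])
  interpret k: abelian_group_hom H C k
    by (rule ring_hom_abelian_group_hom[OF H.ring_axioms assms(1,3)])
  from assms(5) show ?thesis
  proof (induction x rule: hat_induct)
    case (gen x a)
    then show ?case using assms(2,3,4) gen_closed[of a] by (simp add: ring_hom_mult del: Un_iff)
  next
    case (diff x y)
    then show ?case by (simp add: h.hom_minus k.hom_minus)
  qed (use assms(2,3) in \<open>simp add: ring_hom_one\<close>)
qed

context
  fixes C :: "('c, 'd) ring_scheme" and g
  assumes C: "ring C" and g: "hat_family I m C g"
begin

interpretation C: ring C by (rule C)

lemma family_closed: "a \<in> gens \<Longrightarrow> g a \<in> carrier C"
  using hat_familyD(1,2)[OF g] by auto

lemma family_list_prod: "u \<in> lists gens \<Longrightarrow> list_prod C (map g u) \<in> carrier C"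
  using family_closed by (intro C.list_prod_closed) auto

lemma free_lift_ring_hom: "additive_ext C (\<lambda>u. list_prod C (map g u)) \<in> ring_hom F C"
  unfolding free_algebra_def
proof (rule additive_ext_ring_hom[OF monoid_free C])
  fix u v assume "u \<in> carrier (free_monoid gens)" "v \<in> carrier (free_monoid gens)"
  then show "list_prod C (map g (u \<otimes>\<^bsub>free_monoid gens\<^esub> v)) =
      list_prod C (map g u) \<otimes>\<^bsub>C\<^esub> list_prod C (map g v)"
  proof -
    have "set (map g w) \<subseteq> carrier C" if "w \<in> lists gens" for w
      using that family_closed by auto
    then show ?thesis
      using \<open>u \<in> _\<close> \<open>v \<in> _\<close> by (simp add: C.list_prod_append del: set_map in_lists_conv_set)
  qed
qed (use family_list_prod in auto)

lemma free_lift_of: "u \<in> lists gens \<Longrightarrow> additive_ext C (\<lambda>u. list_prod C (map g u)) (frag_of u) = list_prod C (map g u)"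
  by (simp add: family_list_prod del: in_lists_conv_set)

lemma free_lift_hom: "abelian_group_hom F C (additive_ext C (\<lambda>u. list_prod C (map g u)))"
  by (rule ring_hom_abelian_group_hom[OF F.ring_axioms C free_lift_ring_hom])

lemma free_lift_ideal:
  assumes "j \<in> hat_ideal I m"
  shows "additive_ext C (\<lambda>u. list_prod C (map g u)) j = \<zero>\<^bsub>C\<^esub>"
proof (rule F.genideal_kernel[OF C free_lift_ring_hom hat_relations_carrier])
  show "j \<in> Idl\<^bsub>F\<^esub> hat_relations I m" using assms by (simp add: hat_ideal_def)
  note [simp del] = F_sel
  let ?h = "additive_ext C (\<lambda>u. list_prod C (map g u))"
  interpret h: abelian_group_hom F C ?h by (rule free_lift_hom)
  have hd: "?h (p - q) = ?h p \<ominus>\<^bsub>C\<^esub> ?h q" if "p \<in> carrier F" "q \<in> carrier F" for p q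
    using h.hom_minus[OF that] that by simp
  have ha: "?h (p + q) = ?h p \<oplus>\<^bsub>C\<^esub> ?h q" if "p \<in> carrier F" "q \<in> carrier F" for p q
    using h.hom_add[OF that] that by (simp add: F_sel)
  have z: "a \<ominus>\<^bsub>C\<^esub> b = \<zero>\<^bsub>C\<^esub>" if "a = b" "b \<in> carrier C" for a b
    using that by (simp add: C.minus_eq C.r_neg)
  have gc: "g (GenS i) \<in> carrier C" "g (GenD i) \<in> carrier C" if "i \<in> I" for i
    using hat_familyD(1,2)[OF g that] by auto
  fix x assume "x \<in> hat_relations I m"
  then show "?h x = \<zero>\<^bsub>C\<^esub>"
    unfolding hat_relations_def
  proof (elim UnE CollectE exE conjE)
    fix i assume *: "x = frag_of [GenS i, GenS i] - frag_of []" "i \<in> I"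
    show ?thesis unfolding *(1)
      using * gc hat_familyD(3)[OF g]
      by (subst hd) (auto intro!: z frag_of_F simp: free_lift_of)
  next
    fix i assume *: "x = frag_of [GenD i, GenD i] - frag_of [GenD i]" "i \<in> I"
    show ?thesis unfolding *(1)
      using * gc hat_familyD(4)[OF g]
      by (subst hd) (auto intro!: z frag_of_F simp: free_lift_of)
  next
    fix i assume *: "x = frag_of [GenS i, GenD i] + frag_of [GenD i, GenS i] - (frag_of [GenS i] - frag_of [])"
      "i \<in> I"
    have c: "frag_of [GenS i, GenD i] + frag_of [GenD i, GenS i] \<in> carrier F"
      using F.a_closed[OF frag_of_F[of "[GenS i, GenD i]"] frag_of_F[of "[GenD i, GenS i]"]] *(2)
      by (simp add: F_sel(4))
    have l: "[GenS i, GenD i] \<in> lists gens" "[GenD i, GenS i] \<in> lists gens" "[GenS i] \<in> lists gens" "[] \<in> lists gens"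
      using *(2) by auto
    note fl = l[THEN frag_of_F]
    show ?thesis unfolding *(1) hd[OF c F_diff_closed[OF fl(3,4)]] hd[OF fl(3,4)] ha[OF fl(1,2)]
      using * gc hat_familyD(5)[OF g]
      by (intro z) (auto simp: free_lift_of l simp del: in_lists_conv_set)
  next
    fix i j assume *: "x = frag_of (concat (replicate (m i j) [GenS i, GenS j])) - frag_of []" "i \<in> I" "j \<in> I"
    have l: "map GenS (concat (replicate (m i j) [i, j])) \<in> lists gens"
      by (rule map_GenS_lists) (use * in auto)
    have "?h (frag_of (map GenS (concat (replicate (m i j) [i, j])))) = \<one>\<^bsub>C\<^esub>"
      using hat_familyD(6)[OF g *(2,3)] by (subst free_lift_of[OF l]) (simp add: comp_def)
    then show ?thesis unfolding *(1) concat_gens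
      by (subst hd[OF frag_of_F[OF l] frag_of_F]) (auto intro!: z simp: free_lift_of)
  next
    fix i j assume *: "x = frag_of (GenD i # map GenS (tl (alternating i j (m i j)))) -
      frag_of (map GenS (butlast (alternating j i (m i j))) @ [GenD (last (alternating j i (m i j)))])"
      "i \<in> I" "j \<in> I" "i \<noteq> j" "m i j \<noteq> 0"
    let ?u = "alternating j i (m i j - 1)" and ?l = "if even (m i j) then i else j"
    have u: "map GenS ?u \<in> lists gens"
      by (rule map_GenS_lists) (use * in auto)
    then have l: "GenD i # map GenS ?u \<in> lists gens" "map GenS ?u @ [GenD ?l] \<in> lists gens"
      using * by auto
    have "set (map g (map GenS ?u)) \<subseteq> carrier C" using u family_closed by auto
    then have "?h (frag_of (map GenS ?u @ [GenD ?l])) =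
        list_prod C (map g (map GenS ?u)) \<otimes>\<^bsub>C\<^esub> g (GenD ?l)"
      using * gc by (subst free_lift_of[OF l(2)]) (simp add: C.list_prod_append del: set_map)
    moreover have "?h (frag_of (GenD i # map GenS ?u)) = g (GenD i) \<otimes>\<^bsub>C\<^esub> list_prod C (map g (map GenS ?u))"
      by (subst free_lift_of[OF l(1)]) simp
    ultimately show ?thesis unfolding *(1) relation_words[OF *(2,3,5)]
      using hat_familyD(7)[OF g *(2-5)] h.hom_closed[OF frag_of_F[OF l(2)]]
      by (subst hd[OF frag_of_F[OF l(1)] frag_of_F[OF l(2)]]) (auto intro!: z simp: comp_def)
  qed
qed

lemma lift_ring_hom: "lift C g \<in> ring_hom H C"
  unfolding hatH_def by (rule R.descend_ring_hom[OF C free_lift_ring_hom free_lift_ideal])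

lemma lift_gen:
  assumes "a \<in> gens"
  shows "lift C g (gen a) = g a"
proof -
  have "[a] \<in> lists gens" using assms by auto
  then show ?thesis
    unfolding hat_gen_def
    using family_closed[OF assms]
    by (subst R.descend_coset[OF free_lift_hom free_lift_ideal])
      (auto simp: free_lift_of simp del: in_lists_conv_set)
qed

end

lemma coset_eqI:
  assumes "p \<in> carrier F" "q \<in> carrier F" "p - q \<in> hat_relations I m"
  shows "hat_ideal I m +>\<^bsub>F\<^esub> p = hat_ideal I m +>\<^bsub>F\<^esub> q"
proof -
  have "p \<ominus>\<^bsub>F\<^esub> q \<in> hat_ideal I m"
    using assms F.genideal_self[OF hat_relations_carrier] by (auto simp: hat_ideal_def)
  then show ?thesis using R.quot_eq_iff assms(1,2) by blast
qed

lemma hat_family_gen: "hat_family I m H gen"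
proof (rule hat_familyI)
  note [simp del] = F_sel
  have wd: "list_prod H (map gen u) = list_prod H (map gen v)"
    if "u \<in> lists gens" "v \<in> lists gens" "frag_of u - frag_of v \<in> hat_relations I m" for u v
    using that coset_eqI[OF frag_of_F frag_of_F, of u v] by (simp add: list_prod_gens)
  fix i assume i: "i \<in> I"
  show gc: "gen (GenS i) \<in> carrier H" "gen (GenD i) \<in> carrier H"
    using i by auto
  show "gen (GenS i) \<otimes>\<^bsub>H\<^esub> gen (GenS i) = \<one>\<^bsub>H\<^esub>"
  proof -
    have "frag_of [GenS i, GenS i] - frag_of [] \<in> hat_relations I m"
      unfolding hat_relations_def using i by blast
    then show ?thesis using wd[of "[GenS i, GenS i]" "[]"] i gc by simp
  qed
  show "gen (GenD i) \<otimes>\<^bsub>H\<^esub> gen (GenD i) = gen (GenD i)"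
  proof -
    have "frag_of [GenD i, GenD i] - frag_of [GenD i] \<in> hat_relations I m"
      unfolding hat_relations_def using i by blast
    then show ?thesis using wd[of "[GenD i, GenD i]" "[GenD i]"] i gc by simp
  qed
  have l: "[GenS i, GenD i] \<in> lists gens" "[GenD i, GenS i] \<in> lists gens" "[GenS i] \<in> lists gens" "[] \<in> lists gens"
    using i by auto
  note fl = l[THEN frag_of_F]
  have s: "frag_of [GenS i, GenD i] + frag_of [GenD i, GenS i] \<in> carrier F"
    using F.a_closed[OF fl(1,2)] by (simp add: F_sel)
  interpret c: abelian_group_hom F H "\<lambda>p. hat_ideal I m +>\<^bsub>F\<^esub> p"
    unfolding hatH_def
    by (rule ring_hom_abelian_group_hom) (rule F.ring_axioms R.quotient_is_ring R.rcos_ring_hom)+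
  have "hat_ideal I m +>\<^bsub>F\<^esub> (frag_of [GenS i, GenD i] \<oplus>\<^bsub>F\<^esub> frag_of [GenD i, GenS i]) =
      hat_ideal I m +>\<^bsub>F\<^esub> (frag_of [GenS i] \<ominus>\<^bsub>F\<^esub> frag_of [])"
    unfolding F_minus[OF fl(3,4)] F_sel(4)
  proof (rule coset_eqI[OF s F_diff_closed[OF fl(3,4)]])
    show "frag_of [GenS i, GenD i] + frag_of [GenD i, GenS i] - (frag_of [GenS i] - frag_of [])
        \<in> hat_relations I m"
      unfolding hat_relations_def using i by blast
  qed
  then have "list_prod H (map gen [GenS i, GenD i]) \<oplus>\<^bsub>H\<^esub> list_prod H (map gen [GenD i, GenS i]) =
      list_prod H (map gen [GenS i]) \<ominus>\<^bsub>H\<^esub> list_prod H (map gen [])"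
    unfolding list_prod_gens[OF l(1)] list_prod_gens[OF l(2)] list_prod_gens[OF l(3)] list_prod_gens[OF l(4)]
    using c.hom_add[OF fl(1,2)] c.hom_minus[OF fl(3,4)] by simp
  then show "gen (GenS i) \<otimes>\<^bsub>H\<^esub> gen (GenD i) \<oplus>\<^bsub>H\<^esub> gen (GenD i) \<otimes>\<^bsub>H\<^esub> gen (GenS i) =
      gen (GenS i) \<ominus>\<^bsub>H\<^esub> \<one>\<^bsub>H\<^esub>"
    using gc by simp
  fix j assume j: "j \<in> I"
  have l: "map GenS (concat (replicate (m i j) [i, j])) \<in> lists gens"
    by (rule map_GenS_lists) (use i j in auto)
  have "list_prod H (map gen (map GenS (concat (replicate (m i j) [i, j])))) = list_prod H (map gen [])"
    by (rule wd[OF l]) (use i j in \<open>auto simp: hat_relations_def concat_gens[symmetric] simp del: map_concat\<close>)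
  then show "list_prod H (map (\<lambda>i. gen (GenS i)) (concat (replicate (m i j) [i, j]))) = \<one>\<^bsub>H\<^esub>"
    by (simp add: comp_def)
  assume ij: "i \<noteq> j" "m i j \<noteq> 0"
  let ?u = "alternating j i (m i j - 1)" and ?l = "if even (m i j) then i else j"
  have u: "map GenS ?u \<in> lists gens"
    by (rule map_GenS_lists) (use i j in auto)
  then have l: "GenD i # map GenS ?u \<in> lists gens" "map GenS ?u @ [GenD ?l] \<in> lists gens"
    using i j by auto
  have "list_prod H (map gen (GenD i # map GenS ?u)) = list_prod H (map gen (map GenS ?u @ [GenD ?l]))"
  proof (rule wd[OF l])
    have "frag_of (GenD i # map GenS (tl (alternating i j (m i j)))) -
        frag_of (map GenS (butlast (alternating j i (m i j))) @ [GenD (last (alternating j i (m i j)))])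
      \<in> hat_relations I m"
      unfolding hat_relations_def using i j ij by (intro UnI2 CollectI) blast
    then show "frag_of (GenD i # map GenS ?u) - frag_of (map GenS ?u @ [GenD ?l]) \<in> hat_relations I m"
      unfolding relation_words[OF i j ij(2)] .
  qed
  moreover have "set (map gen (map GenS ?u)) \<subseteq> carrier H" using u by (auto intro!: gen_closed)
  moreover have "gen (GenD ?l) \<in> carrier H" using i j by auto
  ultimately show "gen (GenD i) \<otimes>\<^bsub>H\<^esub> list_prod H (map (\<lambda>i. gen (GenS i)) ?u) =
      list_prod H (map (\<lambda>i. gen (GenS i)) ?u) \<otimes>\<^bsub>H\<^esub> gen (GenD ?l)"
    by (simp add: H.list_prod_append comp_def del: set_map)
qed

end

section \<open>The Hopf algebra structure\<close>

lemma (in two_rings) T_distr: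
  "t \<in> carrier T \<Longrightarrow> u \<in> carrier T \<Longrightarrow> v \<in> carrier T \<Longrightarrow>
    (t \<oplus>\<^bsub>T\<^esub> u) \<otimes>\<^bsub>T\<^esub> v = t \<otimes>\<^bsub>T\<^esub> v \<oplus>\<^bsub>T\<^esub> u \<otimes>\<^bsub>T\<^esub> v"
  "t \<in> carrier T \<Longrightarrow> u \<in> carrier T \<Longrightarrow> v \<in> carrier T \<Longrightarrow>
    v \<otimes>\<^bsub>T\<^esub> (t \<oplus>\<^bsub>T\<^esub> u) = v \<otimes>\<^bsub>T\<^esub> t \<oplus>\<^bsub>T\<^esub> v \<otimes>\<^bsub>T\<^esub> u"
  by (simp_all add: T.l_distr T.r_distr)

text \<open>Three maps rather than one, since in the proof of coassociativity the map to be lifted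
  depends on a right tensor factor, which is b, b' and their product in the three places.\<close>

lemma (in two_rings) tensor_lift_mult:
  fixes C :: "('e, 'f) ring_scheme"
  assumes C: "ring C" and f: "biadditive A B C f" "biadditive A B C f'" "biadditive A B C f''"
    and m: "\<And>a a' b b'. a \<in> carrier A \<Longrightarrow> a' \<in> carrier A \<Longrightarrow> b \<in> carrier B \<Longrightarrow> b' \<in> carrier B \<Longrightarrow>
      f'' (a \<otimes>\<^bsub>A\<^esub> a') (b \<otimes>\<^bsub>B\<^esub> b') = f a b \<otimes>\<^bsub>C\<^esub> f' a' b'"
    and t: "t \<in> carrier T" and u: "u \<in> carrier T"
  shows "tensor_lift C f'' (t \<otimes>\<^bsub>T\<^esub> u) = tensor_lift C f t \<otimes>\<^bsub>C\<^esub> tensor_lift C f' u"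
proof -
  interpret C: ring C by fact
  interpret f: abelian_group_hom T C "tensor_lift C f" by (rule tensor_lift_hom) fact
  interpret f': abelian_group_hom T C "tensor_lift C f'" by (rule tensor_lift_hom) fact
  interpret f'': abelian_group_hom T C "tensor_lift C f''" by (rule tensor_lift_hom) fact
  from t show ?thesis
  proof (induction t rule: tensor_induct)
    case (pure a b)
    from u show ?case
    proof (induction u rule: tensor_induct)
      case (pure a' b')
      then show ?case using \<open>a \<in> carrier A\<close> \<open>b \<in> carrier B\<close> m
        by (simp add: tensor_lift_pure f)
    next
      case (add t u)
      then show ?case using \<open>a \<in> carrier A\<close> \<open>b \<in> carrier B\<close>
        by (simp add: T_distr C.r_distr)
    qed
  next
    case (add t t')
    then show ?case using u by (simp add: T_distr C.l_distr)
  qed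
qed

context hat
begin

abbreviation "s i \<equiv> gen (GenS i)"
abbreviation "d i \<equiv> gen (GenD i)"
abbreviation "sw u \<equiv> list_prod H (map s u)"

sublocale S: tensor_square H ..

lemmas rel = hat_familyD[OF hat_family_gen]

lemma s_closed [simp]: "i \<in> I \<Longrightarrow> s i \<in> carrier H"
  and d_closed [simp]: "i \<in> I \<Longrightarrow> d i \<in> carrier H"
  by auto

lemma ss [simp]: "i \<in> I \<Longrightarrow> s i \<otimes>\<^bsub>H\<^esub> s i = \<one>\<^bsub>H\<^esub>"
  and dd [simp]: "i \<in> I \<Longrightarrow> d i \<otimes>\<^bsub>H\<^esub> d i = d i"
  by (auto simp: rel)

lemma ss_left [simp]: "i \<in> I \<Longrightarrow> x \<in> carrier H \<Longrightarrow> s i \<otimes>\<^bsub>H\<^esub> (s i \<otimes>\<^bsub>H\<^esub> x) = x"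
  by (simp flip: H.m_assoc)

lemma sd: "i \<in> I \<Longrightarrow> s i \<otimes>\<^bsub>H\<^esub> d i = s i \<ominus>\<^bsub>H\<^esub> \<one>\<^bsub>H\<^esub> \<ominus>\<^bsub>H\<^esub> d i \<otimes>\<^bsub>H\<^esub> s i"
  using rel(5)[of i]
  by (metis H.add.inv_solve_right H.m_closed H.minus_closed H.minus_eq H.one_closed a_inv_def d_closed s_closed)

lemma sds: "i \<in> I \<Longrightarrow> s i \<otimes>\<^bsub>H\<^esub> d i \<otimes>\<^bsub>H\<^esub> s i = \<one>\<^bsub>H\<^esub> \<ominus>\<^bsub>H\<^esub> s i \<ominus>\<^bsub>H\<^esub> d i"
  by (simp add: sd H.minus_eq H.l_distr H.l_minus H.m_assoc H.minus_add)

lemma sw_closed [simp]: "set u \<subseteq> I \<Longrightarrow> sw u \<in> carrier H"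
  by (rule H.list_prod_closed) auto

lemma sw_append: "set u \<subseteq> I \<Longrightarrow> set v \<subseteq> I \<Longrightarrow> sw (u @ v) = sw u \<otimes>\<^bsub>H\<^esub> sw v"
  by (subst map_append, rule H.list_prod_append) auto

lemma sw_rev: 
  assumes "set u \<subseteq> I"
  shows "sw (rev u) \<otimes>\<^bsub>H\<^esub> sw u = \<one>\<^bsub>H\<^esub>" "sw u \<otimes>\<^bsub>H\<^esub> sw (rev u) = \<one>\<^bsub>H\<^esub>"
  using H.list_prod_involutions[of I s u] H.list_prod_involutions[of I s "rev u"] assms by auto

lemma sw_braid: "i \<in> I \<Longrightarrow> j \<in> I \<Longrightarrow> sw (alternating i j (m i j)) = sw (alternating j i (m i j))"
  using rel(6)[of i j] by (intro H.list_prod_braid) auto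

text \<open>The braid word is read once as \<open>i\<close> followed by x and once as x followed by
  a last letter. The summand s tensor D in the coproduct of D calls for this companion of the
  relation for D: x tensor x has to be moved past both factors.\<close>

lemma braid_conj:
  assumes "i \<in> I" "j \<in> I" "m i j \<noteq> 0"
  shows "s i \<otimes>\<^bsub>H\<^esub> sw (alternating j i (m i j - 1)) =
    sw (alternating j i (m i j - 1)) \<otimes>\<^bsub>H\<^esub> s (if even (m i j) then i else j)"
proof -
  obtain n where n: "m i j = Suc n" using assms(3) not0_implies_Suc by blast
  have "sw (alternating i j (Suc n)) = sw (alternating j i (Suc n))"
    using sw_braid[OF assms(1,2)] by (simp add: n)
  then have "s i \<otimes>\<^bsub>H\<^esub> sw (alternating j i n) = sw (alternating j i n @ [if even n then j else i])"
    by (simp only: alternating_Suc[of i j] alternating_snoc[of j i]) simp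
  also have "\<dots> = sw (alternating j i n) \<otimes>\<^bsub>H\<^esub> s (if even n then j else i)"
    using assms by (subst sw_append) auto
  finally show ?thesis by (simp add: n)
qed

lemma hat_comult_family: "hat_family I m S.A2 (comult_gen I m)"
proof (rule hat_familyI)
  have lp: "list_prod S.A2 (map (\<lambda>i. comult_gen I m (GenS i)) u) = pure_tensor H H (sw u) (sw u)"
    if "set u \<subseteq> I" for u
    using that by (induction u) (simp_all add: S.T2.T_one)
  note D = S.T2.T_distr S.T2.pure_add_left S.T2.pure_add_right S.T2.T_one
  fix i assume i: "i \<in> I"
  then show c: "comult_gen I m (GenS i) \<in> carrier S.A2" "comult_gen I m (GenD i) \<in> carrier S.A2"
    by simp_all
  show "comult_gen I m (GenS i) \<otimes>\<^bsub>S.A2\<^esub> comult_gen I m (GenS i) = \<one>\<^bsub>S.A2\<^esub>"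
    using i by (simp add: S.T2.T_one)
  let ?p = "pure_tensor H H" and ?one = "\<one>\<^bsub>H\<^esub>"
  \<comment> \<open>The mixed terms add up to (s D + D s) tensor D, which s D + D s = s - 1 turns
    into s tensor D minus 1 tensor D. The latter cancels against the square of s tensor D.\<close>
  have "comult_gen I m (GenD i) \<otimes>\<^bsub>S.A2\<^esub> comult_gen I m (GenD i) =
     ?p (d i) ?one \<oplus>\<^bsub>S.A2\<^esub> (?p (s i \<otimes>\<^bsub>H\<^esub> d i \<oplus>\<^bsub>H\<^esub> d i \<otimes>\<^bsub>H\<^esub> s i) (d i) \<oplus>\<^bsub>S.A2\<^esub> ?p ?one (d i))"
    using i by (simp add: D S.T2.T.a_ac)
  also have "s i \<otimes>\<^bsub>H\<^esub> d i \<oplus>\<^bsub>H\<^esub> d i \<otimes>\<^bsub>H\<^esub> s i = s i \<ominus>\<^bsub>H\<^esub> ?one"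
    using i by (rule rel)
  also have "?p (s i \<ominus>\<^bsub>H\<^esub> ?one) (d i) \<oplus>\<^bsub>S.A2\<^esub> ?p ?one (d i) = ?p (s i) (d i)"
    using i by (simp add: H.minus_eq H.a_assoc H.l_neg flip: S.T2.pure_add_left)
  finally show "comult_gen I m (GenD i) \<otimes>\<^bsub>S.A2\<^esub> comult_gen I m (GenD i) = comult_gen I m (GenD i)"
    by simp
  have "comult_gen I m (GenS i) \<otimes>\<^bsub>S.A2\<^esub> comult_gen I m (GenD i) \<oplus>\<^bsub>S.A2\<^esub>
      comult_gen I m (GenD i) \<otimes>\<^bsub>S.A2\<^esub> comult_gen I m (GenS i) =
      ?p (s i \<otimes>\<^bsub>H\<^esub> d i \<oplus>\<^bsub>H\<^esub> d i \<otimes>\<^bsub>H\<^esub> s i) (s i) \<oplus>\<^bsub>S.A2\<^esub> ?p ?one (s i \<otimes>\<^bsub>H\<^esub> d i \<oplus>\<^bsub>H\<^esub> d i \<otimes>\<^bsub>H\<^esub> s i)"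
    using i by (simp add: D S.T2.T.a_ac)
  also have "s i \<otimes>\<^bsub>H\<^esub> d i \<oplus>\<^bsub>H\<^esub> d i \<otimes>\<^bsub>H\<^esub> s i = s i \<ominus>\<^bsub>H\<^esub> ?one"
    using i by (rule rel)
  also have "?p (s i \<ominus>\<^bsub>H\<^esub> ?one) (s i) \<oplus>\<^bsub>S.A2\<^esub> ?p ?one (s i \<ominus>\<^bsub>H\<^esub> ?one) =
      ?p (s i) (s i) \<ominus>\<^bsub>S.A2\<^esub> \<one>\<^bsub>S.A2\<^esub>"
    using i by (simp add: H.minus_eq S.T2.T.minus_eq D S.T2.pure_minus S.T2.T.a_assoc)
      (simp add: S.T2.T.a_assoc[symmetric] S.T2.T.l_neg)
  finally show "comult_gen I m (GenS i) \<otimes>\<^bsub>S.A2\<^esub> comult_gen I m (GenD i) \<oplus>\<^bsub>S.A2\<^esub>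
      comult_gen I m (GenD i) \<otimes>\<^bsub>S.A2\<^esub> comult_gen I m (GenS i) = comult_gen I m (GenS i) \<ominus>\<^bsub>S.A2\<^esub> \<one>\<^bsub>S.A2\<^esub>"
    by simp
  fix j assume j: "j \<in> I"
  show "list_prod S.A2 (map (\<lambda>i. comult_gen I m (GenS i)) (concat (replicate (m i j) [i, j]))) = \<one>\<^bsub>S.A2\<^esub>"
    using i j by (subst lp) (simp_all add: rel S.T2.T_one)
  assume ij: "i \<noteq> j" "m i j \<noteq> 0"
  let ?u = "alternating j i (m i j - 1)" and ?l = "if even (m i j) then i else j"
  have u: "set ?u \<subseteq> I" and l: "?l \<in> I" using i j by auto
  show "comult_gen I m (GenD i) \<otimes>\<^bsub>S.A2\<^esub> list_prod S.A2 (map (\<lambda>i. comult_gen I m (GenS i)) ?u) =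
    list_prod S.A2 (map (\<lambda>i. comult_gen I m (GenS i)) ?u) \<otimes>\<^bsub>S.A2\<^esub> comult_gen I m (GenD ?l)"
    unfolding lp[OF u] unfolding comult_gen.simps
    using i l u rel(7)[OF i j ij] braid_conj[OF i j ij(2)] sw_closed[OF u]
    by (simp add: S.T2.T_distr del: if_split)
qed

lemma counit_family: "hat_family I m \<Z> counit_gen"
proof (rule hat_familyI)
  have lp: "list_prod \<Z> (map (\<lambda>i. counit_gen (GenS i)) u) = 1" for u
    by (induction u) simp_all
  fix i j
  show "list_prod \<Z> (map (\<lambda>i. counit_gen (GenS i)) (concat (replicate (m i j) [i, j]))) = \<one>\<^bsub>\<Z>\<^esub>"
    by (simp only: lp) simp
qed (simp_all add: int_a_minus_eq)

lemma antipode_family: "hat_family I m (opposite H) (antipode_gen I m)"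
proof (rule hat_familyI)
  have lp: "list_prod (opposite H) (map (\<lambda>i. antipode_gen I m (GenS i)) u) = sw (rev u)"
    if "set u \<subseteq> I" for u
    using that by (subst H.list_prod_opposite) (auto simp: rev_map)
  fix i assume i: "i \<in> I"
  then show c: "antipode_gen I m (GenS i) \<in> carrier (opposite H)"
    "antipode_gen I m (GenD i) \<in> carrier (opposite H)"
    by simp_all
  show "antipode_gen I m (GenS i) \<otimes>\<^bsub>opposite H\<^esub> antipode_gen I m (GenS i) = \<one>\<^bsub>opposite H\<^esub>"
    using i by simp
  \<comment> \<open>By \<open>sds\<close> the factor s D s equals 1 - s - D, and multiplying it by D
    on the right leaves - s D. So the image - s D of the generator is idempotent.\<close>
  have "(s i \<otimes>\<^bsub>H\<^esub> d i) \<otimes>\<^bsub>H\<^esub> (s i \<otimes>\<^bsub>H\<^esub> d i) = (s i \<otimes>\<^bsub>H\<^esub> d i \<otimes>\<^bsub>H\<^esub> s i) \<otimes>\<^bsub>H\<^esub> d i"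
    using i by (simp add: H.m_assoc)
  also have "\<dots> = \<ominus>\<^bsub>H\<^esub> (s i \<otimes>\<^bsub>H\<^esub> d i)"
    using i unfolding sds[OF i]
    by (simp add: H.minus_eq H.l_distr H.l_minus H.a_assoc)
      (simp add: H.a_comm[of _ "\<ominus>\<^bsub>H\<^esub> d i"] H.a_assoc[symmetric] H.r_neg)
  finally show "antipode_gen I m (GenD i) \<otimes>\<^bsub>opposite H\<^esub> antipode_gen I m (GenD i) = antipode_gen I m (GenD i)"
    using i by (simp add: H.l_minus H.r_minus)
  have "\<ominus>\<^bsub>H\<^esub> (s i \<otimes>\<^bsub>H\<^esub> d i) \<otimes>\<^bsub>H\<^esub> s i \<oplus>\<^bsub>H\<^esub> s i \<otimes>\<^bsub>H\<^esub> (\<ominus>\<^bsub>H\<^esub> (s i \<otimes>\<^bsub>H\<^esub> d i)) =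
      \<ominus>\<^bsub>H\<^esub> (s i \<otimes>\<^bsub>H\<^esub> d i \<otimes>\<^bsub>H\<^esub> s i) \<oplus>\<^bsub>H\<^esub> \<ominus>\<^bsub>H\<^esub> d i"
    using i by (simp add: H.l_minus H.r_minus)
  also have "\<dots> = s i \<ominus>\<^bsub>H\<^esub> \<one>\<^bsub>H\<^esub>"
    unfolding sds[OF i] using i
    by (simp add: H.minus_eq H.minus_add H.a_assoc H.r_neg) (simp add: H.a_comm)
  finally show "antipode_gen I m (GenS i) \<otimes>\<^bsub>opposite H\<^esub> antipode_gen I m (GenD i) \<oplus>\<^bsub>opposite H\<^esub>
      antipode_gen I m (GenD i) \<otimes>\<^bsub>opposite H\<^esub> antipode_gen I m (GenS i) =
      antipode_gen I m (GenS i) \<ominus>\<^bsub>opposite H\<^esub> \<one>\<^bsub>opposite H\<^esub>"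
    by simp
  fix j assume j: "j \<in> I"
  have w: "set (concat (replicate (m i j) [i, j])) \<subseteq> I" using i j by simp
  show "list_prod (opposite H) (map (\<lambda>i. antipode_gen I m (GenS i)) (concat (replicate (m i j) [i, j]))) =
      \<one>\<^bsub>opposite H\<^esub>"
    using sw_rev(1)[OF w] rel(6)[OF i j] sw_closed[of "rev (concat (replicate (m i j) [i, j]))"] w
    unfolding lp[OF w] by simp
  assume ij: "i \<noteq> j" "m i j \<noteq> 0"
  let ?u = "alternating j i (m i j - 1)" and ?l = "if even (m i j) then i else j"
  have u: "set ?u \<subseteq> I" "set (rev ?u) \<subseteq> I" and l: "?l \<in> I" using i j by auto
  let ?v = "sw (rev ?u)"
  \<comment> \<open>In the opposite ring the word is reversed, so its value in \<open>H\<close> is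
    the inverse of \<open>sw ?u\<close>. Multiplying a relation by this inverse on both sides gives
    the form needed.\<close>
  have swap: "?v \<otimes>\<^bsub>H\<^esub> x = y \<otimes>\<^bsub>H\<^esub> ?v"
    if "x \<otimes>\<^bsub>H\<^esub> sw ?u = sw ?u \<otimes>\<^bsub>H\<^esub> y" "x \<in> carrier H" "y \<in> carrier H" for x y
  proof -
    have "?v \<otimes>\<^bsub>H\<^esub> x = ?v \<otimes>\<^bsub>H\<^esub> (x \<otimes>\<^bsub>H\<^esub> sw ?u) \<otimes>\<^bsub>H\<^esub> ?v"
      using that(2) u by (simp add: H.m_assoc sw_rev)
    also have "\<dots> = (?v \<otimes>\<^bsub>H\<^esub> sw ?u) \<otimes>\<^bsub>H\<^esub> y \<otimes>\<^bsub>H\<^esub> ?v"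
      unfolding that(1) using that(3) u by (simp add: H.m_assoc)
    finally show ?thesis using that(3) u by (simp add: sw_rev)
  qed
  have "?v \<otimes>\<^bsub>H\<^esub> (s i \<otimes>\<^bsub>H\<^esub> d i) = s ?l \<otimes>\<^bsub>H\<^esub> (?v \<otimes>\<^bsub>H\<^esub> d i)"
    using swap[OF braid_conj[OF i j ij(2)]] i l u by (simp add: H.m_assoc[symmetric])
  also have "\<dots> = s ?l \<otimes>\<^bsub>H\<^esub> d ?l \<otimes>\<^bsub>H\<^esub> ?v"
    using swap[OF rel(7)[OF i j ij]] i l u by (simp add: H.m_assoc)
  finally show "antipode_gen I m (GenD i) \<otimes>\<^bsub>opposite H\<^esub>
      list_prod (opposite H) (map (\<lambda>i. antipode_gen I m (GenS i)) ?u) =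
    list_prod (opposite H) (map (\<lambda>i. antipode_gen I m (GenS i)) ?u) \<otimes>\<^bsub>opposite H\<^esub>
      antipode_gen I m (GenD ?l)"
    unfolding lp[OF u(1)] using i l u by (simp add: H.l_minus H.r_minus del: if_split)
qed

text \<open>A product in the opposite ring is the product of the reversed word in \<open>H\<close>,
  so both sides apply the same function to the representatives.\<close>

lemma hat_antipode_eq:
  "x \<in> carrier H \<Longrightarrow> hat_antipode I m x = lift (opposite H) (antipode_gen I m) x"
proof -
  assume "x \<in> carrier H"
  then obtain p where p: "p \<in> carrier F" "x = hat_ideal I m +>\<^bsub>F\<^esub> p"
    unfolding hatH_def by (elim R.quot_elem)
  let ?f = "additive_ext H (\<lambda>u. list_prod H (map (antipode_gen I m) (rev u)))"
  let ?g = "additive_ext (opposite H) (\<lambda>u. list_prod (opposite H) (map (antipode_gen I m) u))"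
  have "?f q = ?g q" if "q \<in> x" for q
  proof -
    have "q \<in> carrier F"
      using that F.a_r_coset_subset_G[OF R.a_subset p(1)] p(2) by blast
    then have "Poly_Mapping.keys q \<subseteq> lists gens" by simp
    moreover have "list_prod H (map (antipode_gen I m) (rev u)) = list_prod (opposite H) (map (antipode_gen I m) u)"
      if "u \<in> lists gens" for u
      using that hat_familyD(1,2)[OF antipode_family]
      by (subst H.list_prod_opposite) (auto simp: rev_map)
    ultimately show ?thesis
      unfolding opposite_additive_ext additive_ext_def
      using family_list_prod[OF H.ring_opposite antipode_family]
      by (intro H.finsum_cong') (simp_all add: subset_iff Pi_iff del: in_lists_conv_set)
  qed
  then have "?f ` x = ?g ` x" by (rule image_cong[OF HOL.refl])
  then show ?thesis by (simp add: hat_antipode_def descend_def)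
qed

abbreviation "\<Delta> \<equiv> hat_comult I m"
abbreviation "\<epsilon> \<equiv> hat_counit :: ('i gen list \<Rightarrow>\<^sub>0 int) set \<Rightarrow> int"
abbreviation "\<sigma> \<equiv> hat_antipode I m"

lemma comult_ring_hom: "\<Delta> \<in> ring_hom H S.A2"
  and comult_of_gen: "a \<in> gens \<Longrightarrow> \<Delta> (gen a) = comult_gen I m a"
  unfolding hat_comult_def
  by (rule lift_ring_hom[OF S.T2.T.ring_axioms hat_comult_family],
      rule lift_gen[OF S.T2.T.ring_axioms hat_comult_family])

lemma counit_ring_hom: "\<epsilon> \<in> ring_hom H \<Z>"
  and counit_of_gen: "a \<in> gens \<Longrightarrow> \<epsilon> (gen a) = counit_gen a"
  unfolding hat_counit_def
  by (rule lift_ring_hom[OF int.ring_axioms counit_family],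
      rule lift_gen[OF int.ring_axioms counit_family])

lemma antipode_ring_hom: "\<sigma> \<in> ring_hom H (opposite H)"
proof -
  have "lift (opposite H) (antipode_gen I m) \<in> ring_hom H (opposite H)"
    by (rule lift_ring_hom[OF H.ring_opposite antipode_family])
  then show ?thesis
    by (auto simp: ring_hom_def Pi_iff hat_antipode_eq)
qed

lemma antipode_of_gen: "a \<in> gens \<Longrightarrow> \<sigma> (gen a) = antipode_gen I m a"
  using lift_gen[OF H.ring_opposite antipode_family, of a] gen_closed[of a]
  by (simp add: hat_antipode_eq del: Un_iff)

lemma comult_hom: "abelian_group_hom H S.A2 \<Delta>"
  by (rule ring_hom_abelian_group_hom[OF H.ring_axioms S.T2.T.ring_axioms comult_ring_hom])

lemma counit_hom: "abelian_group_hom H \<Z> \<epsilon>"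
  by (rule ring_hom_abelian_group_hom[OF H.ring_axioms int.ring_axioms counit_ring_hom])

lemma antipode_hom: "abelian_group_hom H H \<sigma>"
  using ring_hom_closed[OF antipode_ring_hom] ring_hom_add[OF antipode_ring_hom]
  by (intro abelian_group_homI' H.is_abelian_group) simp_all

lemma antipode_mult: "x \<in> carrier H \<Longrightarrow> y \<in> carrier H \<Longrightarrow> \<sigma> (x \<otimes>\<^bsub>H\<^esub> y) = \<sigma> y \<otimes>\<^bsub>H\<^esub> \<sigma> x"
  and antipode_one: "\<sigma> \<one>\<^bsub>H\<^esub> = \<one>\<^bsub>H\<^esub>"
  using ring_hom_mult[OF antipode_ring_hom] ring_hom_one[OF antipode_ring_hom] by auto

sublocale cm: abelian_group_hom H S.A2 \<Delta> by (rule comult_hom)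
sublocale cu: abelian_group_hom H \<Z> \<epsilon> by (rule counit_hom)
sublocale an: abelian_group_hom H H \<sigma> by (rule antipode_hom)

lemma comult_one: "\<Delta> \<one>\<^bsub>H\<^esub> = pure_tensor H H \<one>\<^bsub>H\<^esub> \<one>\<^bsub>H\<^esub>"
  using ring_hom_one[OF comult_ring_hom] by (simp add: S.T2.T_one)

lemma comult_s: "i \<in> I \<Longrightarrow> \<Delta> (s i) = pure_tensor H H (s i) (s i)"
  and comult_d: "i \<in> I \<Longrightarrow> \<Delta> (d i) =
    pure_tensor H H (d i) \<one>\<^bsub>H\<^esub> \<oplus>\<^bsub>S.A2\<^esub> pure_tensor H H (s i) (d i)"
  by (simp_all add: comult_of_gen)

text \<open>Both sides are ring homomorphisms from \<open>H\<close> to the threefold tensor product,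
  so the generators decide.\<close>

lemma hat_coassociative:
  assumes "x \<in> carrier H"
  shows "tensor_lift S.A3 (\<lambda>a b. tensor_lift S.A3
      (\<lambda>a' a''. pure_tensor H S.A2 a' (pure_tensor H H a'' b)) (\<Delta> a)) (\<Delta> x) =
    tensor_lift S.A3 (\<lambda>a b. pure_tensor H S.A2 a (\<Delta> b)) (\<Delta> x)"
    (is "tensor_lift _ ?l _ = tensor_lift _ ?r _")
proof (rule hat_hom_eqI[OF S.T3.T.ring_axioms _ _ _ assms])
  note l = S.biadditive_coassoc_left[OF comult_hom]
  note r = S.biadditive_coassoc_right[OF comult_hom]
  note g = S.biadditive_assoc
  have lm: "?l (a \<otimes>\<^bsub>H\<^esub> a') (b \<otimes>\<^bsub>H\<^esub> b') = ?l a b \<otimes>\<^bsub>S.A3\<^esub> ?l a' b'"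
    if "a \<in> carrier H" "a' \<in> carrier H" "b \<in> carrier H" "b' \<in> carrier H" for a a' b b'
    unfolding ring_hom_mult[OF comult_ring_hom that(1,2)]
    by (rule S.T2.tensor_lift_mult[OF S.T3.T.ring_axioms g g g])
      (use that in auto)
  have "tensor_lift S.A3 ?l \<in> ring_hom S.A2 S.A3"
    by (rule S.T2.tensor_lift_ring_hom[OF l S.T3.T.ring_axioms lm])
      (auto simp: comult_one S.T2.tensor_lift_pure[OF g] S.T3.T_one S.T2.T_one)
  then show "(\<lambda>x. tensor_lift S.A3 ?l (\<Delta> x)) \<in> ring_hom H S.A3"
    using ring_hom_trans[OF comult_ring_hom] by (simp add: comp_def)
  have "tensor_lift S.A3 ?r \<in> ring_hom S.A2 S.A3"
    by (rule S.T2.tensor_lift_ring_hom[OF r S.T3.T.ring_axioms])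
      (auto simp: comult_one S.T3.T_one S.T2.T_one ring_hom_mult[OF comult_ring_hom])
  then show "(\<lambda>x. tensor_lift S.A3 ?r (\<Delta> x)) \<in> ring_hom H S.A3"
    using ring_hom_trans[OF comult_ring_hom] by (simp add: comp_def)
  interpret lh: abelian_group_hom S.A2 S.A3 "tensor_lift S.A3 ?l"
    by (rule S.T2.tensor_lift_hom[OF l])
  interpret rh: abelian_group_hom S.A2 S.A3 "tensor_lift S.A3 ?r"
    by (rule S.T2.tensor_lift_hom[OF r])
  fix a assume "a \<in> gens"
  then consider i where "i \<in> I" "a = GenS i" | i where "i \<in> I" "a = GenD i" by auto
  then show "tensor_lift S.A3 ?l (\<Delta> (gen a)) = tensor_lift S.A3 ?r (\<Delta> (gen a))"
  proof cases
    case 1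
    then show ?thesis
      by (simp add: comult_s S.T2.tensor_lift_pure[OF l] S.T2.tensor_lift_pure[OF r]
          S.T2.tensor_lift_pure[OF g])
  next
    case 2
    have gh: "tensor_lift S.A3 (\<lambda>a' a''. pure_tensor H S.A2 a' (pure_tensor H H a'' \<one>\<^bsub>H\<^esub>)) (t \<oplus>\<^bsub>S.A2\<^esub> u) =
      tensor_lift S.A3 (\<lambda>a' a''. pure_tensor H S.A2 a' (pure_tensor H H a'' \<one>\<^bsub>H\<^esub>)) t \<oplus>\<^bsub>S.A3\<^esub>
      tensor_lift S.A3 (\<lambda>a' a''. pure_tensor H S.A2 a' (pure_tensor H H a'' \<one>\<^bsub>H\<^esub>)) u"
      if "t \<in> carrier S.A2" "u \<in> carrier S.A2" for t u
      using abelian_group_hom.hom_add[OF S.T2.tensor_lift_hom[OF g[OF H.one_closed]] that] .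
    from 2 show ?thesis
      by (simp add: comult_d comult_s comult_one S.T2.tensor_lift_pure[OF l] S.T2.tensor_lift_pure[OF r]
          S.T2.tensor_lift_pure[OF g] gh S.T3.pure_add_right S.T3.T.a_assoc)
  qed
qed

lemma hat_counit_left_right:
  assumes "x \<in> carrier H"
  shows "tensor_lift H (\<lambda>a b. add_pow H (\<epsilon> a) b) (\<Delta> x) = x"
    "tensor_lift H (\<lambda>a b. add_pow H (\<epsilon> b) a) (\<Delta> x) = x"
proof -
  note l = S.biadditive_counit(1)[OF counit_hom] and r = S.biadditive_counit(2)[OF counit_hom]
  have p: "add_pow H (k * n :: int) (x \<otimes>\<^bsub>H\<^esub> y) = add_pow H k x \<otimes>\<^bsub>H\<^esub> add_pow H n y"
    if "x \<in> carrier H" "y \<in> carrier H" for k n x y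
    using that by (simp add: H.add_pow_ldistr_int H.add_pow_rdistr_int H.int_add_pow_pow mult.commute)
  have id: "(\<lambda>x. x) \<in> ring_hom H H" by (rule ring_hom_memI) auto
  interpret lh: abelian_group_hom S.A2 H "tensor_lift H (\<lambda>a b. add_pow H (\<epsilon> a) b)"
    by (rule S.T2.tensor_lift_hom[OF l])
  interpret rh: abelian_group_hom S.A2 H "tensor_lift H (\<lambda>a b. add_pow H (\<epsilon> b) a)"
    by (rule S.T2.tensor_lift_hom[OF r])
  have e1: "\<epsilon> \<one>\<^bsub>H\<^esub> = 1" using ring_hom_one[OF counit_ring_hom] by simp
  have em: "\<epsilon> (x \<otimes>\<^bsub>H\<^esub> y) = \<epsilon> x * \<epsilon> y" if "x \<in> carrier H" "y \<in> carrier H" for x y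
    using ring_hom_mult[OF counit_ring_hom that] by simp
  have L: "tensor_lift H (\<lambda>a b. add_pow H (\<epsilon> a) b) \<in> ring_hom S.A2 H"
    by (rule S.T2.tensor_lift_ring_hom[OF l H.ring_axioms]) (simp_all add: p e1 em)
  show "tensor_lift H (\<lambda>a b. add_pow H (\<epsilon> a) b) (\<Delta> x) = x"
  proof (rule hat_hom_eqI[OF H.ring_axioms _ id _ assms])
    show "(\<lambda>x. tensor_lift H (\<lambda>a b. add_pow H (\<epsilon> a) b) (\<Delta> x)) \<in> ring_hom H H"
      using ring_hom_trans[OF comult_ring_hom L] by (simp add: comp_def)
  qed (auto simp: comult_s comult_d S.T2.tensor_lift_pure[OF l] counit_of_gen e1)
  have R: "tensor_lift H (\<lambda>a b. add_pow H (\<epsilon> b) a) \<in> ring_hom S.A2 H"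
    by (rule S.T2.tensor_lift_ring_hom[OF r H.ring_axioms]) (simp_all add: p e1 em)
  show "tensor_lift H (\<lambda>a b. add_pow H (\<epsilon> b) a) (\<Delta> x) = x"
  proof (rule hat_hom_eqI[OF H.ring_axioms _ id _ assms])
    show "(\<lambda>x. tensor_lift H (\<lambda>a b. add_pow H (\<epsilon> b) a) (\<Delta> x)) \<in> ring_hom H H"
      using ring_hom_trans[OF comult_ring_hom R] by (simp add: comp_def)
  qed (auto simp: comult_s comult_d S.T2.tensor_lift_pure[OF r] counit_of_gen e1)
qed

text \<open>Convolution with the antipode is not multiplicative, since \<sigma> reverses products.
  What survives is that a tensor whose convolution is a scalar can be pulled out of a product. This
  is enough, because the claimed values are scalars.\<close>

lemma hat_antipode_left_right:
  assumes "x \<in> carrier H"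
  shows "tensor_lift H (\<lambda>a b. \<sigma> a \<otimes>\<^bsub>H\<^esub> b) (\<Delta> x) = add_pow H (\<epsilon> x) \<one>\<^bsub>H\<^esub>"
    "tensor_lift H (\<lambda>a b. a \<otimes>\<^bsub>H\<^esub> \<sigma> b) (\<Delta> x) = add_pow H (\<epsilon> x) \<one>\<^bsub>H\<^esub>"
proof -
  let ?l = "tensor_lift H (\<lambda>a b. \<sigma> a \<otimes>\<^bsub>H\<^esub> b)" and ?r = "tensor_lift H (\<lambda>a b. a \<otimes>\<^bsub>H\<^esub> \<sigma> b)"
  note l = S.biadditive_antipode(1)[OF antipode_hom] and r = S.biadditive_antipode(2)[OF antipode_hom]
  interpret lh: abelian_group_hom S.A2 H ?l by (rule S.T2.tensor_lift_hom[OF l])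
  interpret rh: abelian_group_hom S.A2 H ?r by (rule S.T2.tensor_lift_hom[OF r])
  have e1: "\<epsilon> \<one>\<^bsub>H\<^esub> = 1" using ring_hom_one[OF counit_ring_hom] by simp
  have em: "\<epsilon> (x \<otimes>\<^bsub>H\<^esub> y) = \<epsilon> x * \<epsilon> y" if "x \<in> carrier H" "y \<in> carrier H" for x y
    using ring_hom_mult[OF counit_ring_hom that] by simp
  have ed: "add_pow H (\<epsilon> (x \<ominus>\<^bsub>H\<^esub> y)) \<one>\<^bsub>H\<^esub> = add_pow H (\<epsilon> x) \<one>\<^bsub>H\<^esub> \<ominus>\<^bsub>H\<^esub> add_pow H (\<epsilon> y) \<one>\<^bsub>H\<^esub>"
    if "x \<in> carrier H" "y \<in> carrier H" for x y
    using cu.hom_minus[OF that] H.int_add_pow_add[OF H.one_closed, of "\<epsilon> x" "- \<epsilon> y"]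
      H.int_add_pow_minus[OF H.one_closed, of "\<epsilon> y"]
    by (simp add: int_a_minus_eq H.minus_eq)
  have pw: "add_pow H (k * n :: int) \<one>\<^bsub>H\<^esub> = add_pow H k (add_pow H n \<one>\<^bsub>H\<^esub>)" for k n
    by (simp add: H.int_add_pow_pow)
  have sc: "add_pow H (k::int) \<one>\<^bsub>H\<^esub> \<otimes>\<^bsub>H\<^esub> y = add_pow H k y" "y \<otimes>\<^bsub>H\<^esub> add_pow H (k::int) \<one>\<^bsub>H\<^esub> = add_pow H k y"
    if "y \<in> carrier H" for k y
    using that by (simp_all add: H.add_pow_ldistr_int H.add_pow_rdistr_int)
  \<comment> \<open>From \<sigma> (x a) (y b) = \<sigma> a (\<sigma> x y) b: the second tensor wraps
    around the value at the first, so a scalar in the middle can be taken out.\<close>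
  have lp: "?l (t \<otimes>\<^bsub>S.A2\<^esub> pure_tensor H H a b) = \<sigma> a \<otimes>\<^bsub>H\<^esub> ?l t \<otimes>\<^bsub>H\<^esub> b"
    if "t \<in> carrier S.A2" and ab: "a \<in> carrier H" "b \<in> carrier H" for t a b
    using that(1)
    by (induction t rule: S.T2.tensor_induct)
      (use ab in \<open>simp_all add: S.T2.tensor_lift_pure[OF l] antipode_mult H.m_assoc S.T2.T_distr H.r_distr H.l_distr\<close>)
  have lm: "?l (t \<otimes>\<^bsub>S.A2\<^esub> u) = add_pow H k (?l u)"
    if t: "t \<in> carrier S.A2" "?l t = add_pow H k \<one>\<^bsub>H\<^esub>" and "u \<in> carrier S.A2" for t u and k :: int
    using that(3)
    by (induction u rule: S.T2.tensor_induct)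
      (use t in \<open>simp_all add: lp sc S.T2.tensor_lift_pure[OF l] S.T2.T_distr H.int_add_pow_distrib H.add_pow_ldistr_int\<close>)
  have rp: "?r (pure_tensor H H a b \<otimes>\<^bsub>S.A2\<^esub> u) = a \<otimes>\<^bsub>H\<^esub> ?r u \<otimes>\<^bsub>H\<^esub> \<sigma> b"
    if "u \<in> carrier S.A2" and ab: "a \<in> carrier H" "b \<in> carrier H" for u a b
    using that(1)
    by (induction u rule: S.T2.tensor_induct)
      (use ab in \<open>simp_all add: S.T2.tensor_lift_pure[OF r] antipode_mult H.m_assoc S.T2.T_distr H.r_distr H.l_distr\<close>)
  have rm: "?r (t \<otimes>\<^bsub>S.A2\<^esub> u) = add_pow H k (?r t)"
    if u: "u \<in> carrier S.A2" "?r u = add_pow H k \<one>\<^bsub>H\<^esub>" and "t \<in> carrier S.A2" for t u and k :: int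
    using that(3)
    by (induction t rule: S.T2.tensor_induct)
      (use u in \<open>simp_all add: rp sc S.T2.tensor_lift_pure[OF r] S.T2.T_distr H.int_add_pow_distrib H.add_pow_ldistr_int\<close>)
  have g: "?l (\<Delta> (gen a)) = add_pow H (\<epsilon> (gen a)) \<one>\<^bsub>H\<^esub> \<and> ?r (\<Delta> (gen a)) = add_pow H (\<epsilon> (gen a)) \<one>\<^bsub>H\<^esub>"
    if "a \<in> gens" for a
    using that
    by (auto simp: comult_s comult_d counit_of_gen antipode_of_gen antipode_one H.l_neg H.r_neg H.r_minus
        S.T2.tensor_lift_pure[OF l] S.T2.tensor_lift_pure[OF r])
  have "?l (\<Delta> x) = add_pow H (\<epsilon> x) \<one>\<^bsub>H\<^esub> \<and> ?r (\<Delta> x) = add_pow H (\<epsilon> x) \<one>\<^bsub>H\<^esub>"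
    using assms
  proof (induction x rule: hat_induct)
    case one
    then show ?case
      by (simp add: comult_one S.T2.tensor_lift_pure[OF l] S.T2.tensor_lift_pure[OF r] antipode_one e1)
  next
    case (gen x a)
    note a = gen_closed[OF gen(1)]
    have "?l (\<Delta> (gen a) \<otimes>\<^bsub>S.A2\<^esub> \<Delta> x) = add_pow H (\<epsilon> (gen a)) (?l (\<Delta> x))"
      by (rule lm) (use a gen g in auto)
    moreover have "?r (\<Delta> (gen a) \<otimes>\<^bsub>S.A2\<^esub> \<Delta> x) = add_pow H (\<epsilon> x) (?r (\<Delta> (gen a)))"
      by (rule rm) (use a gen g in auto)
    ultimately show ?case
      using a gen g[OF gen(1)] pw[of "\<epsilon> (gen a)" "\<epsilon> x"] pw[of "\<epsilon> x" "\<epsilon> (gen a)"]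
      by (simp add: ring_hom_mult[OF comult_ring_hom] em mult.commute del: Un_iff)
  next
    case (diff x y)
    then show ?case
      by (simp add: cm.hom_minus lh.hom_minus rh.hom_minus ed)
  qed
  then show "?l (\<Delta> x) = add_pow H (\<epsilon> x) \<one>\<^bsub>H\<^esub>" "?r (\<Delta> x) = add_pow H (\<epsilon> x) \<one>\<^bsub>H\<^esub>"
    by auto
qed

lemma hopf_algebra_hat: "hopf_algebra H \<Delta> \<epsilon> \<sigma>"
proof (intro hopf_algebra.intro hopf_algebra_axioms.intro)
  show "\<sigma> \<in> hom (add_monoid H) (add_monoid H)"
    using abelian_group_hom.a_group_hom[OF antipode_hom] by (rule group_hom.homh)
qed (rule H.ring_axioms comult_ring_hom counit_ring_hom hat_coassociative hat_counit_left_right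
    hat_antipode_left_right; assumption?)+

end

section \<open>Coxeter groups\<close>

lemma alternating_add:
  "alternating i j (n + k) = alternating i j n @ (if even n then alternating i j k else alternating j i k)"
  by (induction n arbitrary: i j) (auto simp: alternating_Suc)

lemma rev_alternating: "rev (alternating i j n) = (if even n then alternating j i n else alternating i j n)"
proof (induction n arbitrary: i j)
  case (Suc n)
  have "rev (alternating i j (Suc n)) = rev (alternating j i n) @ [i]"
    by (simp add: alternating_Suc)
  then show ?case
    using Suc[of j i] by (auto simp: alternating_snoc)
qed simp

lemma alternating_append_rev':
  "even (n + k) \<Longrightarrow> alternating i j n @ rev (alternating j i k) = alternating i j (n + k)"
  by (auto simp: alternating_add rev_alternating)

locale coxeter = hat I m for I :: "'i set" and m +
  assumes coxeter_matrix: "coxeter_matrix I m"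
begin

abbreviation "W \<equiv> coxeter_group I m"
abbreviation "val \<equiv> cox_class I m"
abbreviation "r \<equiv> simple_refl I m"

lemma m_sym: "i \<in> I \<Longrightarrow> j \<in> I \<Longrightarrow> m i j = m j i"
  and m_one: "i \<in> I \<Longrightarrow> j \<in> I \<Longrightarrow> m i j = 1 \<longleftrightarrow> i = j"
  using coxeter_matrix by (auto simp: coxeter_matrix_def)

lemma cong_lists: "coxeter_cong I m u v \<Longrightarrow> u \<in> lists I \<and> v \<in> lists I"
proof (induction rule: coxeter_cong.induct)
  case (rel i j u v)
  have "concat (replicate (m i j) [i, j]) \<in> lists I"
    using rel by (simp add: in_lists_conv_set flip: subset_iff)
  then show ?case using rel by simp
qed auto

lemma cong_append_left: "coxeter_cong I m u v \<Longrightarrow> w \<in> lists I \<Longrightarrow> coxeter_cong I m (w @ u) (w @ v)"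
proof (induction rule: coxeter_cong.induct)
  case (rel i j u v)
  then show ?case using coxeter_cong.rel[of i I j "w @ u" v m] by simp
next
  case (refl u)
  then show ?case by (intro coxeter_cong.refl) auto
qed (auto intro: coxeter_cong.sym coxeter_cong.trans)

lemma cong_append_right: "coxeter_cong I m u v \<Longrightarrow> w \<in> lists I \<Longrightarrow> coxeter_cong I m (u @ w) (v @ w)"
proof (induction rule: coxeter_cong.induct)
  case (rel i j u v)
  then show ?case using coxeter_cong.rel[of i I j u "v @ w" m] by simp
next
  case (refl u)
  then show ?case by (intro coxeter_cong.refl) auto
qed (auto intro: coxeter_cong.sym coxeter_cong.trans)

lemma val_eq_iff: "u \<in> lists I \<Longrightarrow> val u = val v \<longleftrightarrow> coxeter_cong I m u v"
  unfolding cox_class_def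
  by (auto intro: coxeter_cong.intros)

lemma W_sel: "carrier W = val ` lists I" "\<one>\<^bsub>W\<^esub> = val []"
  by (simp_all add: coxeter_group_def)

lemma val_closed [simp]: "set u \<subseteq> I \<Longrightarrow> val u \<in> carrier W"
  by (auto simp: W_sel in_lists_conv_set)

lemma W_elem:
  assumes "w \<in> carrier W"
  obtains u where "set u \<subseteq> I" "w = val u"
  using assms by (auto simp: W_sel in_lists_conv_set)

lemma val_append:
  assumes "set u \<subseteq> I" "set v \<subseteq> I"
  shows "val (u @ v) = val u \<otimes>\<^bsub>W\<^esub> val v"
proof -
  have l: "u \<in> lists I" "v \<in> lists I" using assms by auto
  have "val (x @ y) = val (u @ v)" if "x \<in> val u" "y \<in> val v" for x y
  proof -
    have "coxeter_cong I m u x" "coxeter_cong I m v y" using that by (auto simp: cox_class_def)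
    then have "coxeter_cong I m (u @ v) (x @ y)"
      using cong_append_right[of u x v] cong_append_left[of v y x] cong_lists l coxeter_cong.trans by blast
    then show ?thesis using val_eq_iff[of "u @ v" "x @ y"] l by simp
  qed
  then have "(\<Union>x\<in>val u. \<Union>y\<in>val v. val (x @ y)) = (\<Union>x\<in>val u. \<Union>y\<in>val v. val (u @ v))"
    by (intro SUP_cong HOL.refl)
  moreover have "u \<in> val u" "v \<in> val v"
    using l by (auto simp: cox_class_def intro: coxeter_cong.refl)
  then have "(\<Union>x\<in>val u. \<Union>y\<in>val v. val (u @ v)) = val (u @ v)" by blast
  ultimately show ?thesis
    by (simp add: coxeter_group_def)
qed

lemma val_relation: "i \<in> I \<Longrightarrow> j \<in> I \<Longrightarrow> val (alternating i j (2 * m i j)) = \<one>\<^bsub>W\<^esub>"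
proof -
  assume "i \<in> I" "j \<in> I"
  then have "coxeter_cong I m (concat (replicate (m i j) [i, j])) []"
    using coxeter_cong.rel[of i I j "[]" "[]" m] by simp
  then show ?thesis
    using val_eq_iff[of "concat (replicate (m i j) [i, j])" "[]"] cong_lists
    unfolding alternating_double W_sel by blast
qed

lemma val_double: "i \<in> I \<Longrightarrow> val [i, i] = \<one>\<^bsub>W\<^esub>"
  using val_relation[of i i] m_one[of i i] by (simp add: numeral_2_eq_2 alternating_Suc)

lemma monoid_W: "monoid W"
proof (rule monoidI)
  fix x y z assume "x \<in> carrier W" "y \<in> carrier W" "z \<in> carrier W"
  then show "x \<otimes>\<^bsub>W\<^esub> y \<otimes>\<^bsub>W\<^esub> z = x \<otimes>\<^bsub>W\<^esub> (y \<otimes>\<^bsub>W\<^esub> z)" "x \<otimes>\<^bsub>W\<^esub> y \<in> carrier W"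
    by (auto elim!: W_elem simp flip: val_append)
next
  fix x assume "x \<in> carrier W"
  then obtain u where u: "set u \<subseteq> I" "x = val u" by (rule W_elem)
  then show "\<one>\<^bsub>W\<^esub> \<otimes>\<^bsub>W\<^esub> x = x" "x \<otimes>\<^bsub>W\<^esub> \<one>\<^bsub>W\<^esub> = x"
    using val_append[of "[]" u] val_append[of u "[]"] by (simp_all add: W_sel)
qed (simp add: W_sel)

lemma val_rev_append: "set u \<subseteq> I \<Longrightarrow> val (rev u @ u) = \<one>\<^bsub>W\<^esub>"
proof (induction u)
  case (Cons i u)
  interpret monoid W by (rule monoid_W)
  have "val (rev (i # u) @ i # u) = val (rev u) \<otimes>\<^bsub>W\<^esub> val [i, i] \<otimes>\<^bsub>W\<^esub> val u"
    using Cons.prems by (simp flip: val_append)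
  then show ?case using Cons by (simp add: val_double flip: val_append)
qed (simp add: W_sel)

sublocale W: group W
proof (rule groupI)
  interpret monoid W by (rule monoid_W)
  fix x assume "x \<in> carrier W"
  then obtain u where u: "set u \<subseteq> I" "x = val u" by (rule W_elem)
  then show "\<exists>y\<in>carrier W. y \<otimes>\<^bsub>W\<^esub> x = \<one>\<^bsub>W\<^esub>"
    using val_rev_append[OF u(1)] by (intro bexI[of _ "val (rev u)"]) (simp_all add: val_append)
qed (simp_all add: monoid.m_closed[OF monoid_W] monoid.m_assoc[OF monoid_W] monoid.l_one[OF monoid_W]
    monoid.one_closed[OF monoid_W])

lemma inv_val: "set u \<subseteq> I \<Longrightarrow> inv\<^bsub>W\<^esub> val u = val (rev u)"
  using val_rev_append[of u] by (intro W.inv_equality) (simp_all add: val_append)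

lemma r_val: "r i = val [i]"
  by (simp add: simple_refl_def)

lemma r_closed [simp]: "i \<in> I \<Longrightarrow> r i \<in> carrier W"
  by (simp add: r_val)

lemma r_square [simp]: "i \<in> I \<Longrightarrow> r i \<otimes>\<^bsub>W\<^esub> r i = \<one>\<^bsub>W\<^esub>"
  using val_double[of i] val_append[of "[i]" "[i]"] by (simp add: r_val)

lemma inv_r [simp]: "i \<in> I \<Longrightarrow> inv\<^bsub>W\<^esub> r i = r i"
  by (intro W.inv_equality) simp_all

lemma val_Cons: "set (i # u) \<subseteq> I \<Longrightarrow> val (i # u) = r i \<otimes>\<^bsub>W\<^esub> val u"
  using val_append[of "[i]" u] by (simp add: r_val)

lemma val_snoc: "set u \<subseteq> I \<Longrightarrow> i \<in> I \<Longrightarrow> val (u @ [i]) = val u \<otimes>\<^bsub>W\<^esub> r i"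
  using val_append[of u "[i]"] by (simp add: r_val)

lemma r_r_left [simp]: "i \<in> I \<Longrightarrow> x \<in> carrier W \<Longrightarrow> r i \<otimes>\<^bsub>W\<^esub> (r i \<otimes>\<^bsub>W\<^esub> x) = x"
  by (simp flip: W.m_assoc)

text \<open>An even alternating word of length \<open>2 m\<^sub>i\<^sub>j\<close> is trivial, so its two parts are inverse.\<close>

lemma val_alternating_flip:
  assumes "i \<in> I" "j \<in> I" "n \<le> 2 * m i j"
  shows "val (alternating i j n) = val (alternating j i (2 * m i j - n))"
proof -
  let ?k = "2 * m i j - n"
  have "alternating i j n @ rev (alternating j i ?k) = alternating i j (2 * m i j)"
    using alternating_append_rev'[of n ?k i j] assms(3) by simp
  then have "val (alternating i j n) \<otimes>\<^bsub>W\<^esub> inv\<^bsub>W\<^esub> val (alternating j i ?k) = \<one>\<^bsub>W\<^esub>"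
    using assms val_relation[of i j] by (simp add: inv_val val_append[symmetric])
  then show ?thesis
    using assms by (metis W.inv_closed W.inv_equality W.inv_inv set_alternating' val_closed)
qed

lemma val_braid: "i \<in> I \<Longrightarrow> j \<in> I \<Longrightarrow> val (alternating i j (m i j)) = val (alternating j i (m i j))"
  using val_alternating_flip[of i j "m i j"] by simp

subsection \<open>The sign cocycle\<close>

text \<open>\<open>flips u x\<close> is the sign acquired by the pair \<open>(x, +)\<close> under \<open>u\<close>, where the simple reflection
  \<open>s\<^sub>i\<close> acts on \<open>W \<times> {+, -}\<close> by conjugation on \<open>W\<close> and changes the sign exactly at \<open>s\<^sub>i\<close>.\<close>

abbreviation conj where "conj w x \<equiv> w \<otimes>\<^bsub>W\<^esub> x \<otimes>\<^bsub>W\<^esub> inv\<^bsub>W\<^esub> w"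

fun flips :: "'i list \<Rightarrow> 'i list set \<Rightarrow> bool" where
  "flips [] x \<longleftrightarrow> False"
| "flips (i # u) x \<longleftrightarrow> (flips u x \<noteq> (conj (val u) x = r i))"

lemma conj_mult: "w \<in> carrier W \<Longrightarrow> v \<in> carrier W \<Longrightarrow> x \<in> carrier W \<Longrightarrow>
    conj (w \<otimes>\<^bsub>W\<^esub> v) x = conj w (conj v x)"
  by (simp add: W.inv_mult_group W.m_assoc)

lemma conj_eq_iff:
  "w \<in> carrier W \<Longrightarrow> x \<in> carrier W \<Longrightarrow> y \<in> carrier W \<Longrightarrow>
    conj w x = y \<longleftrightarrow> x = inv\<^bsub>W\<^esub> w \<otimes>\<^bsub>W\<^esub> y \<otimes>\<^bsub>W\<^esub> w"
  by (metis W.inv_closed W.inv_solve_left W.inv_solve_right W.m_assoc W.m_closed)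

lemma flips_append:
  "set u \<subseteq> I \<Longrightarrow> set v \<subseteq> I \<Longrightarrow> x \<in> carrier W \<Longrightarrow>
    flips (u @ v) x \<longleftrightarrow> (flips u (conj (val v) x) \<noteq> flips v x)"
  by (induction u) (auto simp: val_append conj_mult)

text \<open>A letter of the word changes the sign of \<open>x\<close> exactly if \<open>x\<close> is
  that letter conjugated back by the letters to its right. For letter number k, counted from the
  right and from 0, this conjugate is the palindrome of length 2 k + 1, so the sign is the parity of
  the number of hits.\<close>

lemma flips_alternating:
  assumes ij: "i \<in> I" "j \<in> I" and x: "x \<in> carrier W"
  shows "flips (rev (alternating j i n)) x \<longleftrightarrow>
    odd (card {k. k < n \<and> x = val (alternating j i (2 * k + 1))})"
proof (induction n)
  case (Suc n)
  let ?l = "if even n then j else i"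
  have s: "set (alternating j i k) \<subseteq> I" "set (alternating i j k) \<subseteq> I" for k using ij by simp_all
  have l: "?l \<in> I" using ij by simp
  have "alternating j i n @ [?l] @ rev (alternating j i n) = alternating j i (n + Suc n)"
    by (subst alternating_add) (simp add: rev_alternating alternating_Suc)
  moreover have "n + Suc n = 2 * n + 1" by simp
  ultimately have "val (alternating j i n @ [?l] @ rev (alternating j i n)) = val (alternating j i (2 * n + 1))"
    by metis
  then have "inv\<^bsub>W\<^esub> val (rev (alternating j i n)) \<otimes>\<^bsub>W\<^esub> r ?l \<otimes>\<^bsub>W\<^esub> val (rev (alternating j i n)) =
      val (alternating j i (2 * n + 1))"
    using s l by (simp add: inv_val r_val W.m_assoc val_append[symmetric] del: if_split)
  then have "conj (val (rev (alternating j i n))) x = r ?l \<longleftrightarrow> x = val (alternating j i (2 * n + 1))"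
    using s l x by (subst conj_eq_iff) (auto simp del: if_split)
  moreover have "rev (alternating j i (Suc n)) = ?l # rev (alternating j i n)"
    by (simp add: alternating_snoc)
  moreover have "{k. k < Suc n \<and> x = val (alternating j i (2 * k + 1))} =
      (if x = val (alternating j i (2 * n + 1)) then insert n else id)
        {k. k < n \<and> x = val (alternating j i (2 * k + 1))}"
    by (auto simp: less_Suc_eq)
  ultimately show ?case using Suc by simp
qed simp

text \<open>The palindromes of length 2 k + 1 repeat in k with period \<open>m i j\<close>, because
  the relator is trivial. Over the 2 \<open>m i j\<close> letters of the relator each hit is thus
  counted twice.\<close>

lemma flips_relation:
  assumes ij: "i \<in> I" "j \<in> I" and x: "x \<in> carrier W"
  shows "\<not> flips (concat (replicate (m i j) [i, j])) x"
proof -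
  let ?n = "m i j"
  let ?t = "\<lambda>k. val (alternating j i (2 * k + 1))"
  have periodic: "?t (?n + k) = ?t k" for k
  proof -
    have "alternating j i (2 * (?n + k) + 1) = alternating j i (2 * ?n) @ alternating j i (2 * k + 1)"
      using alternating_add[of j i "2 * ?n" "2 * k + 1"] by (simp add: algebra_simps)
    then show ?thesis
      using ij val_relation[of j i] by (simp add: val_append m_sym[of j i])
  qed
  have "{k. k < 2 * ?n \<and> x = ?t k} = {k. k < ?n \<and> x = ?t k} \<union> (+) ?n ` {k. k < ?n \<and> x = ?t k}"
  proof (intro equalityI subsetI)
    fix k assume k: "k \<in> {k. k < 2 * ?n \<and> x = ?t k}"
    show "k \<in> {k. k < ?n \<and> x = ?t k} \<union> (+) ?n ` {k. k < ?n \<and> x = ?t k}"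
    proof (cases "k < ?n")
      case False
      then have "k = ?n + (k - ?n)" "k - ?n < ?n" using k by auto
      then show ?thesis using k periodic[of "k - ?n"] by (intro UnI2 image_eqI[of _ _ "k - ?n"]) auto
    qed (use k in auto)
  qed (use periodic in auto)
  moreover have "card ({k. k < ?n \<and> x = ?t k} \<union> (+) ?n ` {k. k < ?n \<and> x = ?t k}) =
      2 * card {k. k < ?n \<and> x = ?t k}"
    by (subst card_Un_disjoint) (auto simp: card_image)
  moreover have "concat (replicate ?n [i, j]) = rev (alternating j i (2 * ?n))"
    unfolding alternating_double[symmetric] by (simp add: rev_alternating)
  ultimately show ?thesis
    using flips_alternating[OF ij x, of "2 * ?n"] by simp
qed

lemma flips_cong: "coxeter_cong I m u v \<Longrightarrow> x \<in> carrier W \<Longrightarrow> flips u x = flips v x"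
proof (induction arbitrary: x rule: coxeter_cong.induct)
  case (rel i j u v)
  let ?c = "concat (replicate (m i j) [i, j])"
  have s: "set u \<subseteq> I" "set v \<subseteq> I" "set ?c \<subseteq> I" using rel by auto
  have c: "val ?c = \<one>\<^bsub>W\<^esub>" using val_relation[OF rel(1,2)] by (simp add: alternating_double)
  have "set (?c @ v) \<subseteq> I" using s by simp
  then show ?case
    using s rel(5) flips_relation[OF rel(1,2), of "conj (val v) x"]
    by (simp add: flips_append val_append c del: set_append set_concat)
qed auto

text \<open>For a reflection \<open>x\<close> this plays the role of the statement that
  \<open>w\<close> turns the positive root of \<open>x\<close> into a negative one. Any word for
  \<open>w\<close> may be used, by \<open>flips_cong\<close>.\<close>

definition nflip :: "'i list set \<Rightarrow> 'i list set \<Rightarrow> bool" where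
  "nflip w x \<longleftrightarrow> (\<exists>u. set u \<subseteq> I \<and> w = val u \<and> flips u x)"

lemma nflip_val: "set u \<subseteq> I \<Longrightarrow> x \<in> carrier W \<Longrightarrow> nflip (val u) x = flips u x"
  unfolding nflip_def using flips_cong val_eq_iff[of u] by (metis in_lists_conv_set subsetD)

text \<open>The cocycle identity: signs multiply, which for truth values is exclusive or, written as
  inequality.\<close>

lemma nflip_mult:
  assumes "g \<in> carrier W" "h \<in> carrier W" "x \<in> carrier W"
  shows "nflip (g \<otimes>\<^bsub>W\<^esub> h) x \<longleftrightarrow> (nflip g (conj h x) \<noteq> nflip h x)"
proof -
  obtain u v where "set u \<subseteq> I" "g = val u" "set v \<subseteq> I" "h = val v"
    using assms(1,2) by (auto elim!: W_elem)
  then show ?thesis using assms by (simp add: nflip_val flips_append flip: val_append)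
qed

lemma nflip_one [simp]: "x \<in> carrier W \<Longrightarrow> \<not> nflip \<one>\<^bsub>W\<^esub> x"
  using nflip_val[of "[]" x] by (simp add: W_sel)

lemma nflip_r: "i \<in> I \<Longrightarrow> x \<in> carrier W \<Longrightarrow> nflip (r i) x \<longleftrightarrow> x = r i"
  using nflip_val[of "[i]" x] W.inv_one by (simp add: r_val flip: W_sel)

subsection \<open>Length\<close>

definition len :: "'i list set \<Rightarrow> nat" where
  "len w = (LEAST n. \<exists>u. set u \<subseteq> I \<and> val u = w \<and> length u = n)"

lemma len_le: "set u \<subseteq> I \<Longrightarrow> len (val u) \<le> length u"
  unfolding len_def by (rule Least_le) blast

lemma reduced_word:
  assumes "w \<in> carrier W"
  obtains u where "set u \<subseteq> I" "val u = w" "length u = len w"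
proof -
  obtain u where "set u \<subseteq> I" "w = val u" using assms by (rule W_elem)
  then have "\<exists>n u. set u \<subseteq> I \<and> val u = w \<and> length u = n" by blast
  from LeastI_ex[OF this] show ?thesis using that unfolding len_def by blast
qed

lemma len_r_left: 
  assumes "i \<in> I" "w \<in> carrier W"
  shows "len (r i \<otimes>\<^bsub>W\<^esub> w) \<le> Suc (len w)"
proof -
  obtain u where "set u \<subseteq> I" "val u = w" "length u = len w" using assms(2) by (rule reduced_word)
  then show ?thesis using len_le[of "i # u"] assms(1) by (simp add: val_Cons)
qed

text \<open>The strong exchange argument: a sign change happens at some letter of a reduced word,
  that letter conjugated back is \<open>x\<close>, and multiplying by \<open>x\<close> deletes
  it.\<close>

lemma nflip_len:
  assumes "w \<in> carrier W" "x \<in> carrier W" "nflip w x"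
  shows "len (w \<otimes>\<^bsub>W\<^esub> x) < len w"
proof -
  obtain u where u: "set u \<subseteq> I" "val u = w" "length u = len w" using assms(1) by (rule reduced_word)
  have "\<exists>a i b. u = a @ i # b \<and> conj (val b) x = r i" if "flips u x" for u
    using that
  proof (induction u)
    case (Cons i u)
    show ?case
    proof (cases "conj (val u) x = r i")
      case True
      then show ?thesis by (intro exI[of _ "[]"] exI[of _ i] exI[of _ u]) simp
    next
      case False
      then obtain a k b where "u = a @ k # b" "conj (val b) x = r k" using Cons by auto
      then show ?thesis by (intro exI[of _ "i # a"] exI[of _ k] exI[of _ b]) simp
    qed
  qed simp
  moreover have "flips u x" using assms(2,3) u nflip_val by blast
  ultimately obtain a i b where u': "u = a @ i # b" "conj (val b) x = r i" by blast
  have s: "set a \<subseteq> I" "i \<in> I" "set b \<subseteq> I" using u u' by auto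
  have "x = inv\<^bsub>W\<^esub> val b \<otimes>\<^bsub>W\<^esub> r i \<otimes>\<^bsub>W\<^esub> val b"
    using u'(2) s assms(2) conj_eq_iff[of "val b" x "r i"] by simp
  moreover have "w = val a \<otimes>\<^bsub>W\<^esub> (r i \<otimes>\<^bsub>W\<^esub> val b)"
    using u u' s by (simp add: val_append val_Cons del: append.append_Cons)
  ultimately have "w \<otimes>\<^bsub>W\<^esub> x = val a \<otimes>\<^bsub>W\<^esub> (r i \<otimes>\<^bsub>W\<^esub> (val b \<otimes>\<^bsub>W\<^esub> (inv\<^bsub>W\<^esub> val b \<otimes>\<^bsub>W\<^esub> (r i \<otimes>\<^bsub>W\<^esub> val b))))"
    using s by (simp add: W.m_assoc)
  also have "\<dots> = val (a @ b)"
    using s by (simp add: val_append W.m_assoc[symmetric])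
  finally have "len (w \<otimes>\<^bsub>W\<^esub> x) \<le> length (a @ b)" using len_le[of "a @ b"] s by simp
  then show ?thesis using u(3) u'(1) by simp
qed

text \<open>Since \<open>r i\<close> flips itself, the cocycle identity shows that \<open>w\<close>
  times \<open>r i\<close> does flip \<open>r i\<close>. Multiplying by \<open>r i\<close> once more
  therefore shortens it, and the result is \<open>w\<close>.\<close>

lemma not_nflip_len:
  assumes "w \<in> carrier W" "i \<in> I" "\<not> nflip w (r i)"
  shows "len w < len (w \<otimes>\<^bsub>W\<^esub> r i)"
proof -
  have "nflip (w \<otimes>\<^bsub>W\<^esub> r i) (r i)"
    using assms by (simp add: nflip_mult nflip_r W.m_assoc)
  then have "len (w \<otimes>\<^bsub>W\<^esub> r i \<otimes>\<^bsub>W\<^esub> r i) < len (w \<otimes>\<^bsub>W\<^esub> r i)"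
    using assms by (intro nflip_len) auto
  then show ?thesis using assms by (simp add: W.m_assoc)
qed

subsection \<open>The order of a product of two simple reflections\<close>

text \<open>The contragredient of the geometric representation, on real functions on \<open>I\<close>.\<close>

definition bil :: "'i \<Rightarrow> 'i \<Rightarrow> real" where
  "bil i k = (if i = k then -2 else if m i k = 0 then 2 else 2 * cos (pi / m i k))"

text \<open>A function stands for a linear functional, listed by its values on the simple roots. As
  \<open>bil\<close> is minus twice the standard bilinear form, the new value at \<open>k\<close> is
  that of the functional on the simple root of \<open>k\<close> reflected by
  \<open>i\<close>.\<close>

definition geo :: "'i \<Rightarrow> ('i \<Rightarrow> real) \<Rightarrow> 'i \<Rightarrow> real" where
  "geo i f = (\<lambda>k. f k + bil i k * f i)"

lemma geo_double: "geo i (geo i f) = f"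
  by (auto simp: geo_def bil_def)

text \<open>Along the orbit of \<open>f\<close> under alternate applications of \<open>s\<^sub>i\<close> and \<open>s\<^sub>j\<close> the successive
  values \<open>x\<^sub>n\<close> satisfy \<open>x\<^sub>n\<^sub>+\<^sub>1 = 2 cos (\<pi> / m\<^sub>i\<^sub>j) x\<^sub>n - x\<^sub>n\<^sub>-\<^sub>1\<close>, which is solved by sines.\<close>

lemma geo_iterate:
  fixes f :: "'i \<Rightarrow> real" and c :: real
  assumes ij: "i \<noteq> j" "i \<in> I" "j \<in> I" and m0: "m i j \<noteq> 0" and c: "c = pi / m i j"
  defines "x \<equiv> \<lambda>n. (f i * sin ((real n + 1) * c) + f j * sin (real n * c)) / sin c"
  shows "((\<lambda>f. geo j (geo i f)) ^^ n) f i = x (2 * n)"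
    "((\<lambda>f. geo j (geo i f)) ^^ n) f j =
      - (f i * sin (2 * real n * c) + f j * sin ((2 * real n - 1) * c)) / sin c"
    "k \<noteq> i \<Longrightarrow> k \<noteq> j \<Longrightarrow> ((\<lambda>f. geo j (geo i f)) ^^ n) f k =
      f k + bil i k * (\<Sum>l<n. x (2 * l)) + bil j k * (\<Sum>l<n. x (2 * l + 1))"
proof -
  have m2: "m i j \<ge> 2" using m_one[OF ij(2,3)] m0 ij(1) by (cases "m i j"; cases "m i j - 1") auto
  have "0 < c" using m2 by (simp add: c)
  moreover have "c < pi" using m2 by (simp add: c divide_less_eq)
  ultimately have s: "sin c \<noteq> 0" using sin_gt_zero[of c] by simp
  have b: "bil i j = 2 * cos c" "bil j i = 2 * cos c" "bil i i = -2" "bil j j = -2"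
    using ij m0 m_sym[of i j] by (auto simp: bil_def c)
  have rec: "sin ((t + 1) * c) = 2 * cos c * sin (t * c) - sin ((t - 1) * c)" for t
    by (simp add: algebra_simps sin_add sin_diff)
  have "((\<lambda>f. geo j (geo i f)) ^^ n) f i = x (2 * n) \<and>
    ((\<lambda>f. geo j (geo i f)) ^^ n) f j =
      - (f i * sin (2 * real n * c) + f j * sin ((2 * real n - 1) * c)) / sin c \<and>
    (k \<noteq> i \<longrightarrow> k \<noteq> j \<longrightarrow> ((\<lambda>f. geo j (geo i f)) ^^ n) f k =
      f k + bil i k * (\<Sum>l<n. x (2 * l)) + bil j k * (\<Sum>l<n. x (2 * l + 1)))"
  proof (induction n)
    case 0
    then show ?case using s by (simp add: x_def)
  next
    case (Suc n)
    let ?F = "((\<lambda>f. geo j (geo i f)) ^^ n) f"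
    let ?a = "f i" and ?b = "f j"
    have Fi: "?F i = x (2 * n)"
      and Fj: "?F j = - (f i * sin (2 * real n * c) + f j * sin ((2 * real n - 1) * c)) / sin c"
      using Suc by blast+
    have i: "geo i ?F i = - x (2 * n)" using Fi by (simp add: geo_def b)
    have j: "geo i ?F j = x (2 * n + 1)"
    proof -
      have "geo i ?F j = ?F j + 2 * cos c * ?F i" by (simp add: geo_def b)
      also have "\<dots> = (?a * (2 * cos c * sin ((2 * real n + 1) * c) - sin (2 * real n * c)) +
          ?b * (2 * cos c * sin (2 * real n * c) - sin ((2 * real n - 1) * c))) / sin c"
        unfolding Fi Fj by (simp add: x_def add_divide_distrib diff_divide_distrib algebra_simps)
      also have "\<dots> = x (2 * n + 1)"
        using rec[of "2 * real n + 1"] rec[of "2 * real n"] by (simp add: x_def add_ac)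
      finally show ?thesis .
    qed
    have "geo j (geo i ?F) j = - x (2 * n + 1)"
      using j by (simp add: geo_def[of j] b)
    moreover have "- x (2 * n + 1) =
       - (?a * sin (2 * real (Suc n) * c) + ?b * sin ((2 * real (Suc n) - 1) * c)) / sin c"
      by (simp add: x_def add_ac minus_divide_left del: divide_minus_left)
    moreover have "geo j (geo i ?F) i = x (2 * Suc n)"
    proof -
      have "geo j (geo i ?F) i = geo i ?F i + 2 * cos c * geo i ?F j"
        by (simp add: geo_def[of j] b)
      also have "\<dots> = (?a * (2 * cos c * sin ((2 * real n + 2) * c) - sin ((2 * real n + 1) * c)) +
          ?b * (2 * cos c * sin ((2 * real n + 1) * c) - sin (2 * real n * c))) / sin c"
        unfolding i j by (simp add: x_def add_divide_distrib diff_divide_distrib algebra_simps)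
      also have "\<dots> = x (2 * Suc n)"
        using rec[of "2 * real n + 2"] rec[of "2 * real n + 1"] by (simp add: x_def add_ac)
      finally show ?thesis .
    qed
    moreover have "geo j (geo i ?F) k = f k + bil i k * (\<Sum>l<Suc n. x (2 * l)) + bil j k * (\<Sum>l<Suc n. x (2 * l + 1))"
      if "k \<noteq> i" "k \<noteq> j"
    proof -
      have "geo j (geo i ?F) k = ?F k + bil i k * ?F i + bil j k * geo i ?F j"
        by (simp add: geo_def)
      also have "\<dots> = f k + bil i k * (\<Sum>l<n. x (2 * l)) + bil j k * (\<Sum>l<n. x (2 * l + 1)) +
          bil i k * x (2 * n) + bil j k * x (2 * n + 1)"
        using Suc that j by simp
      finally show ?thesis by (simp add: algebra_simps)
    qed
    ultimately show ?case by simp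
  qed
  then show "((\<lambda>f. geo j (geo i f)) ^^ n) f i = x (2 * n)"
    "((\<lambda>f. geo j (geo i f)) ^^ n) f j =
      - (f i * sin (2 * real n * c) + f j * sin ((2 * real n - 1) * c)) / sin c"
    "k \<noteq> i \<Longrightarrow> k \<noteq> j \<Longrightarrow> ((\<lambda>f. geo j (geo i f)) ^^ n) f k =
      f k + bil i k * (\<Sum>l<n. x (2 * l)) + bil j k * (\<Sum>l<n. x (2 * l + 1))"
    by blast+
qed

text \<open>With c = pi / m the angle advances by 2 c in each step. After m steps it has advanced by
  2 pi, so the values at \<open>i\<close> and \<open>j\<close> return, and any other value has
  changed only by sums of sines over a full period, which vanish.\<close>

lemma geo_relation:
  assumes "i \<in> I" "j \<in> I"
  shows "((\<lambda>f. geo j (geo i f)) ^^ m i j) f = f"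
proof (cases "i = j \<or> m i j = 0")
  case True
  then show ?thesis using m_one[of i i] assms by (auto simp: geo_double)
next
  case False
  then have ij: "i \<noteq> j" and m0: "m i j \<noteq> 0" by auto
  define c where "c = pi / m i j"
  have m2: "m i j \<ge> 2" using m_one[OF assms] m0 ij by (cases "m i j"; cases "m i j - 1") auto
  have "0 < c" using m2 by (simp add: c_def)
  moreover have "c < pi" using m2 by (simp add: c_def divide_less_eq)
  ultimately have s: "sin c \<noteq> 0" using sin_gt_zero[of c] by simp
  have mc: "2 * real (m i j) * c = 2 * pi" using m0 by (simp add: c_def)
  have sum0: "(\<Sum>l<m i j. sin (2 * real l * c + \<phi>)) = 0" for \<phi>
  proof -
    \<comment> \<open>Multiplying by 2 sin c turns the summands into differences of cosines, so the
      sum telescopes.\<close>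
    have "2 * sin c * (\<Sum>l<n. sin (2 * real l * c + \<phi>)) = cos (\<phi> - c) - cos (2 * real n * c - c + \<phi>)" for n
    proof (induction n)
      case (Suc n)
      have "2 * sin c * sin (2 * real n * c + \<phi>) =
          cos (2 * real n * c - c + \<phi>) - cos (2 * real (Suc n) * c - c + \<phi>)"
        using cos_diff[of "2 * real n * c + \<phi>" c] cos_add[of "2 * real n * c + \<phi>" c]
        by (simp add: algebra_simps)
      then show ?case using Suc by (simp add: distrib_left)
    qed simp
    from this[of "m i j"] have "2 * sin c * (\<Sum>l<m i j. sin (2 * real l * c + \<phi>)) = 0"
      unfolding mc using cos_periodic[of "\<phi> - c"] by (simp add: algebra_simps)
    then show ?thesis using s by simp
  qed
  define x where "x = (\<lambda>n::nat. (f i * sin ((real n + 1) * c) + f j * sin (real n * c)) / sin c)"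
  note it = geo_iterate[OF ij assms m0 c_def, where n = "m i j" and f = f]
  have sums: "(\<Sum>l<m i j. x (2 * l)) = 0" "(\<Sum>l<m i j. x (2 * l + 1)) = 0"
  proof -
    have "(\<Sum>l<m i j. x (2 * l)) =
      (f i * (\<Sum>l<m i j. sin (2 * real l * c + c)) + f j * (\<Sum>l<m i j. sin (2 * real l * c + 0))) / sin c"
      by (simp add: x_def sum_divide_distrib sum.distrib sum_distrib_left algebra_simps add_divide_distrib)
    then show "(\<Sum>l<m i j. x (2 * l)) = 0" unfolding sum0 by simp
    have "(\<Sum>l<m i j. x (2 * l + 1)) =
      (f i * (\<Sum>l<m i j. sin (2 * real l * c + 2 * c)) + f j * (\<Sum>l<m i j. sin (2 * real l * c + c))) / sin c"
      by (simp add: x_def sum_divide_distrib sum.distrib sum_distrib_left algebra_simps add_divide_distrib)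
    then show "(\<Sum>l<m i j. x (2 * l + 1)) = 0" unfolding sum0 by simp
  qed
  have e: "sin ((2 * real (m i j) + 1) * c) = sin c" "sin (2 * real (m i j) * c) = 0"
    "sin ((2 * real (m i j) - 1) * c) = - sin c"
  proof -
    have "(2 * real (m i j) + 1) * c = c + 2 * pi" "(2 * real (m i j) - 1) * c = - c + 2 * pi"
      unfolding distrib_right left_diff_distrib mc by simp_all
    then show "sin ((2 * real (m i j) + 1) * c) = sin c" "sin ((2 * real (m i j) - 1) * c) = - sin c"
      by (simp_all only: sin_periodic sin_minus)
    show "sin (2 * real (m i j) * c) = 0" unfolding mc by simp
  qed
  show ?thesis
  proof
    fix k
    consider "k = i" | "k = j" | "k \<noteq> i" "k \<noteq> j" by blast
    then show "((\<lambda>f. geo j (geo i f)) ^^ m i j) f k = f k"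
    proof cases
      case 1
      then show ?thesis using it(1) e s by (simp add: x_def)
    next
      case 2
      then show ?thesis using it(2) e s by simp
    next
      case 3
      then show ?thesis using it(3) sums by (simp add: x_def)
    qed
  qed
qed

lemma foldr_geo_pair: "foldr geo (concat (replicate n [i, j])) = (\<lambda>f. geo i (geo j f)) ^^ n"
  by (induction n) (simp_all add: comp_def id_def)

lemma geo_cong: "coxeter_cong I m u v \<Longrightarrow> foldr geo u = foldr geo v"
proof (induction rule: coxeter_cong.induct)
  case (rel i j u v)
  then have "((\<lambda>f. geo i (geo j f)) ^^ m i j) = id"
    using geo_relation[of j i] m_sym[of i j] by auto
  then show ?case by (simp add: foldr_geo_pair)
qed auto

text \<open>The representation detects the order. For m = 0 the orbit of a test function grows
  linearly. Otherwise a return after e steps would make sin (e c) zero, although e c lies strictly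
  between 0 and pi.\<close>

lemma order_alternating:
  assumes ij: "i \<in> I" "j \<in> I" "i \<noteq> j" and e: "0 < e" and "m i j = 0 \<or> e < m i j"
  shows "val (alternating i j (2 * e)) \<noteq> \<one>\<^bsub>W\<^esub>"
proof
  assume "val (alternating i j (2 * e)) = \<one>\<^bsub>W\<^esub>"
  then have "coxeter_cong I m (concat (replicate e [i, j])) []"
    using val_eq_iff[of "alternating i j (2 * e)" "[]"] ij
    by (auto simp: W_sel in_lists_conv_set alternating_double)
  from geo_cong[OF this] have id: "((\<lambda>f. geo i (geo j f)) ^^ e) f = f" for f
    by (simp add: foldr_geo_pair)
  \<comment> \<open>The functional dual to the simple root of \<open>j\<close>; along its orbit the
    values at \<open>i\<close> and \<open>j\<close> are explicit.\<close>
  define f where "f = (\<lambda>k. if k = j then 1 else 0 :: real)"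
  show False
  proof (cases "m i j = 0")
    case True
    then have b: "bil i j = 2" "bil j i = 2" "bil i i = -2" "bil j j = -2"
      using ij m_sym[of i j] by (auto simp: bil_def)
    have "((\<lambda>f. geo i (geo j f)) ^^ n) f j = 2 * real n + 1 \<and>
      ((\<lambda>f. geo i (geo j f)) ^^ n) f i = - 2 * real n" for n
      by (induction n) (use ij in \<open>auto simp: geo_def b f_def\<close>)
    from this[of e] show False using id[of f] e by (simp add: f_def)
  next
    case False
    then have m0: "m j i \<noteq> 0" "e < m j i" using assms m_sym[of i j] by auto
    define c where "c = pi / m j i"
    have "m j i \<ge> 2" using m0 e by simp
    then have "0 < c" "c < pi" by (simp_all add: c_def divide_less_eq)
    then have s: "sin c > 0" using sin_gt_zero by simp
    note it = geo_iterate[OF ij(3)[symmetric] ij(2,1) m0(1) c_def, where n = e and f = f]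
    have "sin ((2 * real e + 1) * c) / sin c = 1"
      using it(1) id[of f] ij by (simp add: f_def)
    then have s1: "sin (2 * real e * c + c) = sin c" using s by (simp add: distrib_right)
    have "sin (2 * real e * c) / sin c = 0"
      using it(2) id[of f] ij by (simp add: f_def)
    then have s0: "sin (2 * real e * c) = 0" using s by simp
    have "cos (2 * real e * c) * sin c = sin c"
      using s1 s0 by (simp add: sin_add)
    then have "cos (2 * real e * c) = 1" using s by simp
    then have "sin (real e * c) = 0"
      using cos_double_sin[of "real e * c"] by (simp add: mult.assoc)
    moreover have "0 < real e * c" using e \<open>0 < c\<close> by simp
    moreover have "real e * c < pi"
      using m0 e by (simp add: c_def divide_less_eq)
    ultimately show False using sin_gt_zero[of "real e * c"] by simp
  qed
qed

lemma r_inj: 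
  assumes "i \<in> I" "j \<in> I" "r i = r j"
  shows "i = j"
proof (rule ccontr)
  assume "i \<noteq> j"
  then have "m i j = 0 \<or> 1 < m i j" using m_one[OF assms(1,2)] by (cases "m i j"; cases "m i j - 1") auto
  then have "val (alternating i j (2 * 1)) \<noteq> \<one>\<^bsub>W\<^esub>"
    using assms \<open>i \<noteq> j\<close> by (intro order_alternating) auto
  then show False using assms by (simp add: numeral_2_eq_2 alternating_Suc val_Cons flip: r_val)
qed

end

context coxeter
begin

subsection \<open>Rank two parabolic subgroups and the induction on roots\<close>

text \<open>A letter put in front of an alternating word either prolongs it or cancels its first
  letter.\<close>

lemma alternating_Cons_cases:
  assumes "set u \<subseteq> {i, k}" "i \<in> I" "k \<in> I"
  obtains a b n where "{a, b} = {i, k}" "val u = val (alternating a b n)"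
  using assms(1)
proof (induction u arbitrary: thesis)
  case Nil
  then show ?case using Nil(1)[of i k 0] by simp
next
  case (Cons c u)
  obtain a b n where ab: "{a, b} = {i, k}" "val u = val (alternating a b n)"
    using Cons by (metis insert_subset list.simps(15))
  have I: "a \<in> I" "b \<in> I" "c \<in> I" "set u \<subseteq> I" using ab assms Cons.prems(2) by auto
  have vc: "val (c # u) = r c \<otimes>\<^bsub>W\<^esub> val (alternating a b n)"
    using I ab by (simp add: val_Cons)
  have "c = a \<or> c = b" using Cons.prems(2) ab(1) by auto
  then show ?case
  proof
    assume "c = b"
    then have "val (c # u) = val (alternating b a (Suc n))"
      using vc I by (simp add: alternating_Suc val_Cons)
    then show ?thesis using Cons.prems(1)[of b a] ab(1) by (simp add: insert_commute)
  next
    assume ca: "c = a"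
    show ?thesis
    proof (cases n)
      case 0
      then have "val (c # u) = val (alternating a b (Suc 0))"
        using vc I ca by (simp add: alternating_Suc val_Cons)
      then show ?thesis using Cons.prems(1)[of a b] ab(1) by simp
    next
      case (Suc l)
      then have "val (c # u) = val (alternating b a l)"
        using vc I ca by (simp add: alternating_Suc val_Cons)
      then show ?thesis using Cons.prems(1)[of b a] ab(1) by (simp add: insert_commute)
    qed
  qed
qed

text \<open>Take an alternating word of least length n with the given value. If n exceeded m, then
  either the complementary word of length 2 m - n or the removal of a trivial prefix of length 2 m
  would give a shorter one.\<close>

lemma short_alternating:
  assumes "set u \<subseteq> {i, k}" "i \<in> I" "k \<in> I"
  obtains a b n where "{a, b} = {i, k}" "val u = val (alternating a b n)" "m i k \<noteq> 0 \<Longrightarrow> n \<le> m i k"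
proof -
  let ?P = "\<lambda>n. \<exists>a b. {a, b} = {i, k} \<and> val u = val (alternating a b n)"
  have ex: "\<exists>n. ?P n" using alternating_Cons_cases[OF assms] by metis
  define n where "n = (LEAST n. ?P n)"
  obtain a b where ab: "{a, b} = {i, k}" "val u = val (alternating a b n)"
    using LeastI_ex[OF ex] unfolding n_def by blast
  have least: "n \<le> n'" if "?P n'" for n'
    using Least_le[of ?P, OF that] by (simp add: n_def)
  have I: "a \<in> I" "b \<in> I" using ab assms by auto
  have m: "m a b = m i k" using ab(1) m_sym[OF I] by (auto simp: doubleton_eq_iff)
  have "n \<le> m i k" if "m i k \<noteq> 0"
  proof (rule ccontr)
    assume "\<not> n \<le> m i k"
    then consider "m i k < n" "n \<le> 2 * m i k" | "2 * m i k < n" by linarith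
    then show False
    proof cases
      case 1
      then have "val u = val (alternating b a (2 * m i k - n))"
        using val_alternating_flip[OF I, of n] ab(2) m by simp
      then have "n \<le> 2 * m i k - n" using ab(1) by (intro least) (metis insert_commute)
      then show False using 1 by simp
    next
      case 2
      then have "alternating a b n = alternating a b (2 * m i k) @ alternating a b (n - 2 * m i k)"
        using alternating_add[of a b "2 * m i k" "n - 2 * m i k"] by simp
      then have "val u = val (alternating a b (n - 2 * m i k))"
        using ab(2) I val_relation[OF I] m by (simp add: val_append)
      then have "n \<le> n - 2 * m i k" using ab(1) by (intro least) blast
      then show False using 2 that by simp
    qed
  qed
  with ab that show ?thesis by blast
qed

lemma val_inverse_eq: "set u \<subseteq> I \<Longrightarrow> set v \<subseteq> I \<Longrightarrow> val u = val v \<Longrightarrow> val (rev u) = val (rev v)"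
  by (simp flip: inv_val)

text \<open>Only the longest element of a finite dihedral group has two descents. In a word of least
  length n that ends in a, flipping the other letter b makes (a b)^(e + 1) trivial for some e < n.
  The order of a product of two simple reflections then forces m to be nonzero and m <= e + 1 <= n,
  while n <= m by minimality.\<close>

lemma dihedral_two_descents:
  assumes "set u \<subseteq> {i, k}" "i \<in> I" "k \<in> I" "i \<noteq> k" "nflip (val u) (r i)" "nflip (val u) (r k)"
  shows "m i k \<noteq> 0" "val u = val (rev (alternating i k (m i k)))"
proof -
  obtain a b n where ab: "{a, b} = {i, k}" "val (rev u) = val (alternating a b n)"
    and n: "m i k \<noteq> 0 \<Longrightarrow> n \<le> m i k"
    using short_alternating[of "rev u" i k] assms by auto
  have I: "a \<in> I" "b \<in> I" "set u \<subseteq> I" using ab assms by auto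
  have m: "m a b = m i k" using ab(1) m_sym[OF I(1,2)] by (auto simp: doubleton_eq_iff)
  have v: "val u = val (rev (alternating a b n))"
    using val_inverse_eq[of "rev u" "alternating a b n"] ab(2) I by simp
  have "nflip (val u) (r b)" using assms ab(1) by (auto simp: doubleton_eq_iff)
  then have "flips (rev (alternating a b n)) (r b)"
    unfolding v using I by (subst (asm) nflip_val) auto
  then have "odd (card {e. e < n \<and> r b = val (alternating a b (2 * e + 1))})"
    using flips_alternating[of b a "r b" n] I by simp
  then have "{e. e < n \<and> r b = val (alternating a b (2 * e + 1))} \<noteq> {}"
    by (metis card.empty dvd_0_right)
  then obtain e where e: "e < n" "r b = val (alternating a b (2 * e + 1))" by blast
  have "alternating a b (2 * Suc e) = alternating a b (2 * e + 1) @ [b]"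
    using alternating_snoc[of a b "2 * e + 1"] by simp
  then have "val (alternating a b (2 * Suc e)) = \<one>\<^bsub>W\<^esub>"
    using I e(2)[symmetric] by (simp add: val_snoc)
  moreover have "a \<noteq> b" using ab(1) assms(4) by (auto simp: doubleton_eq_iff)
  ultimately have "\<not> (m a b = 0 \<or> Suc e < m a b)"
    using order_alternating[of a b "Suc e"] I by blast
  then show m0: "m i k \<noteq> 0" using m by simp
  have "n = m i k" using n[OF m0] e(1) \<open>\<not> (m a b = 0 \<or> Suc e < m a b)\<close> m by simp
  moreover have "val (rev (alternating a b (m i k))) = val (rev (alternating i k (m i k)))"
  proof (cases "a = i")
    case False
    then have "a = k" "b = i" using ab(1) by (auto simp: doubleton_eq_iff)
    then show ?thesis using val_braid[OF assms(2,3)] assms by (intro val_inverse_eq) auto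
  qed (use ab(1) in \<open>auto simp: doubleton_eq_iff\<close>)
  ultimately show "val u = val (rev (alternating i k (m i k)))" using v by simp
qed

text \<open>For \<open>g\<close> an element of least length in the coset of \<open>w\<close> is
  taken. If it flipped an element of the parabolic subgroup, multiplication by that element would
  shorten it within the coset.\<close>

lemma min_coset:
  assumes "w \<in> carrier W" "J \<subseteq> I"
  obtains g u where "g \<in> carrier W" "set u \<subseteq> J" "w = g \<otimes>\<^bsub>W\<^esub> val u"
    "\<And>v. set v \<subseteq> J \<Longrightarrow> \<not> nflip g (val v)" "\<And>v. set v \<subseteq> J \<Longrightarrow> len g \<le> len (w \<otimes>\<^bsub>W\<^esub> val v)"
proof -
  let ?P = "\<lambda>n. \<exists>v. set v \<subseteq> J \<and> len (w \<otimes>\<^bsub>W\<^esub> val v) = n"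
  define n where "n = (LEAST n. ?P n)"
  have ex: "\<exists>n. ?P n" by (intro exI[of _ "len (w \<otimes>\<^bsub>W\<^esub> val [])"] exI[of _ "[]"]) simp
  obtain v where v: "set v \<subseteq> J" "len (w \<otimes>\<^bsub>W\<^esub> val v) = n"
    using LeastI_ex[OF ex] unfolding n_def by blast
  let ?g = "w \<otimes>\<^bsub>W\<^esub> val v"
  have least: "len ?g \<le> len (w \<otimes>\<^bsub>W\<^esub> val v')" if "set v' \<subseteq> J" for v'
    unfolding v(2) n_def by (rule Least_le) (use that in blast)
  have vI: "set v' \<subseteq> I" if "set v' \<subseteq> J" for v' using that assms(2) by blast
  show ?thesis
  proof (rule that[of ?g "rev v"])
    show "?g \<in> carrier W" using assms(1) vI[OF v(1)] by simp
    show "set (rev v) \<subseteq> J" using v by simp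
    show "w = ?g \<otimes>\<^bsub>W\<^esub> val (rev v)"
      using assms(1) vI[OF v(1)] by (simp add: W.m_assoc flip: inv_val)
    fix v' assume v': "set v' \<subseteq> J"
    show "len ?g \<le> len (w \<otimes>\<^bsub>W\<^esub> val v')" by (rule least[OF v'])
    show "\<not> nflip ?g (val v')"
    proof
      assume "nflip ?g (val v')"
      then have "len (?g \<otimes>\<^bsub>W\<^esub> val v') < len ?g"
        using assms(1) vI[OF v(1)] vI[OF v'] by (intro nflip_len) auto
      moreover have "?g \<otimes>\<^bsub>W\<^esub> val v' = w \<otimes>\<^bsub>W\<^esub> val (v @ v')"
        using assms(1) vI[OF v(1)] vI[OF v'] by (simp add: W.m_assoc val_append)
      ultimately show False using least[of "v @ v'"] v(1) v' by simp
    qed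
  qed
qed

lemma right_descent:
  assumes "w \<in> carrier W" "w \<noteq> \<one>\<^bsub>W\<^esub>"
  obtains k where "k \<in> I" "nflip w (r k)" "len (w \<otimes>\<^bsub>W\<^esub> r k) < len w"
proof -
  obtain u where u: "set u \<subseteq> I" "val u = w" "length u = len w" using assms(1) by (rule reduced_word)
  have "u \<noteq> []" using u assms(2) by (auto simp: W_sel)
  then obtain v k where vk: "u = v @ [k]" by (metis rev_exhaust)
  have I: "set v \<subseteq> I" "k \<in> I" using u vk by auto
  have "w \<otimes>\<^bsub>W\<^esub> r k = val v"
    using u(2) I by (simp add: vk val_snoc W.m_assoc flip: u(2))
  then have "len (w \<otimes>\<^bsub>W\<^esub> r k) < len w" using len_le[OF I(1)] u(3) vk by simp
  moreover have "nflip w (r k)"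
    using not_nflip_len[OF assms(1) I(2)] calculation by force
  ultimately show ?thesis using that I by blast
qed

text \<open>In terms of roots: if \<open>w\<close> maps the simple root of \<open>i\<close> to that of \<open>j\<close>, then \<open>w\<close> is a product of
  elements of rank two parabolic subgroups, each of which maps a simple root to a simple root. These
  are the words occurring in relation (iii).\<close>

lemma simple_root_induct:
  assumes "w \<in> carrier W" "i \<in> I" "j \<in> I" "conj w (r i) = r j" "\<not> nflip w (r i)"
    and one: "P \<one>\<^bsub>W\<^esub> j"
    and step: "\<And>w a b. w \<in> carrier W \<Longrightarrow> a \<in> I \<Longrightarrow> b \<in> I \<Longrightarrow> a \<noteq> b \<Longrightarrow> m a b \<noteq> 0 \<Longrightarrow> P w a \<Longrightarrow>
      P (w \<otimes>\<^bsub>W\<^esub> val (alternating b a (m a b - 1))) (if even (m a b) then a else b)"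
  shows "P w i"
  using assms(1,2,4,5)
proof (induction "len w" arbitrary: w i rule: less_induct)
  case less
  note w = less.prems(1) and i = less.prems(2)
  show ?case
  proof (cases "w = \<one>\<^bsub>W\<^esub>")
    case True
    then have "r i = r j" using less.prems by simp
    then have "i = j" using r_inj[OF i assms(3)] by simp
    then show ?thesis using True one by simp
  next
    case False
    obtain k where k: "k \<in> I" "nflip w (r k)" "len (w \<otimes>\<^bsub>W\<^esub> r k) < len w"
      using right_descent[OF w False] by blast
    then have ik: "i \<noteq> k" using less.prems by auto
    obtain g u where g: "g \<in> carrier W" "set u \<subseteq> {i, k}" "w = g \<otimes>\<^bsub>W\<^esub> val u"
      "\<And>v. set v \<subseteq> {i, k} \<Longrightarrow> \<not> nflip g (val v)" "\<And>v. set v \<subseteq> {i, k} \<Longrightarrow> len g \<le> len (w \<otimes>\<^bsub>W\<^esub> val v)"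
      using min_coset[OF w, of "{i, k}"] i k(1) by auto
    have uI: "set u \<subseteq> I" using g(2) i k(1) by auto
    \<comment> \<open>The minimal \<open>g\<close> flips nothing in the rank two subgroup, so by the
      cocycle identity the sign changes at \<open>i\<close> and \<open>k\<close> depend on the
      factor \<open>v\<close> alone.\<close>
    have gflip: "nflip (g \<otimes>\<^bsub>W\<^esub> val v) (r c) = nflip (val v) (r c)" if "set v \<subseteq> {i, k}" "c \<in> {i, k}" for v c
    proof -
      have I: "set v \<subseteq> I" "c \<in> I" using that i k(1) by auto
      have "conj (val v) (r c) = val (v @ [c] @ rev v)"
        using I by (simp add: inv_val r_val W.m_assoc flip: val_append)
      then show ?thesis
        using I that g(1) g(4)[of "v @ [c] @ rev v"] by (simp add: nflip_mult)
    qed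
    have "len g < len w"
      using g(5)[of "[k]"] k(3) by (simp add: r_val)
    have wr: "w \<otimes>\<^bsub>W\<^esub> r i = r j \<otimes>\<^bsub>W\<^esub> w"
      using less.prems(3) w i assms(3) by (metis W.inv_solve_right' W.m_closed r_closed)
    have wri: "w \<otimes>\<^bsub>W\<^esub> r i = g \<otimes>\<^bsub>W\<^esub> val (u @ [i])"
      using g(1,3) uI i by (simp add: val_snoc W.m_assoc)
    have fi: "nflip (w \<otimes>\<^bsub>W\<^esub> r i) (r i)"
      using less.prems w i by (simp add: nflip_mult nflip_r W.m_assoc)
    \<comment> \<open>Since \<open>w r i = r j w\<close>, the element \<open>w r i r k\<close>
      equals \<open>r j w r k\<close> and is at most as long as \<open>w\<close>, hence shorter than
      \<open>w r i\<close>. So \<open>k\<close> is a second descent of \<open>w r i\<close>, besides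
      \<open>i\<close>.\<close>
    have "len (r j \<otimes>\<^bsub>W\<^esub> (w \<otimes>\<^bsub>W\<^esub> r k)) \<le> len w"
      using len_r_left[OF assms(3), of "w \<otimes>\<^bsub>W\<^esub> r k"] k w by simp
    also have "len w < len (w \<otimes>\<^bsub>W\<^esub> r i)"
      by (rule not_nflip_len) (use less.prems in auto)
    finally have "\<not> len (w \<otimes>\<^bsub>W\<^esub> r i) < len (w \<otimes>\<^bsub>W\<^esub> r i \<otimes>\<^bsub>W\<^esub> r k)"
      unfolding wr using w assms(3) k(1) by (simp add: W.m_assoc)
    then have fk: "nflip (w \<otimes>\<^bsub>W\<^esub> r i) (r k)"
      using not_nflip_len[of "w \<otimes>\<^bsub>W\<^esub> r i" k] w i k(1) by auto
    have ui: "set (u @ [i]) \<subseteq> {i, k}" using g(2) by simp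
    \<comment> \<open>Both descents pass to the dihedral part, \<open>u\<close> followed by
      \<open>i\<close>, which is therefore the longest element. Cancelling the final
      \<open>i\<close> determines \<open>u\<close>.\<close>
    have "nflip (val (u @ [i])) (r i)" "nflip (val (u @ [i])) (r k)"
      using fi fk gflip[OF ui] unfolding wri by auto
    note D = dihedral_two_descents[OF ui i k(1) ik this]
    obtain n where n: "m i k = Suc n" using D(1) not0_implies_Suc by blast
    have "val u \<otimes>\<^bsub>W\<^esub> r i = val (rev (alternating k i n)) \<otimes>\<^bsub>W\<^esub> r i"
      using D(2) uI i k(1) by (simp add: n alternating_Suc val_snoc)
    then have vu: "val u = val (rev (alternating k i n))"
      using uI i k(1) by simp
    \<comment> \<open>The parity of n decides with which letter the word for \<open>u\<close>
      starts. Under this naming \<open>u\<close> is the word required by the rule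
      \<open>step\<close>, and it carries the simple root of \<open>i\<close> to that of
      \<open>a\<close>.\<close>
    define a where "a = (if even n then k else i)"
    define b where "b = (if even n then i else k)"
    have ab: "a \<in> I" "b \<in> I" "a \<noteq> b" using i k(1) ik by (auto simp: a_def b_def)
    have mab: "m a b = Suc n" using n m_sym[OF i k(1)] by (auto simp: a_def b_def)
    have vu': "val u = val (alternating b a (m a b - 1))"
      unfolding vu mab by (auto simp: rev_alternating a_def b_def)
    have i': "i = (if even (m a b) then a else b)"
      unfolding mab by (auto simp: a_def b_def)
    have "r a \<otimes>\<^bsub>W\<^esub> val (alternating b a n) = val (alternating b a n) \<otimes>\<^bsub>W\<^esub> r i"
    proof -
      have "val (alternating a b (Suc n)) = val (alternating b a (Suc n))"
        using val_braid[OF ab(1,2)] mab by simp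
      moreover have "alternating b a (Suc n) = alternating b a n @ [i]"
        by (auto simp: alternating_snoc a_def b_def)
      ultimately have "val (a # alternating b a n) = val (alternating b a n @ [i])"
        by (simp only: alternating_Suc[of a b])
      then show ?thesis using ab i by (simp add: val_Cons val_snoc)
    qed
    then have "val u \<otimes>\<^bsub>W\<^esub> r i = r a \<otimes>\<^bsub>W\<^esub> val u"
      by (simp add: vu' mab)
    then have cu: "conj (val u) (r i) = r a"
      using ab(1) uI by (simp add: W.m_assoc)
    have "P g a"
    proof (rule less.hyps[OF \<open>len g < len w\<close> g(1) ab(1)])
      show "conj g (r a) = r j"
        using less.prems(3) g(1,3) uI i cu conj_mult[of g "val u" "r i"] by simp
      show "\<not> nflip g (r a)"
        using g(4)[of "[a]"] by (auto simp: r_val a_def)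
    qed
    then show ?thesis
      using step[OF g(1) ab _ ] mab unfolding vu'[symmetric] i'[symmetric] g(3)[symmetric] by simp
  qed
qed

end

context coxeter
begin

section \<open>The elements \<open>D\<^sub>s\<close>\<close>

lemma sw_cong: "coxeter_cong I m u v \<Longrightarrow> sw u = sw v"
proof (induction rule: coxeter_cong.induct)
  case (rel i j u v)
  let ?c = "concat (replicate (m i j) [i, j])"
  have s: "set u \<subseteq> I" "set v \<subseteq> I" "set ?c \<subseteq> I" using rel by auto
  then have "sw (?c @ v) = sw v"
    using hat_familyD(6)[OF hat_family_gen rel(1,2)] by (simp add: sw_append[of ?c] del: map_append)
  moreover have "set (?c @ v) \<subseteq> I" using s by simp
  ultimately show ?case using s by (simp add: sw_append del: map_append)
qed auto

abbreviation "\<tau> \<equiv> hat_of_group I m"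

lemma tau_val: 
  assumes "set u \<subseteq> I"
  shows "\<tau> (val u) = sw u"
proof -
  have "sw v = sw u" if "v \<in> val u" for v
    using that sw_cong[of u v] by (simp add: cox_class_def)
  moreover have "u \<in> val u"
    using assms by (auto simp: cox_class_def intro: coxeter_cong.refl)
  ultimately have "sw ` val u = {sw u}" by blast
  then show ?thesis by (simp add: hat_of_group_def descend_def)
qed

lemma tau_closed [simp]: "w \<in> carrier W \<Longrightarrow> \<tau> w \<in> carrier H"
  by (auto elim!: W_elem simp: tau_val)

lemma tau_mult: "g \<in> carrier W \<Longrightarrow> h \<in> carrier W \<Longrightarrow> \<tau> (g \<otimes>\<^bsub>W\<^esub> h) = \<tau> g \<otimes>\<^bsub>H\<^esub> \<tau> h"
  by (elim W_elem) (simp add: tau_val sw_append del: map_append flip: val_append)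

lemma tau_one [simp]: "\<tau> \<one>\<^bsub>W\<^esub> = \<one>\<^bsub>H\<^esub>"
  using tau_val[of "[]"] by (simp add: W_sel)

lemma tau_r: "i \<in> I \<Longrightarrow> \<tau> (r i) = s i"
  using tau_val[of "[i]"] by (simp add: r_val)

lemma tau_inv [simp]:
  assumes "w \<in> carrier W"
  shows "\<tau> w \<otimes>\<^bsub>H\<^esub> \<tau> (inv\<^bsub>W\<^esub> w) = \<one>\<^bsub>H\<^esub>" "\<tau> (inv\<^bsub>W\<^esub> w) \<otimes>\<^bsub>H\<^esub> \<tau> w = \<one>\<^bsub>H\<^esub>"
  using assms by (simp_all flip: tau_mult)

lemma tau_inv_left [simp]:
  assumes "w \<in> carrier W" "x \<in> carrier H"
  shows "\<tau> w \<otimes>\<^bsub>H\<^esub> (\<tau> (inv\<^bsub>W\<^esub> w) \<otimes>\<^bsub>H\<^esub> x) = x" "\<tau> (inv\<^bsub>W\<^esub> w) \<otimes>\<^bsub>H\<^esub> (\<tau> w \<otimes>\<^bsub>H\<^esub> x) = x"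
  using assms by (simp_all flip: H.m_assoc)

definition hconj where "hconj w x = \<tau> w \<otimes>\<^bsub>H\<^esub> x \<otimes>\<^bsub>H\<^esub> \<tau> (inv\<^bsub>W\<^esub> w)"

lemma hconj_closed [simp]: "w \<in> carrier W \<Longrightarrow> x \<in> carrier H \<Longrightarrow> hconj w x \<in> carrier H"
  by (simp add: hconj_def)

lemma hconj_mult: 
  "w \<in> carrier W \<Longrightarrow> v \<in> carrier W \<Longrightarrow> x \<in> carrier H \<Longrightarrow> hconj (w \<otimes>\<^bsub>W\<^esub> v) x = hconj w (hconj v x)"
  by (simp add: hconj_def tau_mult W.inv_mult_group H.m_assoc)

lemma hconj_one [simp]: "x \<in> carrier H \<Longrightarrow> hconj \<one>\<^bsub>W\<^esub> x = x"
  by (simp add: hconj_def)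

lemma hconj_prod:
  "w \<in> carrier W \<Longrightarrow> x \<in> carrier H \<Longrightarrow> y \<in> carrier H \<Longrightarrow>
    hconj w (x \<otimes>\<^bsub>H\<^esub> y) = hconj w x \<otimes>\<^bsub>H\<^esub> hconj w y"
  by (simp add: hconj_def H.m_assoc)

lemma tau_conj: "w \<in> carrier W \<Longrightarrow> x \<in> carrier W \<Longrightarrow> \<tau> (conj w x) = hconj w (\<tau> x)"
  by (simp add: hconj_def tau_mult)

lemma hconj_eqI:
  "w \<in> carrier W \<Longrightarrow> x \<in> carrier H \<Longrightarrow> y \<in> carrier H \<Longrightarrow> \<tau> w \<otimes>\<^bsub>H\<^esub> x = y \<otimes>\<^bsub>H\<^esub> \<tau> w \<Longrightarrow> hconj w x = y"
  by (simp add: hconj_def H.m_assoc)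

text \<open>The relation that moves D across a word says precisely that the elementary factors of
  \<open>simple_root_induct\<close> conjugate one simple D into another.\<close>

lemma hconj_d:
  assumes "w \<in> carrier W" "i \<in> I" "j \<in> I" "conj w (r i) = r j" "\<not> nflip w (r i)"
  shows "hconj w (d i) = d j"
proof (rule simple_root_induct[where P = "\<lambda>w i. hconj w (d i) = d j", OF assms])
  show "hconj \<one>\<^bsub>W\<^esub> (d j) = d j" using assms(3) by simp
next
  fix w a b
  assume w: "w \<in> carrier W" and ab: "a \<in> I" "b \<in> I" "a \<noteq> b" "m a b \<noteq> 0" and IH: "hconj w (d a) = d j"
  let ?u = "alternating b a (m a b - 1)" and ?l = "if even (m a b) then a else b"
  have u: "set ?u \<subseteq> I" "?l \<in> I" using ab by auto
  have "hconj (val ?u) (d ?l) = d a"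
    using hat_familyD(7)[OF hat_family_gen ab] ab(1) u
    by (intro hconj_eqI) (simp_all add: tau_val del: if_split)
  then show "hconj (w \<otimes>\<^bsub>W\<^esub> val ?u) (d ?l) = d j"
    using w u IH by (simp add: hconj_mult del: if_split)
qed

abbreviation "T \<equiv> reflections I m"

lemma T_eq: "T = {conj w (r i) | w i. w \<in> carrier W \<and> i \<in> I}"
  by (simp add: reflections_def)

lemma T_closed [simp]: "t \<in> T \<Longrightarrow> t \<in> carrier W"
  by (auto simp: T_eq)

lemma r_T [simp]: "i \<in> I \<Longrightarrow> r i \<in> T"
  unfolding T_eq by (intro CollectI exI[of _ "\<one>\<^bsub>W\<^esub>"] exI[of _ i]) simp

lemma conj_T [simp]: "w \<in> carrier W \<Longrightarrow> t \<in> T \<Longrightarrow> conj w t \<in> T"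
proof -
  assume w: "w \<in> carrier W" and "t \<in> T"
  then obtain v i where v: "v \<in> carrier W" "i \<in> I" "t = conj v (r i)"
    unfolding T_eq by blast
  then have "conj w t = conj (w \<otimes>\<^bsub>W\<^esub> v) (r i)" using conj_mult[OF w v(1) r_closed] by simp
  then show ?thesis unfolding T_eq using w v W.m_closed by blast
qed

text \<open>If \<open>w\<close> flips the simple reflection, then \<open>w\<close> times
  \<open>r i\<close> does not, and it yields the same reflection since \<open>r i\<close> commutes
  with itself.\<close>

lemma T_elem:
  assumes "t \<in> T"
  obtains w i where "w \<in> carrier W" "i \<in> I" "t = conj w (r i)" "\<not> nflip w (r i)"
proof -
  obtain w i where w: "w \<in> carrier W" "i \<in> I" "t = conj w (r i)"
    using assms unfolding T_eq by blast
  show ?thesis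
  proof (cases "nflip w (r i)")
    case True
    have "conj (w \<otimes>\<^bsub>W\<^esub> r i) (r i) = conj w (r i)"
      using w by (simp add: W.inv_mult_group W.m_assoc)
    moreover have "\<not> nflip (w \<otimes>\<^bsub>W\<^esub> r i) (r i)"
      using w True by (simp add: nflip_mult nflip_r W.m_assoc)
    ultimately show ?thesis using that[of "w \<otimes>\<^bsub>W\<^esub> r i" i] w by simp
  qed (use that w in blast)
qed

text \<open>The condition on the sign is essential: conjugating \<open>d i\<close> by
  \<open>s i\<close> gives 1 - \<open>s i\<close> - \<open>d i\<close>, although \<open>r i\<close>
  is fixed. Under this condition the value does not depend on the chosen pair, by
  \<open>dr_eq\<close>.\<close>

definition dr where
  "dr t = (SOME x. \<exists>w i. w \<in> carrier W \<and> i \<in> I \<and> t = conj w (r i) \<and> \<not> nflip w (r i) \<and> x = hconj w (d i))"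

text \<open>Two admissible pairs differ by an element that carries one simple reflection to the
  other without a sign change, and \<open>hconj_d\<close> applies to it.\<close>

lemma dr_eq:
  assumes w: "w \<in> carrier W" "i \<in> I" "\<not> nflip w (r i)"
  shows "dr (conj w (r i)) = hconj w (d i)"
  unfolding dr_def
proof (rule some_equality)
  fix x assume "\<exists>w' i'. w' \<in> carrier W \<and> i' \<in> I \<and> conj w (r i) = conj w' (r i') \<and> \<not> nflip w' (r i') \<and> x = hconj w' (d i')"
  then obtain w' j where w': "w' \<in> carrier W" "j \<in> I" "conj w (r i) = conj w' (r j)" "\<not> nflip w' (r j)"
    "x = hconj w' (d j)" by blast
  let ?v = "inv\<^bsub>W\<^esub> w' \<otimes>\<^bsub>W\<^esub> w"
  have v: "?v \<in> carrier W" and wv: "w = w' \<otimes>\<^bsub>W\<^esub> ?v" using w w' by (simp_all add: W.m_assoc[symmetric])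
  have c: "conj ?v (r i) = r j"
    using w w' by (simp add: conj_mult del: W.inv_inv) (simp add: W.m_assoc[symmetric], simp add: W.m_assoc)
  have "nflip (w' \<otimes>\<^bsub>W\<^esub> ?v) (r i) \<longleftrightarrow> (nflip w' (r j) \<noteq> nflip ?v (r i))"
    using nflip_mult[OF w'(1) v r_closed[OF w(2)]] c by simp
  then have "\<not> nflip ?v (r i)" using w(3) w'(4) wv by simp
  then have "hconj ?v (d i) = d j" by (intro hconj_d v w w' c)
  then have "hconj (w' \<otimes>\<^bsub>W\<^esub> ?v) (d i) = hconj w' (d j)" using w w' v by (simp add: hconj_mult)
  then show "x = hconj w (d i)" using w'(5) wv by simp
qed (use w in blast)

lemma dr_simple: "i \<in> I \<Longrightarrow> dr (r i) = d i"
  using dr_eq[of "\<one>\<^bsub>W\<^esub>" i] by simp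

lemma dr_conj:
  assumes "w \<in> carrier W" "t \<in> T" "\<not> nflip w t"
  shows "dr (conj w t) = hconj w (dr t)"
proof -
  obtain v i where v: "v \<in> carrier W" "i \<in> I" "t = conj v (r i)" "\<not> nflip v (r i)"
    using assms(2) by (rule T_elem)
  have "\<not> nflip (w \<otimes>\<^bsub>W\<^esub> v) (r i)" using assms v by (simp add: nflip_mult)
  then have "dr (conj (w \<otimes>\<^bsub>W\<^esub> v) (r i)) = hconj (w \<otimes>\<^bsub>W\<^esub> v) (d i)"
    using assms v by (intro dr_eq) auto
  then show ?thesis
    using assms(1) v by (simp only: conj_mult hconj_mult dr_eq r_closed d_closed simp_thms)
qed

lemma dr_closed: "t \<in> T \<Longrightarrow> dr t \<in> carrier H"
  by (elim T_elem) (simp add: dr_eq)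

text \<open>Existence: \<open>r i\<close> flips only itself, so the required conjugation rule is an
  instance of \<open>dr_conj\<close>. Uniqueness: every reflection is reached from a simple one by
  successive conjugations with simple reflections.\<close>

lemma refl_D_eq: "refl_D I m = restrict dr T"
  unfolding refl_D_def
proof (rule the_equality, intro conjI ballI)
  show "restrict dr T \<in> T \<rightarrow>\<^sub>E carrier H" using dr_closed by auto
  show "restrict dr T (r i) = d i" if "i \<in> I" for i using that by (simp add: dr_simple)
  show "restrict dr T (r i \<otimes>\<^bsub>W\<^esub> t \<otimes>\<^bsub>W\<^esub> r i) = s i \<otimes>\<^bsub>H\<^esub> restrict dr T t \<otimes>\<^bsub>H\<^esub> s i"
    if i: "i \<in> I" and t: "t \<in> T - {r i}" for i t
  proof -
    have "dr (conj (r i) t) = hconj (r i) (dr t)"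
      using i t by (intro dr_conj) (auto simp: nflip_r)
    moreover have "conj (r i) t \<in> T" using i t by (intro conj_T) auto
    ultimately show ?thesis using i t by (simp add: hconj_def tau_r)
  qed
next
  fix e
  assume e: "e \<in> T \<rightarrow>\<^sub>E carrier H \<and> (\<forall>i\<in>I. e (r i) = d i) \<and>
    (\<forall>i\<in>I. \<forall>t\<in>T - {r i}. e (r i \<otimes>\<^bsub>W\<^esub> t \<otimes>\<^bsub>W\<^esub> r i) = s i \<otimes>\<^bsub>H\<^esub> e t \<otimes>\<^bsub>H\<^esub> s i)"
  \<comment> \<open>Induction on the conjugating word. A letter \<open>k\<close> with
    \<open>?t = r k\<close> leaves the reflection fixed, and there the value is prescribed by the
    condition on simple reflections.\<close>
  have eq: "e (conj (val u) (r i)) = dr (conj (val u) (r i))" if "set u \<subseteq> I" "i \<in> I" for u i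
    using that(1)
  proof (induction u)
    case Nil
    then show ?case using e that(2) by (simp add: dr_simple flip: W_sel)
  next
    case (Cons k u)
    let ?t = "conj (val u) (r i)"
    have k: "k \<in> I" "set u \<subseteq> I" using Cons.prems by auto
    have t: "?t \<in> T" using k that(2) by (intro conj_T) auto
    have c: "conj (val (k # u)) (r i) = r k \<otimes>\<^bsub>W\<^esub> ?t \<otimes>\<^bsub>W\<^esub> r k"
      using Cons.prems k that(2) conj_mult[of "r k" "val u" "r i"] by (simp only: val_Cons r_closed val_closed inv_r)
    show ?case
    proof (cases "?t = r k")
      case True
      then show ?thesis unfolding c using e k by (simp add: dr_simple)
    next
      case False
      then have "e (r k \<otimes>\<^bsub>W\<^esub> ?t \<otimes>\<^bsub>W\<^esub> r k) = s k \<otimes>\<^bsub>H\<^esub> e ?t \<otimes>\<^bsub>H\<^esub> s k" using e k t by blast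
      also have "\<dots> = dr (conj (r k) ?t)"
        using dr_conj[OF r_closed[OF k(1)] t] False t k Cons by (simp add: nflip_r hconj_def tau_r)
      finally show ?thesis unfolding c using k by simp
    qed
  qed
  have eT: "e t = dr t" if tT: "t \<in> T" for t
  proof -
    obtain w i where w: "w \<in> carrier W" "i \<in> I" "t = conj w (r i)"
      by (rule T_elem[OF tT])
    obtain u where u: "set u \<subseteq> I" "w = val u" using w(1) by (rule W_elem)
    show ?thesis unfolding w(3) u(2) by (rule eq[OF u(1) w(2)])
  qed
  show "e = restrict dr T"
  proof (intro ext)
    fix t
    have eE: "e \<in> T \<rightarrow>\<^sub>E carrier H" using e by (rule conjunct1)
    show "e t = restrict dr T t"
    proof (cases "t \<in> T")
      case True
      then show ?thesis by (simp only: eT restrict_apply if_True)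
    next
      case False
      then have "e t = undefined" by (rule PiE_arb[OF eE])
      then show ?thesis using False by (simp only: restrict_apply if_False)
    qed
  qed
qed

abbreviation "D \<equiv> refl_D I m"

lemma D_closed [simp]: "t \<in> T \<Longrightarrow> D t \<in> carrier H"
  by (simp add: refl_D_eq dr_closed)

lemma D_simple [simp]: "i \<in> I \<Longrightarrow> D (r i) = d i"
  by (simp add: refl_D_eq dr_simple)

lemma D_conj: "w \<in> carrier W \<Longrightarrow> t \<in> T \<Longrightarrow> \<not> nflip w t \<Longrightarrow> D (conj w t) = hconj w (D t)"
  using conj_T[of w t] by (simp only: refl_D_eq restrict_apply dr_conj if_True simp_thms)

lemma D_elem:
  assumes "t \<in> T"
  obtains w i where "w \<in> carrier W" "i \<in> I" "t = conj w (r i)" "D t = hconj w (d i)" "\<tau> t = hconj w (s i)"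
    "\<not> nflip w (r i)"
proof -
  obtain w i where w: "w \<in> carrier W" "i \<in> I" "t = conj w (r i)" "\<not> nflip w (r i)"
    using assms by (rule T_elem)
  then show ?thesis using that[OF w(1-3)] D_conj[of w "r i"] tau_conj[of w "r i"] by (simp add: tau_r)
qed

lemma D_idem: "t \<in> T \<Longrightarrow> D t \<otimes>\<^bsub>H\<^esub> D t = D t"
  by (elim D_elem) (simp flip: hconj_prod)

lemma s_D: "i \<in> I \<Longrightarrow> t \<in> T \<Longrightarrow> t \<noteq> r i \<Longrightarrow> s i \<otimes>\<^bsub>H\<^esub> D t = D (conj (r i) t) \<otimes>\<^bsub>H\<^esub> s i"
  using D_conj[of "r i" t] by (simp add: nflip_r hconj_def tau_r H.m_assoc)

section \<open>A spanning set\<close>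

definition monomial :: "'i list set list \<times> 'i list set \<Rightarrow> ('i gen list \<Rightarrow>\<^sub>0 int) set" where
  "monomial b = list_prod H (map D (fst b)) \<otimes>\<^bsub>H\<^esub> \<tau> (snd b)"

definition B :: "('i list set list \<times> 'i list set) set" where
  "B = {(ts, w). set ts \<subseteq> T \<and> distinct_adj ts \<and> w \<in> carrier W}"

lemma Dprod_closed [simp]: "set ts \<subseteq> T \<Longrightarrow> list_prod H (map D ts) \<in> carrier H"
  by (rule H.list_prod_closed) auto

lemma monomial_closed [simp]: "b \<in> B \<Longrightarrow> monomial b \<in> carrier H"
  by (auto simp: monomial_def B_def)

lemma monomial_Cons: "set (t # ts) \<subseteq> T \<Longrightarrow> w \<in> carrier W \<Longrightarrow> monomial (t # ts, w) = D t \<otimes>\<^bsub>H\<^esub> monomial (ts, w)"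
  by (simp add: monomial_def H.m_assoc)

abbreviation "Sp \<equiv> int_span H (monomial ` B)"

lemma monomial_B_carrier: "monomial ` B \<subseteq> carrier H"
  by auto

interpretation Sp: additive_subgroup Sp H
  by (rule additive_subgroupI, rule H.int_span_subgroup, rule monomial_B_carrier)

lemma Sp_monomial: "b \<in> B \<Longrightarrow> monomial b \<in> Sp"
  by (rule subsetD[OF H.int_span_superset imageI])

lemma Sp_left_mult:
  assumes x: "x \<in> carrier H" and b: "\<And>b. b \<in> B \<Longrightarrow> x \<otimes>\<^bsub>H\<^esub> monomial b \<in> Sp" and y: "y \<in> Sp"
  shows "x \<otimes>\<^bsub>H\<^esub> y \<in> Sp"
  using y monomial_B_carrier
proof (induction y rule: H.int_span_induct)
  case (minus y)
  then have "y \<in> carrier H" using monomial_B_carrier by blast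
  with minus show ?case using x Sp.a_inv_closed[of "x \<otimes>\<^bsub>H\<^esub> y"] by (simp add: H.r_minus)
next
  case (incl y)
  then show ?case using b by blast
next
  case (add y z)
  then show ?case using x Sp.a_closed by (simp add: H.r_distr)
next
  case zero
  then show ?case using x Sp.zero_closed by simp
qed

text \<open>A repeated first letter is absorbed, as \<open>D t\<close> is idempotent; otherwise the
  word grows.\<close>

lemma Sp_D:
  assumes "t \<in> T" "y \<in> Sp"
  shows "D t \<otimes>\<^bsub>H\<^esub> y \<in> Sp"
proof (rule Sp_left_mult[OF D_closed[OF assms(1)] _ assms(2)])
  fix b assume "b \<in> B"
  then obtain ts w where b: "b = (ts, w)" "set ts \<subseteq> T" "distinct_adj ts" "w \<in> carrier W"
    by (auto simp: B_def)
  show "D t \<otimes>\<^bsub>H\<^esub> monomial b \<in> Sp"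
  proof (cases "ts \<noteq> [] \<and> hd ts = t")
    case True
    then obtain ts' where ts: "ts = t # ts'" by (cases ts) auto
    then have "D t \<otimes>\<^bsub>H\<^esub> monomial b = monomial b"
      using b assms(1) by (simp add: monomial_def D_idem H.m_assoc[symmetric])
    then show ?thesis using Sp_monomial[OF \<open>b \<in> B\<close>] by simp
  next
    case False
    then have "(t # ts, w) \<in> B" using b assms(1) by (cases ts) (auto simp: B_def)
    moreover have "D t \<otimes>\<^bsub>H\<^esub> monomial b = monomial (t # ts, w)" using b assms(1) by (simp add: monomial_Cons)
    ultimately show ?thesis using Sp_monomial by simp
  qed
qed

text \<open>\<open>s i\<close> moves to the right through the word, conjugating its letters, until
  the group element absorbs it. Passing the letter \<open>r i\<close> costs the extra terms of s D =
  s - 1 - D s, which concern the shorter word. \<open>Sp_D\<close> repairs letters that have become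
  equal neighbours.\<close>

lemma Sp_s:
  assumes "i \<in> I" "y \<in> Sp"
  shows "s i \<otimes>\<^bsub>H\<^esub> y \<in> Sp"
proof (rule Sp_left_mult[OF s_closed[OF assms(1)] _ assms(2)])
  fix b assume "b \<in> B"
  then obtain ts w where b: "b = (ts, w)" "set ts \<subseteq> T" "distinct_adj ts" "w \<in> carrier W"
    by (auto simp: B_def)
  have "s i \<otimes>\<^bsub>H\<^esub> monomial (ts, w) \<in> Sp"
    using b(2,3)
  proof (induction ts)
    case Nil
    have "s i \<otimes>\<^bsub>H\<^esub> monomial ([], w) = monomial ([], r i \<otimes>\<^bsub>W\<^esub> w)"
      using b assms(1) by (simp add: monomial_def tau_mult tau_r)
    moreover have "([], r i \<otimes>\<^bsub>W\<^esub> w) \<in> B" using b assms(1) by (simp add: B_def)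
    ultimately show ?case using Sp_monomial by simp
  next
    case (Cons t ts)
    then have t: "t \<in> T" "set ts \<subseteq> T" "(ts, w) \<in> B" and IH: "s i \<otimes>\<^bsub>H\<^esub> monomial (ts, w) \<in> Sp"
      using b(4) by (auto simp: B_def distinct_adj_Cons)
    have "s i \<otimes>\<^bsub>H\<^esub> monomial (t # ts, w) = (s i \<otimes>\<^bsub>H\<^esub> D t) \<otimes>\<^bsub>H\<^esub> monomial (ts, w)"
      using Cons.prems b assms(1) t by (simp add: monomial_Cons H.m_assoc)
    also have "\<dots> \<in> Sp"
    proof (cases "t = r i")
      case False
      then have "(s i \<otimes>\<^bsub>H\<^esub> D t) \<otimes>\<^bsub>H\<^esub> monomial (ts, w) = D (conj (r i) t) \<otimes>\<^bsub>H\<^esub> (s i \<otimes>\<^bsub>H\<^esub> monomial (ts, w))"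
        using assms(1) t conj_T[of "r i" t] by (simp add: s_D H.m_assoc)
      then show ?thesis using Sp_D[OF conj_T[OF r_closed[OF assms(1)] t(1)] IH] by simp
    next
      case True
      then have "(s i \<otimes>\<^bsub>H\<^esub> D t) \<otimes>\<^bsub>H\<^esub> monomial (ts, w) =
          s i \<otimes>\<^bsub>H\<^esub> monomial (ts, w) \<ominus>\<^bsub>H\<^esub> monomial (ts, w) \<ominus>\<^bsub>H\<^esub> D (r i) \<otimes>\<^bsub>H\<^esub> (s i \<otimes>\<^bsub>H\<^esub> monomial (ts, w))"
        using assms(1) t by (simp add: sd H.minus_eq H.l_distr H.l_minus H.m_assoc)
      moreover have "D (r i) \<otimes>\<^bsub>H\<^esub> (s i \<otimes>\<^bsub>H\<^esub> monomial (ts, w)) \<in> Sp"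
        using assms(1) IH by (intro Sp_D) auto
      ultimately show ?thesis
        using IH Sp_monomial[OF t(3)] by (simp add: H.minus_eq Sp.a_closed Sp.a_inv_closed)
    qed
    finally show ?case .
  qed
  then show "s i \<otimes>\<^bsub>H\<^esub> monomial b \<in> Sp" using b(1) by simp
qed

lemma spanning: "x \<in> carrier H \<Longrightarrow> x \<in> Sp"
proof (induction x rule: hat_induct)
  case one
  have "([], \<one>\<^bsub>W\<^esub>) \<in> B" by (simp add: B_def)
  then show ?case using Sp_monomial[of "([], \<one>\<^bsub>W\<^esub>)"] by (simp add: monomial_def)
next
  case (gen x a)
  then show ?case using Sp_s Sp_D[OF r_T] by auto
next
  case (diff x y)
  then show ?case by (simp add: H.minus_eq Sp.a_closed Sp.a_inv_closed)
qed

end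

section \<open>Linear independence of the spanning set\<close>

text \<open>The target for the universal property of \<open>H\<close>: additive endomorphisms of a
  space of real functions, where the halves in the shift exist.\<close>

definition End :: "(('x \<Rightarrow> real) \<Rightarrow> 'x \<Rightarrow> real) ring" where
  "End = \<lparr>carrier = {h. \<forall>f g. h (\<lambda>x. f x + g x) = (\<lambda>x. h f x + h g x)},
    monoid.mult = (\<circ>), one = id, ring.zero = (\<lambda>f x. 0), ring.add = (\<lambda>h k f x. h f x + k f x)\<rparr>"

lemma End_sel [simp]:
  "h \<in> carrier End \<longleftrightarrow> (\<forall>f g. h (\<lambda>x. f x + g x) = (\<lambda>x. h f x + h g x))"
  "h \<otimes>\<^bsub>End\<^esub> k = h \<circ> k" "\<one>\<^bsub>End\<^esub> = id" "\<zero>\<^bsub>End\<^esub> = (\<lambda>f x. 0)" "h \<oplus>\<^bsub>End\<^esub> k = (\<lambda>f x. h f x + k f x)"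
  by (simp_all add: End_def)

lemma End_add: "h \<in> carrier End \<Longrightarrow> h (\<lambda>x. f x + g x) = (\<lambda>x. h f x + h g x)"
  by (simp only: End_sel(1))

lemma ring_End: "ring End"
proof (rule ringI)
  show "abelian_group End"
  proof (rule abelian_groupI)
    fix h :: "('x \<Rightarrow> real) \<Rightarrow> 'x \<Rightarrow> real" assume "h \<in> carrier End"
    then show "\<exists>k\<in>carrier End. k \<oplus>\<^bsub>End\<^esub> h = \<zero>\<^bsub>End\<^esub>"
      by (intro bexI[of _ "\<lambda>f x. - h f x"]) (simp_all add: fun_eq_iff)
  qed (simp_all add: fun_eq_iff algebra_simps)
  show "Group.monoid End"
    by (rule monoidI) (simp_all add: comp_def id_def)
qed (simp_all add: fun_eq_iff comp_def)

lemma End_a_minus: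
  assumes "h \<in> carrier End" "k \<in> carrier End"
  shows "h \<ominus>\<^bsub>End\<^esub> k = (\<lambda>f x. h f x - k f x)"
proof -
  interpret E: ring End by (rule ring_End)
  have "\<ominus>\<^bsub>End\<^esub> k = (\<lambda>f x. - k f x)"
    by (rule E.minus_equality) (use assms in \<open>simp_all add: fun_eq_iff\<close>)
  then show ?thesis by (simp add: a_minus_def fun_eq_iff)
qed

context coxeter
begin

text \<open>Over the reals put \<open>E\<^sub>t = D\<^sub>t - (1 - t) / 2\<close>. Then \<open>E\<^sub>t\<^sup>2 = 0\<close> and \<open>w E\<^sub>t w\<^sup>-\<^sup>1\<close> is \<open>E\<close> at the
  conjugate reflection up to sign, so that \<open>H\<close> acts on functions on pairs of a word in reflections
  and a group element, where \<open>E\<^sub>t\<close> prepends the letter \<open>t\<close>.\<close>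

definition cc where "cc g t = (if t \<in> carrier W then conj g t else t)"
text \<open>\<open>cc\<close>, \<open>lm\<close> and \<open>sg\<close> are continued outside the
  group by the identity and the sign 1, because the functions acted on are defined on all pairs of
  the type. The action laws then hold at every point.\<close>

definition lm where "lm g w = (if w \<in> carrier W then g \<otimes>\<^bsub>W\<^esub> w else w)"
definition sg :: "'i list set \<Rightarrow> 'i list set \<Rightarrow> real" where
  "sg g t = (if t \<in> carrier W \<and> nflip g t then -1 else 1)"
definition sgs :: "'i list set \<Rightarrow> 'i list set list \<Rightarrow> real" where
  "sgs g ts = prod_list (map (sg g) ts)"

text \<open>Functions are pulled back along the inverse, so that for \<open>g\<close> in the group
  the indicator of a pair moves to that of its image, with one sign for each letter of the
  word.\<close>

definition act :: "'i list set \<Rightarrow> ('i list set list \<times> 'i list set \<Rightarrow> real) \<Rightarrow>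
    'i list set list \<times> 'i list set \<Rightarrow> real" where
  "act g f = (\<lambda>(ts, w). sgs (inv\<^bsub>W\<^esub> g) ts * f (map (cc (inv\<^bsub>W\<^esub> g)) ts, lm (inv\<^bsub>W\<^esub> g) w))"

text \<open>On indicators: \<open>t\<close> is put in front of the word, and a word that already
  begins with \<open>t\<close> goes to zero, as E E = 0 demands. On functions this means evaluation
  at the word without its head.\<close>

definition Eop :: "'i list set \<Rightarrow> ('i list set list \<times> 'i list set \<Rightarrow> real) \<Rightarrow>
    'i list set list \<times> 'i list set \<Rightarrow> real" where
  "Eop t f = (\<lambda>(ts, w). if ts \<noteq> [] \<and> hd ts = t \<and> (tl ts = [] \<or> hd (tl ts) \<noteq> t) then f (tl ts, w) else 0)"

definition Dop :: "'i list set \<Rightarrow> ('i list set list \<times> 'i list set \<Rightarrow> real) \<Rightarrow>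
    'i list set list \<times> 'i list set \<Rightarrow> real" where
  "Dop t f = (\<lambda>x. Eop t f x + (f x - act t f x) / 2)"

lemma cc_mult: "g \<in> carrier W \<Longrightarrow> h \<in> carrier W \<Longrightarrow> cc (g \<otimes>\<^bsub>W\<^esub> h) = (\<lambda>t. cc g (cc h t))"
  by (simp add: cc_def fun_eq_iff W.inv_mult_group W.m_assoc)

lemma sg_mult: "g \<in> carrier W \<Longrightarrow> h \<in> carrier W \<Longrightarrow> sg (g \<otimes>\<^bsub>W\<^esub> h) t = sg g (cc h t) * sg h t"
  by (simp add: sg_def cc_def nflip_mult)

lemma sgs_mult: "g \<in> carrier W \<Longrightarrow> h \<in> carrier W \<Longrightarrow> sgs (g \<otimes>\<^bsub>W\<^esub> h) ts = sgs g (map (cc h) ts) * sgs h ts"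
  by (induction ts) (simp_all add: sgs_def sg_mult)

lemma act_mult: "g \<in> carrier W \<Longrightarrow> h \<in> carrier W \<Longrightarrow> act (g \<otimes>\<^bsub>W\<^esub> h) f = act g (act h f)"
  by (auto simp: act_def fun_eq_iff W.inv_mult_group sgs_mult cc_mult comp_def lm_def W.m_assoc)

lemma act_one: "act \<one>\<^bsub>W\<^esub> f = f"
proof -
  have sgs: "sgs \<one>\<^bsub>W\<^esub> ts = 1" for ts by (induction ts) (simp_all add: sgs_def sg_def)
  have "cc \<one>\<^bsub>W\<^esub> = id" by (simp add: fun_eq_iff cc_def)
  then have "map (cc \<one>\<^bsub>W\<^esub>) ts = ts" for ts by simp
  moreover have "lm \<one>\<^bsub>W\<^esub> w = w" for w by (simp add: lm_def)
  ultimately show ?thesis by (simp add: act_def sgs fun_eq_iff)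
qed

lemma act_inv: "g \<in> carrier W \<Longrightarrow> act g (act (inv\<^bsub>W\<^esub> g) f) = f"
  by (simp add: act_one flip: act_mult)

lemma act_End: "act g \<in> carrier End"
  by (simp add: act_def fun_eq_iff algebra_simps)

lemma Eop_End: "Eop t \<in> carrier End"
  by (auto simp: Eop_def fun_eq_iff)

lemma Dop_End: "Dop t \<in> carrier End"
proof -
  have "Eop t (\<lambda>x. f x + g x) = (\<lambda>x. Eop t f x + Eop t g x)" "act t (\<lambda>x. f x + g x) = (\<lambda>x. act t f x + act t g x)"
    for f g
    by (rule End_add[OF Eop_End], rule End_add[OF act_End])
  then show ?thesis by (simp add: Dop_def fun_eq_iff field_simps)
qed


lemma act_half: "act g (\<lambda>x. (f x - h x) / 2) = (\<lambda>x. (act g f x - act g h x) / 2)"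
  by (simp add: act_def fun_eq_iff field_simps)

lemma Eop_half: "Eop g (\<lambda>x. (f x - h x) / 2) = (\<lambda>x. (Eop g f x - Eop g h x) / 2)"
  by (auto simp: Eop_def fun_eq_iff)

lemma Eop_Eop: "Eop t (Eop t f) = (\<lambda>x. 0)"
  by (auto simp: Eop_def fun_eq_iff)

lemma sg_inv:
  assumes "g \<in> carrier W" "t \<in> carrier W"
  shows "sg (inv\<^bsub>W\<^esub> g) (conj g t) = sg g t"
  using assms nflip_mult[of "inv\<^bsub>W\<^esub> g" g t] by (auto simp: sg_def)

text \<open>The pullback turns a head \<open>conj g t\<close> into \<open>t\<close>. That letter
  alone accounts for the sign, which \<open>sg_inv\<close> evaluates; the signs of the other letters
  occur on both sides.\<close>

lemma act_Eop:
  assumes g: "g \<in> carrier W" and t: "t \<in> carrier W"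
  shows "act g (Eop t f) = (\<lambda>x. sg g t * Eop (conj g t) (act g f) x)"
proof
  fix x :: "'i list set list \<times> 'i list set"
  let ?t = "conj g t" and ?g = "inv\<^bsub>W\<^esub> g"
  have c: "cc ?g u = t \<longleftrightarrow> u = ?t" for u
  proof
    assume "cc ?g u = t"
    then show "u = ?t" using g t by (auto simp: cc_def W.m_assoc W.inv_solve_left split: if_splits)
      (simp_all add: W.m_assoc[symmetric])
  qed (use g t in \<open>simp add: cc_def W.m_assoc, simp add: W.m_assoc[symmetric]\<close>)
  obtain ts w where x: "x = (ts, w)" by (cases x)
  show "act g (Eop t f) x = sg g t * Eop ?t (act g f) x"
  proof (cases ts)
    case (Cons u us)
    show ?thesis
    proof (cases "u = ?t \<and> (us = [] \<or> hd us \<noteq> ?t)")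
      case True
      have "sgs ?g (u # us) = sg g t * sgs ?g us"
        using True sg_inv[OF g t] by (simp add: sgs_def)
      moreover have "Eop t f (map (cc ?g) (u # us), lm ?g w) = f (map (cc ?g) us, lm ?g w)"
        using True by (cases us) (simp_all add: Eop_def c)
      moreover have "Eop ?t (act g f) (u # us, w) = act g f (us, w)"
        using True by (simp add: Eop_def)
      ultimately show ?thesis unfolding x Cons by (simp add: act_def)
    next
      case False
      then consider "u \<noteq> ?t" | "us \<noteq> []" "hd us = ?t" by blast
      then have "Eop t f (map (cc ?g) (u # us), lm ?g w) = 0"
      proof cases
        case 2
        then show ?thesis using c[of "hd us"] by (simp add: Eop_def hd_map)
      qed (simp add: Eop_def c)
      moreover have "Eop ?t (act g f) (u # us, w) = 0"
        by (simp only: Eop_def prod.case list.sel) (rule if_not_P, use False in blast)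
      ultimately show ?thesis unfolding x Cons by (simp add: act_def)
    qed
  qed (simp add: x act_def Eop_def)
qed

text \<open>The converse of the step in \<open>simple_root_induct\<close>, needed for the braid
  relation between the operators. If the word flipped \<open>r l\<close>, some power (p q)^(k + 1)
  with k + 1 < m would be trivial, against the order of the product.\<close>

lemma dihedral_simple:
  assumes ij: "i \<in> I" "j \<in> I" "i \<noteq> j" "m i j \<noteq> 0"
  defines "x \<equiv> val (alternating j i (m i j - 1))" and "l \<equiv> if even (m i j) then i else j"
  shows "\<not> nflip x (r l)" "r i \<otimes>\<^bsub>W\<^esub> x = x \<otimes>\<^bsub>W\<^esub> r l"
proof -
  obtain n where n: "m i j = Suc n" using ij(4) not0_implies_Suc by blast
  have no: "val (alternating p q (2 * k + 1)) \<noteq> r q" if "{p, q} = {i, j}" "k < n" for p q k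
  proof
    assume *: "val (alternating p q (2 * k + 1)) = r q"
    have pq: "p \<in> I" "q \<in> I" "p \<noteq> q" "m p q = m i j"
      using that(1) ij m_sym[OF ij(1,2)] by (auto simp: doubleton_eq_iff)
    have "alternating p q (2 * Suc k) = alternating p q (2 * k + 1) @ [q]"
      using alternating_snoc[of p q "2 * k + 1"] by simp
    then have "val (alternating p q (2 * Suc k)) = \<one>\<^bsub>W\<^esub>"
      using pq * by (simp add: val_snoc)
    then show False using order_alternating[OF pq(1-3), of "Suc k"] pq(4) n that(2) by simp
  qed
  show "\<not> nflip x (r l)"
  proof (cases "even n")
    case True
    then have "alternating j i n = rev (alternating i j n)" by (simp add: rev_alternating)
    moreover have "{k. k < n \<and> r j = val (alternating i j (2 * k + 1))} = {}"
      using no[of i j] by fastforce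
    then have "\<not> flips (rev (alternating i j n)) (r j)"
      unfolding flips_alternating[OF ij(2,1) r_closed[OF ij(2)]]
      by (simp only: card.empty even_zero simp_thms)
    ultimately show ?thesis using True ij
      unfolding x_def l_def n by (subst nflip_val) simp_all
  next
    case False
    then have "alternating j i n = rev (alternating j i n)" by (simp add: rev_alternating)
    moreover have "{k. k < n \<and> r i = val (alternating j i (2 * k + 1))} = {}"
      using no[of j i] by fastforce
    then have "\<not> flips (rev (alternating j i n)) (r i)"
      unfolding flips_alternating[OF ij(1,2) r_closed[OF ij(1)]]
      by (simp only: card.empty even_zero simp_thms)
    ultimately show ?thesis using False ij
      unfolding x_def l_def n by (subst nflip_val) simp_all
  qed
  have "val (alternating i j (Suc n)) = val (alternating j i (Suc n))"
    using val_braid[OF ij(1,2)] by (simp add: n)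
  then have "val (i # alternating j i n) = val (alternating j i n @ [l])"
    unfolding alternating_Suc[of i j] alternating_snoc[of j i] l_def n by simp
  then show "r i \<otimes>\<^bsub>W\<^esub> x = x \<otimes>\<^bsub>W\<^esub> r l"
    using ij by (simp add: x_def n l_def val_Cons val_snoc del: if_split)
qed

lemma act_Dop:
  assumes g: "g \<in> carrier W" and t: "t \<in> carrier W" "\<not> nflip g t"
  shows "act g (Dop t f) = Dop (conj g t) (act g f)"
proof -
  have "act g (Eop t f) = Eop (conj g t) (act g f)"
    using act_Eop[OF g t(1)] t(2) by (simp add: sg_def)
  moreover have "act g (act t f) = act (conj g t) (act g f)"
    using g t by (simp add: W.m_assoc flip: act_mult)
  moreover have "act g (\<lambda>x. Eop t f x + (f x - act t f x) / 2) =
      (\<lambda>x. act g (Eop t f) x + act g (\<lambda>x. (f x - act t f x) / 2) x)"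
    by (rule End_add[OF act_End])
  ultimately show ?thesis by (simp add: Dop_def act_half)
qed

definition rho :: "'i gen \<Rightarrow> ('i list set list \<times> 'i list set \<Rightarrow> real) \<Rightarrow>
    'i list set list \<times> 'i list set \<Rightarrow> real" where
  "rho a = (case a of GenS i \<Rightarrow> act (r i) | GenD i \<Rightarrow> Dop (r i))"

lemma list_prod_act: "set u \<subseteq> I \<Longrightarrow> list_prod End (map (\<lambda>i. act (r i)) u) = act (val u)"
proof (induction u)
  case Nil
  then show ?case by (simp add: fun_eq_iff act_one flip: W_sel)
next
  case (Cons i u)
  show ?case by (rule ext) (use Cons in \<open>simp add: val_Cons act_mult\<close>)
qed

lemma rho_family: "hat_family I m End rho"
proof (rule hat_familyI)
  fix i assume i: "i \<in> I"
  let ?\<sigma> = "act (r i)" and ?e = "Eop (r i)"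
  show "rho (GenS i) \<in> carrier End" "rho (GenD i) \<in> carrier End"
    using act_End Dop_End by (simp_all only: rho_def gen.case)
  have \<sigma>\<sigma>: "?\<sigma> (?\<sigma> f) = f" for f using i by (simp add: act_one flip: act_mult)
  \<comment> \<open>The sign is -1 because \<open>r i\<close> flips itself; this is s E + E s = 0
    for the operators.\<close>
  have "\<sigma>e": "?\<sigma> (?e f) = (\<lambda>x. - ?e (?\<sigma> f) x)" for f
  proof -
    have "conj (r i) (r i) = r i" using i by (simp add: W.m_assoc)
    moreover have "sg (r i) (r i) = -1" using i by (simp add: sg_def nflip_r)
    ultimately show ?thesis using act_Eop[of "r i" "r i" f] i by simp
  qed
  show "rho (GenS i) \<otimes>\<^bsub>End\<^esub> rho (GenS i) = \<one>\<^bsub>End\<^esub>"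
    using \<sigma>\<sigma> by (simp add: rho_def fun_eq_iff)
  have "\<sigma>D": "?\<sigma> (Dop (r i) f) = (\<lambda>x. - ?e (?\<sigma> f) x + (?\<sigma> f x - f x) / 2)" for f
    unfolding Dop_def by (simp add: End_add[OF act_End] act_half \<sigma>\<sigma> "\<sigma>e")
  have "Dop (r i) (Dop (r i) f) x = Dop (r i) f x" for f x
  proof -
    have "?e (Dop (r i) f) = (\<lambda>x. (?e f x - ?e (?\<sigma> f) x) / 2)"
      unfolding Dop_def by (simp add: End_add[OF Eop_End] Eop_Eop Eop_half)
    then show ?thesis
      unfolding Dop_def[of _ "Dop (r i) f"] "\<sigma>D" by (simp add: Dop_def field_simps)
  qed
  then show "rho (GenD i) \<otimes>\<^bsub>End\<^esub> rho (GenD i) = rho (GenD i)"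
    by (simp add: rho_def fun_eq_iff)
  have "?\<sigma> (Dop (r i) f) x + Dop (r i) (?\<sigma> f) x = ?\<sigma> f x - f x" for f x
    unfolding "\<sigma>D" by (simp add: Dop_def \<sigma>\<sigma> field_simps)
  then show "rho (GenS i) \<otimes>\<^bsub>End\<^esub> rho (GenD i) \<oplus>\<^bsub>End\<^esub> rho (GenD i) \<otimes>\<^bsub>End\<^esub> rho (GenS i) =
      rho (GenS i) \<ominus>\<^bsub>End\<^esub> \<one>\<^bsub>End\<^esub>"
    using act_End[of "r i"] ring.ring_simprules(6)[OF ring_End]
    by (subst End_a_minus) (simp_all only: rho_def gen.case, simp_all add: fun_eq_iff)
  fix j assume j: "j \<in> I"
  have "set (concat (replicate (m i j) [i, j])) \<subseteq> I" using i j by simp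
  then have "list_prod End (map (\<lambda>i. act (r i)) (concat (replicate (m i j) [i, j]))) = act \<one>\<^bsub>W\<^esub>"
    using val_relation[OF i j] by (simp only: list_prod_act alternating_double)
  then show "list_prod End (map (\<lambda>i. rho (GenS i)) (concat (replicate (m i j) [i, j]))) = \<one>\<^bsub>End\<^esub>"
    by (simp add: rho_def fun_eq_iff act_one)
  assume ij: "i \<noteq> j" "m i j \<noteq> 0"
  let ?u = "alternating j i (m i j - 1)" and ?l = "if even (m i j) then i else j"
  have u: "set ?u \<subseteq> I" "?l \<in> I" using i j by auto
  have "conj (val ?u) (r ?l) = r i"
    unfolding dihedral_simple(2)[OF i j ij, symmetric] using u i by (simp add: W.m_assoc)
  then have "act (val ?u) (Dop (r ?l) f) = Dop (r i) (act (val ?u) f)" for f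
    using act_Dop[of "val ?u" "r ?l" f] dihedral_simple(1)[OF i j ij] u by (simp del: if_split)
  then have "Dop (r i) \<circ> act (val ?u) = act (val ?u) \<circ> Dop (r ?l)"
    by (intro ext) (simp only: comp_apply)
  then show "rho (GenD i) \<otimes>\<^bsub>End\<^esub> list_prod End (map (\<lambda>i. rho (GenS i)) ?u) =
      list_prod End (map (\<lambda>i. rho (GenS i)) ?u) \<otimes>\<^bsub>End\<^esub> rho (GenD ?l)"
    by (simp only: rho_def gen.case list_prod_act[OF u(1)] End_sel(2))
qed

definition rep where "rep = lift End rho"

lemma rep_hom: "rep \<in> ring_hom H End"
  unfolding rep_def by (rule lift_ring_hom[OF ring_End rho_family])

lemma rep_add_hom: "abelian_group_hom H End rep"
  by (rule ring_hom_abelian_group_hom[OF H.ring_axioms ring_End rep_hom])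

lemma rep_gen: "a \<in> gens \<Longrightarrow> rep (gen a) = rho a"
  unfolding rep_def by (rule lift_gen[OF ring_End rho_family])

lemma rep_mult: "x \<in> carrier H \<Longrightarrow> y \<in> carrier H \<Longrightarrow> rep (x \<otimes>\<^bsub>H\<^esub> y) f = rep x (rep y f)"
  using ring_hom_mult[OF rep_hom, of x y] by simp

lemma rep_tau: "w \<in> carrier W \<Longrightarrow> rep (\<tau> w) = act w"
proof (elim W_elem)
  fix u assume u: "set u \<subseteq> I" "w = val u"
  have "set (map s u) \<subseteq> carrier H" using u by auto
  then have "rep (sw u) = list_prod End (map rep (map s u))"
    by (rule ring_hom_list_prod[OF H.ring_axioms ring_End rep_hom])
  also have "map rep (map s u) = map (\<lambda>i. act (r i)) u"
    using u by (auto simp: rep_gen rho_def)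
  finally show ?thesis using u by (simp add: tau_val list_prod_act)
qed

lemma rep_D:
  assumes "t \<in> T"
  shows "rep (D t) = Dop t"
proof
  fix f
  obtain w i where w: "w \<in> carrier W" "i \<in> I" "t = conj w (r i)" "D t = hconj w (d i)" "\<not> nflip w (r i)"
    using assms by (rule D_elem)
  have "rep (D t) f = act w (Dop (r i) (act (inv\<^bsub>W\<^esub> w) f))"
    unfolding w(4) hconj_def using w(1,2) by (simp add: rep_mult rep_tau rep_gen rho_def)
  also have "\<dots> = Dop t f"
    using act_Dop[OF w(1) r_closed[OF w(2)] w(5)] w(1) unfolding w(3)[symmetric] by (simp add: act_inv)
  finally show "rep (D t) f = Dop t f" .
qed

text \<open>The indicator of the pair of the empty word and the identity; monomials are told apart
  by what they make of it.\<close>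

definition vac :: "'i list set list \<times> 'i list set \<Rightarrow> real" where
  "vac x = (if x = ([], \<one>\<^bsub>W\<^esub>) then 1 else 0)"

text \<open>Of the two parts of \<open>Dop t\<close> only E lengthens words, while (1 - t) / 2
  preserves their length. So in the longest possible words only the product of the E parts is
  visible. It puts the letters in front one by one and does not vanish, as neighbours
  differ.\<close>

lemma rep_monomial_leading:
  assumes "b \<in> B" "length (fst x) \<ge> length (fst b)"
  shows "rep (monomial b) vac x = (if x = b then 1 else 0)"
proof -
  obtain ts w where b: "b = (ts, w)" "set ts \<subseteq> T" "distinct_adj ts" "w \<in> carrier W"
    using assms(1) by (auto simp: B_def)
  have "rep (monomial (ts, w)) vac x = (if x = (ts, w) then 1 else 0)"
    if "set ts \<subseteq> T" "distinct_adj ts" "length (fst x) \<ge> length ts" for ts x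
    using that
  proof (induction ts arbitrary: x)
    case Nil
    obtain us v where x: "x = (us, v)" by (cases x)
    have "lm (inv\<^bsub>W\<^esub> w) v = \<one>\<^bsub>W\<^esub> \<longleftrightarrow> v = w"
    proof
      assume *: "lm (inv\<^bsub>W\<^esub> w) v = \<one>\<^bsub>W\<^esub>"
      then have v: "v \<in> carrier W" by (metis W.one_closed lm_def)
      then have "v = w \<otimes>\<^bsub>W\<^esub> (inv\<^bsub>W\<^esub> w \<otimes>\<^bsub>W\<^esub> v)" using b(4) by (simp flip: W.m_assoc)
      then show "v = w" using * v b(4) by (simp add: lm_def)
    qed (use b(4) in \<open>simp add: lm_def\<close>)
    moreover have "monomial ([], w) = \<tau> w" using b(4) by (simp add: monomial_def)
    ultimately show ?case
      using b(4) by (auto simp: rep_tau x act_def vac_def sgs_def)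
  next
    case (Cons t ts)
    have t: "t \<in> T" "set ts \<subseteq> T" "distinct_adj ts" "ts \<noteq> [] \<Longrightarrow> hd ts \<noteq> t"
      using Cons.prems by (auto simp: distinct_adj_Cons)
    let ?f = "rep (monomial (ts, w)) vac"
    note IH = Cons.IH[OF t(2,3)]
    obtain us v where x: "x = (us, v)" by (cases x)
    obtain u us' where us: "us = u # us'" using Cons.prems x by (cases us) auto
    have l: "length ts \<le> length us'" using Cons.prems x us by simp
    \<comment> \<open>These words are longer than \<open>ts\<close>, so the (1 - t) / 2 part of
      \<open>Dop t\<close> contributes nothing at \<open>x\<close>.\<close>
    have f0: "?f (us'', v') = 0" if "length us'' = length us" for us'' v'
      using IH[of "(us'', v')"] that l us by auto
    have "monomial (ts, w) \<in> carrier H" using t b(4) by (intro monomial_closed) (simp add: B_def)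
    then have "rep (monomial (t # ts, w)) vac x = Dop t ?f x"
      using Cons.prems b(4) t by (simp add: monomial_Cons rep_mult rep_D)
    also have "\<dots> = Eop t ?f x"
      using f0[of us v] f0[of "map (cc (inv\<^bsub>W\<^esub> t)) us" "lm (inv\<^bsub>W\<^esub> t) v"]
      by (simp add: Dop_def act_def x)
    also have "\<dots> = (if x = (t # ts, w) then 1 else 0)"
      using IH[of "(us', v)"] l t(4) by (auto simp: Eop_def x us)
    finally show ?case .
  qed
  then show ?thesis using b assms by simp
qed

lemma additive_ext_leading:
  assumes "Poly_Mapping.keys p \<subseteq> {b \<in> B. length (fst b) \<le> n}" "length (fst x) = n"
  shows "rep (additive_ext H monomial p) vac x = of_int (Poly_Mapping.lookup p x)"
  using assms(1)
proof (induction p rule: frag_span_induct)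
  case zero
  then show ?case using abelian_group_hom.hom_zero[OF rep_add_hom] by simp
next
  case (one b)
  then show ?case using rep_monomial_leading[of b x] assms(2) by (simp add: lookup_frag_of)
next
  case (diff p q)
  have B: "monomial \<in> B \<rightarrow> carrier H" by simp
  have k: "Poly_Mapping.keys p \<subseteq> B" "Poly_Mapping.keys q \<subseteq> B" using diff by auto
  have c: "additive_ext H monomial p \<in> carrier H" "additive_ext H monomial q \<in> carrier H"
    using H.additive_ext_closed[OF k(1) B] H.additive_ext_closed[OF k(2) B] by auto
  have "rep (additive_ext H monomial (p - q)) = rep (additive_ext H monomial p) \<ominus>\<^bsub>End\<^esub> rep (additive_ext H monomial q)"
    using H.additive_ext_diff[OF k B] abelian_group_hom.hom_minus[OF rep_add_hom c] by simp
  also have "\<dots> = (\<lambda>f x. rep (additive_ext H monomial p) f x - rep (additive_ext H monomial q) f x)"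
    by (rule End_a_minus) (rule abelian_group_hom.hom_closed[OF rep_add_hom] c)+
  finally show ?case using diff by (simp add: lookup_minus)
qed

text \<open>At a member of the support whose word is of maximal length, all other monomials of the
  combination vanish. The value there is thus the coefficient, which must be zero.\<close>

lemma independent:
  assumes "Poly_Mapping.keys p \<subseteq> B" "additive_ext H monomial p = \<zero>\<^bsub>H\<^esub>"
  shows "p = 0"
proof (rule ccontr)
  assume "p \<noteq> 0"
  then have ne: "Poly_Mapping.keys p \<noteq> {}" by simp
  let ?n = "Max ((length \<circ> fst) ` Poly_Mapping.keys p)"
  have "?n \<in> (length \<circ> fst) ` Poly_Mapping.keys p" using ne by (intro Max_in) auto
  then obtain x where x: "x \<in> Poly_Mapping.keys p" "length (fst x) = ?n" by auto
  have "length (fst b) \<le> ?n" if "b \<in> Poly_Mapping.keys p" for b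
  proof -
    have "(length \<circ> fst) b \<le> ?n" by (intro Max_ge finite_imageI imageI that) simp
    then show ?thesis by (simp only: comp_apply)
  qed
  then have "Poly_Mapping.keys p \<subseteq> {b \<in> B. length (fst b) \<le> ?n}" using assms(1) by blast
  from additive_ext_leading[OF this x(2)] have "Poly_Mapping.lookup p x = 0"
    using assms(2) abelian_group_hom.hom_zero[OF rep_add_hom] by simp
  then show False using x(1) by (simp add: in_keys_iff)
qed

section \<open>Coordinates with respect to the monomial basis\<close>

definition co where
  "co x = (THE p. Poly_Mapping.keys p \<subseteq> B \<and> additive_ext H monomial p = x)"

lemma monomial_Pi: "monomial \<in> B \<rightarrow> carrier H"
  by simp

lemma co_eqI:
  assumes "Poly_Mapping.keys p \<subseteq> B" "additive_ext H monomial p = x"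
  shows "co x = p"
  unfolding co_def
proof (rule the_equality)
  fix q assume q: "Poly_Mapping.keys q \<subseteq> B \<and> additive_ext H monomial q = x"
  then have "additive_ext H monomial (q - p) = x \<ominus>\<^bsub>H\<^esub> x"
    using assms by (simp add: H.additive_ext_diff[OF _ _ monomial_Pi])
  moreover have "x \<in> carrier H" using H.additive_ext_closed[OF assms(1) monomial_Pi] assms(2) by simp
  ultimately have "additive_ext H monomial (q - p) = \<zero>\<^bsub>H\<^esub>"
    by (simp add: H.minus_eq H.r_neg)
  then have "q - p = 0"
    by (intro independent keys_diff_subset conjunct1[OF q] assms(1))
  then show "q = p" by simp
qed (use assms in auto)

lemma co_ex:
  assumes "x \<in> carrier H"
  shows "\<exists>p. Poly_Mapping.keys p \<subseteq> B \<and> additive_ext H monomial p = x"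
  using spanning[OF assms] monomial_B_carrier
proof (induction x rule: H.int_span_induct)
  case zero
  then show ?case by (intro exI[of _ 0]) simp
next
  case (incl x)
  then obtain b where "b \<in> B" "x = monomial b" by blast
  then show ?case by (intro exI[of _ "frag_of b"]) simp
next
  case (minus x)
  then obtain p where "Poly_Mapping.keys p \<subseteq> B" "additive_ext H monomial p = x" by blast
  then show ?case by (intro exI[of _ "- p"]) (simp add: H.additive_ext_minus[OF _ monomial_Pi])
next
  case (add x y)
  then obtain p q where "Poly_Mapping.keys p \<subseteq> B" "additive_ext H monomial p = x"
    "Poly_Mapping.keys q \<subseteq> B" "additive_ext H monomial q = y" by blast
  then show ?case using Poly_Mapping.keys_add[of p q]
    by (intro exI[of _ "p + q"]) (auto simp: H.additive_ext_add[OF _ _ monomial_Pi])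
qed

lemma co_keys: "x \<in> carrier H \<Longrightarrow> Poly_Mapping.keys (co x) \<subseteq> B"
  and co_ext: "x \<in> carrier H \<Longrightarrow> additive_ext H monomial (co x) = x"
proof -
  assume "x \<in> carrier H"
  then obtain p where p: "Poly_Mapping.keys p \<subseteq> B" "additive_ext H monomial p = x"
    using co_ex by meson
  then have "co x = p" by (rule co_eqI)
  with p show "Poly_Mapping.keys (co x) \<subseteq> B" "additive_ext H monomial (co x) = x" by simp_all
qed

lemma co_add:
  assumes "x \<in> carrier H" "y \<in> carrier H"
  shows "co (x \<oplus>\<^bsub>H\<^esub> y) = co x + co y"
  using assms co_keys[of x] co_keys[of y] Poly_Mapping.keys_add[of "co x" "co y"]
  by (intro co_eqI) (auto simp: H.additive_ext_add[OF _ _ monomial_Pi] co_ext)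

end

section \<open>Left coideals\<close>

lemma (in abelian_group_hom) hom_finsum:
  assumes "finite F" "f \<in> F \<rightarrow> carrier G"
  shows "h (finsum G f F) = finsum H (\<lambda>x. h (f x)) F"
  using assms
proof (induction F rule: finite_induct)
  case (insert x F)
  then have "f x \<in> carrier G" "f \<in> F \<rightarrow> carrier G" by auto
  moreover from this have "(\<lambda>x. h (f x)) \<in> F \<rightarrow> carrier H"
    by (intro funcsetI hom_closed) (rule funcset_mem)
  ultimately show ?case using insert by (simp add: G.finsum_insert H.finsum_insert)
qed simp

lemma (in abelian_group) diff_add_diff:
  "a \<in> carrier G \<Longrightarrow> b \<in> carrier G \<Longrightarrow> c \<in> carrier G \<Longrightarrow> d \<in> carrier G \<Longrightarrow>
    (a \<oplus> b) \<ominus> (c \<oplus> d) = (a \<ominus> c) \<oplus> (b \<ominus> d)"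
  by (simp add: minus_eq minus_add a_ac)

lemma (in additive_subgroup) add_pow_mem:
  assumes "abelian_group G" "x \<in> H"
  shows "add_pow G (n::int) x \<in> H"
  using group.subgroup_int_pow_closed[OF abelian_group.a_group[OF assms(1)] a_subgroup, of x n] assms(2)
  by (simp add: add_pow_def)

lemma (in abelian_group) finsum_subgroup:
  assumes "subgroup L (add_monoid G)" "finite F" "\<And>x. x \<in> F \<Longrightarrow> f x \<in> L"
  shows "finsum G f F \<in> L"
proof -
  interpret L: additive_subgroup L G by (rule additive_subgroupI) fact
  from assms(2,3) show ?thesis
  proof (induction F rule: finite_induct)
    case (insert x F)
    then have "f \<in> F \<rightarrow> carrier G" "f x \<in> carrier G" using L.a_subset by auto
    then show ?case using insert by (simp add: finsum_insert)
  qed (simp add: L.zero_closed)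
qed

context coxeter
begin

abbreviation pt (infixl "\<otimes>p" 70) where "a \<otimes>p b \<equiv> pure_tensor H H a b"

text \<open>The image of H tensor L in the tensor square of H, so that no question of injectivity
  arises.\<close>

definition RL :: "('i gen list \<Rightarrow>\<^sub>0 int) set set \<Rightarrow> _" where
  "RL L = int_span S.A2 {a \<otimes>p l | a l. a \<in> carrier H \<and> l \<in> L}"

lemma RL_gens_carrier: "L \<subseteq> carrier H \<Longrightarrow> {a \<otimes>p l | a l. a \<in> carrier H \<and> l \<in> L} \<subseteq> carrier S.A2"
  by (auto intro!: S.T2.pure_closed)

lemma RL_subgroup: "L \<subseteq> carrier H \<Longrightarrow> additive_subgroup (RL L) S.A2"
  unfolding RL_def by (rule additive_subgroupI, rule S.T2.T.int_span_subgroup, rule RL_gens_carrier)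

lemma RL_pure: "a \<in> carrier H \<Longrightarrow> l \<in> L \<Longrightarrow> a \<otimes>p l \<in> RL L"
  unfolding RL_def by (rule subsetD[OF S.T2.T.int_span_superset]) blast

lemma RL_induct [consumes 2, case_names pure add]:
  assumes "t \<in> RL L" "additive_subgroup L H"
    and pure: "\<And>a l. a \<in> carrier H \<Longrightarrow> l \<in> L \<Longrightarrow> P (a \<otimes>p l)"
    and add: "\<And>t u. t \<in> carrier S.A2 \<Longrightarrow> u \<in> carrier S.A2 \<Longrightarrow> P t \<Longrightarrow> P u \<Longrightarrow> P (t \<oplus>\<^bsub>S.A2\<^esub> u)"
  shows "P t"
proof -
  interpret L: additive_subgroup L H by fact
  show ?thesis
    using assms(1) RL_gens_carrier[OF L.a_subset] unfolding RL_def
  proof (induction t rule: S.T2.T.int_span_induct)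
    case zero
    then show ?case using pure[OF H.zero_closed L.zero_closed] by simp
  next
    case (incl x)
    then show ?case using pure by blast
  next
    case (minus x)
    then obtain a l where x: "x = a \<otimes>p l" "a \<in> carrier H" "l \<in> L" by blast
    then have "\<ominus>\<^bsub>S.A2\<^esub> x = (\<ominus>\<^bsub>H\<^esub> a) \<otimes>p l" using L.a_Hcarr by (simp add: S.T2.pure_minus)
    then show ?case using pure[of "\<ominus>\<^bsub>H\<^esub> a" l] x by simp
  qed (rule add)
qed

lemma RL_hom:
  assumes h: "abelian_group_hom S.A2 C h" and L: "additive_subgroup L H" and M: "additive_subgroup M C"
    and "\<And>a l. a \<in> carrier H \<Longrightarrow> l \<in> L \<Longrightarrow> h (a \<otimes>p l) \<in> M" and t: "t \<in> RL L"
  shows "h t \<in> M"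
  using t L
proof (induction t rule: RL_induct)
  case (add t u)
  then show ?case
    using abelian_group_hom.hom_add[OF h] additive_subgroup.a_closed[OF M] by simp
qed (rule assms(4))

lemma RL_mono:
  assumes "L \<subseteq> M" "M \<subseteq> carrier H"
  shows "RL L \<subseteq> RL M"
  unfolding RL_def
proof (rule S.T2.T.int_span_minimal)
  show "{a \<otimes>p l | a l. a \<in> carrier H \<and> l \<in> L} \<subseteq> int_span S.A2 {a \<otimes>p l | a l. a \<in> carrier H \<and> l \<in> M}"
    using assms(1) by (intro subset_trans[OF _ S.T2.T.int_span_superset]) blast
qed (rule S.T2.T.int_span_subgroup[OF RL_gens_carrier[OF assms(2)]])

lemma RL_mult:
  assumes "additive_subgroup L H" "additive_subgroup L' H" "additive_subgroup M H"
    and m: "\<And>l l'. l \<in> L \<Longrightarrow> l' \<in> L' \<Longrightarrow> l \<otimes>\<^bsub>H\<^esub> l' \<in> M"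
    and t: "t \<in> RL L" and u: "u \<in> RL L'"
  shows "t \<otimes>\<^bsub>S.A2\<^esub> u \<in> RL M"
proof -
  interpret L: additive_subgroup L H by fact
  interpret L': additive_subgroup L' H by fact
  interpret M: additive_subgroup M H by fact
  interpret RM: additive_subgroup "RL M" S.A2 by (rule RL_subgroup[OF M.a_subset])
  have uc: "u \<in> carrier S.A2"
    using u additive_subgroup.a_subset[OF RL_subgroup[OF L'.a_subset]] by blast
  show ?thesis
    using t assms(1)
  proof (induction t rule: RL_induct)
    case (pure a l)
    note al = pure
    from u assms(2) show ?case
    proof (induction u rule: RL_induct)
      case (pure a' l')
      then show ?case using al L.a_Hcarr L'.a_Hcarr m by (simp add: RL_pure)
    next
      case (add t u)
      then show ?case using al L.a_Hcarr by (simp add: S.T2.T_distr RM.a_closed)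
    qed
  next
    case (add t t')
    then show ?case using uc by (simp add: S.T2.T_distr RM.a_closed)
  qed
qed

text \<open>The coordinate functionals of the basis turn membership in \<open>H \<otimes> L\<close> into membership of the
  slices in \<open>L\<close>, so that \<open>H \<otimes> _\<close> commutes with arbitrary intersections.\<close>

definition slice where
  "slice b = tensor_lift H (\<lambda>x y. add_pow H (Poly_Mapping.lookup (co x) b) y)"

lemma slice_biadditive: "biadditive H H H (\<lambda>x y. add_pow H (Poly_Mapping.lookup (co x) b) y)"
  by (rule biadditiveI)
    (simp_all add: H.is_abelian_group co_add lookup_add H.int_add_pow_add H.int_add_pow_distrib)

lemma slice_hom: "abelian_group_hom S.A2 H (slice b)"
  unfolding slice_def by (rule S.T2.tensor_lift_hom[OF slice_biadditive])

lemma slice_pure: "x \<in> carrier H \<Longrightarrow> y \<in> carrier H \<Longrightarrow>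
    slice b (x \<otimes>p y) = add_pow H (Poly_Mapping.lookup (co x) b) y"
  unfolding slice_def by (rule S.T2.tensor_lift_pure[OF slice_biadditive])

lemma slice_mem:
  assumes L: "additive_subgroup L H" and t: "t \<in> RL L"
  shows "slice b t \<in> L"
proof (rule RL_hom[OF slice_hom L L _ t])
  fix a l assume "a \<in> carrier H" "l \<in> L"
  then show "slice b (a \<otimes>p l) \<in> L"
    using additive_subgroup.add_pow_mem[OF L H.is_abelian_group] additive_subgroup.a_Hcarr[OF L]
    by (simp add: slice_pure)
qed

text \<open>The expansion is claimed for all finite sets beyond some \<open>F0\<close>, not for a
  single set, so that two tensors can be expanded over a common one.\<close>

lemma slice_expansion:
  assumes "t \<in> carrier S.A2"
  shows "\<exists>F0. finite F0 \<and> F0 \<subseteq> B \<and> (\<forall>F. finite F \<longrightarrow> F0 \<subseteq> F \<longrightarrow> F \<subseteq> B \<longrightarrow>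
    t = (\<Oplus>\<^bsub>S.A2\<^esub>b\<in>F. monomial b \<otimes>p slice b t))"
  using assms
proof (induction t rule: S.T2.tensor_induct)
  case (pure x y)
  show ?case
  proof (intro exI[of _ "Poly_Mapping.keys (co x)"] conjI allI impI)
    show "Poly_Mapping.keys (co x) \<subseteq> B" by (rule co_keys[OF pure(1)])
    fix F assume F: "finite F" "Poly_Mapping.keys (co x) \<subseteq> F" "F \<subseteq> B"
    let ?c = "\<lambda>b. add_pow H (Poly_Mapping.lookup (co x) b) (monomial b)"
    have c: "?c \<in> F \<rightarrow> carrier H" using F(3) by auto
    have "monomial \<in> F \<rightarrow> carrier H" using F(3) by (intro funcsetI monomial_closed) blast
    then have "x = finsum H ?c F"
      using H.additive_ext_superset[OF F(1,2), of monomial] by (simp add: co_ext[OF pure(1)])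
    then have "x \<otimes>p y = finsum H ?c F \<otimes>p y" by simp
    also have "\<dots> = (\<Oplus>\<^bsub>S.A2\<^esub>b\<in>F. ?c b \<otimes>p y)"
      by (rule abelian_group_hom.hom_finsum[OF S.T2.pure_hom_left[OF pure(2)] F(1) c])
    also have "\<dots> = (\<Oplus>\<^bsub>S.A2\<^esub>b\<in>F. monomial b \<otimes>p slice b (x \<otimes>p y))"
    proof (rule S.T2.T.finsum_cong'[OF HOL.refl])
      show "(\<lambda>b. monomial b \<otimes>p slice b (x \<otimes>p y)) \<in> F \<rightarrow> carrier S.A2"
        using F(3) pure by (intro funcsetI S.T2.pure_closed) (auto simp: slice_pure)
      fix b assume "b \<in> F"
      then show "?c b \<otimes>p y = monomial b \<otimes>p slice b (x \<otimes>p y)"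
        using F(3) pure monomial_closed[of b] by (subst S.T2.pure_add_pow) (auto simp: slice_pure)
    qed
    finally show "x \<otimes>p y = (\<Oplus>\<^bsub>S.A2\<^esub>b\<in>F. monomial b \<otimes>p slice b (x \<otimes>p y))" .
  qed simp
next
  case (add t u)
  obtain F0 where F0: "finite F0" "F0 \<subseteq> B" "\<And>F. finite F \<Longrightarrow> F0 \<subseteq> F \<Longrightarrow> F \<subseteq> B \<Longrightarrow>
    t = (\<Oplus>\<^bsub>S.A2\<^esub>b\<in>F. monomial b \<otimes>p slice b t)"
    using add(3) by blast
  obtain F1 where F1: "finite F1" "F1 \<subseteq> B" "\<And>F. finite F \<Longrightarrow> F1 \<subseteq> F \<Longrightarrow> F \<subseteq> B \<Longrightarrow>
    u = (\<Oplus>\<^bsub>S.A2\<^esub>b\<in>F. monomial b \<otimes>p slice b u)"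
    using add(4) by blast
  show ?case
  proof (intro exI[of _ "F0 \<union> F1"] conjI allI impI)
    fix F assume F: "finite F" "F0 \<union> F1 \<subseteq> F" "F \<subseteq> B"
    have sc: "slice b v \<in> carrier H" if "v \<in> carrier S.A2" for b v
      using abelian_group_hom.hom_closed[OF slice_hom that] .
    have c: "(\<lambda>b. monomial b \<otimes>p slice b v) \<in> F \<rightarrow> carrier S.A2" if "v \<in> carrier S.A2" for v
      using F(3) sc[OF that] by (intro funcsetI S.T2.pure_closed) auto
    have "t \<oplus>\<^bsub>S.A2\<^esub> u = (\<Oplus>\<^bsub>S.A2\<^esub>b\<in>F. monomial b \<otimes>p slice b t) \<oplus>\<^bsub>S.A2\<^esub> (\<Oplus>\<^bsub>S.A2\<^esub>b\<in>F. monomial b \<otimes>p slice b u)"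
      using F0(3)[OF F(1) _ F(3)] F1(3)[OF F(1) _ F(3)] F(2) by simp
    also have "\<dots> = (\<Oplus>\<^bsub>S.A2\<^esub>b\<in>F. monomial b \<otimes>p slice b t \<oplus>\<^bsub>S.A2\<^esub> monomial b \<otimes>p slice b u)"
      by (rule S.T2.T.finsum_addf[symmetric]) (rule c add(1,2))+
    also have "\<dots> = (\<Oplus>\<^bsub>S.A2\<^esub>b\<in>F. monomial b \<otimes>p slice b (t \<oplus>\<^bsub>S.A2\<^esub> u))"
    proof (rule S.T2.T.finsum_cong'[OF HOL.refl c])
      fix b assume "b \<in> F"
      then have "monomial b \<in> carrier H" using F(3) by auto
      then show "monomial b \<otimes>p slice b t \<oplus>\<^bsub>S.A2\<^esub> monomial b \<otimes>p slice b u = monomial b \<otimes>p slice b (t \<oplus>\<^bsub>S.A2\<^esub> u)"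
        using add(1,2) sc by (simp add: abelian_group_hom.hom_add[OF slice_hom] S.T2.pure_add_right)
    qed (use add(1,2) in simp)
    finally show "t \<oplus>\<^bsub>S.A2\<^esub> u = (\<Oplus>\<^bsub>S.A2\<^esub>b\<in>F. monomial b \<otimes>p slice b (t \<oplus>\<^bsub>S.A2\<^esub> u))" .
  qed (use F0 F1 in auto)
qed

lemma RL_sliceI:
  assumes t: "t \<in> carrier S.A2" and L: "L \<subseteq> carrier H" and s: "\<And>b. slice b t \<in> L"
  shows "t \<in> RL L"
proof -
  obtain F where F: "finite F" "F \<subseteq> B" and "\<forall>F'. finite F' \<longrightarrow> F \<subseteq> F' \<longrightarrow> F' \<subseteq> B \<longrightarrow>
      t = (\<Oplus>\<^bsub>S.A2\<^esub>b\<in>F'. monomial b \<otimes>p slice b t)"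
    using slice_expansion[OF t] by (elim exE conjE) (rule that)
  then have eq: "t = (\<Oplus>\<^bsub>S.A2\<^esub>b\<in>F. monomial b \<otimes>p slice b t)" by (elim allE impE) (rule F subset_refl | assumption)+
  have "(\<Oplus>\<^bsub>S.A2\<^esub>b\<in>F. monomial b \<otimes>p slice b t) \<in> RL L"
    using F(2) s
    by (intro S.T2.T.finsum_subgroup[OF additive_subgroup.a_subgroup[OF RL_subgroup[OF L]] F(1)] RL_pure
        monomial_closed) auto
  then show ?thesis unfolding eq[symmetric] .
qed

text \<open>The map applied to \<open>t\<close> is the identity tensor the map from l to l -
  \<epsilon> l 1. For \<open>t\<close> a coproduct, the counit axiom makes the subtracted term x
  tensor 1.\<close>

lemma RL_remove_counit:
  assumes L: "additive_subgroup L H" and t: "t \<in> RL L"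
    and M: "M \<subseteq> carrier H" "\<And>l. l \<in> L \<Longrightarrow> l \<ominus>\<^bsub>H\<^esub> add_pow H (\<epsilon> l) \<one>\<^bsub>H\<^esub> \<in> M"
  shows "t \<ominus>\<^bsub>S.A2\<^esub> (tensor_lift H (\<lambda>a b. add_pow H (\<epsilon> b) a) t \<otimes>p \<one>\<^bsub>H\<^esub>) \<in> RL M"
proof -
  interpret L: additive_subgroup L H by fact
  let ?e = "tensor_lift H (\<lambda>a b. add_pow H (\<epsilon> b) a)"
  note bi = S.biadditive_counit(2)[OF counit_hom]
  interpret e: abelian_group_hom S.A2 H ?e by (rule S.T2.tensor_lift_hom[OF bi])
  have h: "abelian_group_hom S.A2 S.A2 (\<lambda>t. t \<ominus>\<^bsub>S.A2\<^esub> (?e t \<otimes>p \<one>\<^bsub>H\<^esub>))"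
  proof -
    interpret q: abelian_group_hom S.A2 S.A2 "\<lambda>t. ?e t \<otimes>p \<one>\<^bsub>H\<^esub>"
      by (rule abelian_group_hom_compose[OF S.T2.tensor_lift_hom[OF bi] S.T2.pure_hom_left[OF H.one_closed]])
    show ?thesis
    proof (rule abelian_group_homI'[OF S.T2.T.is_abelian_group S.T2.T.is_abelian_group])
      fix t assume "t \<in> carrier S.A2"
      then show "t \<ominus>\<^bsub>S.A2\<^esub> (?e t \<otimes>p \<one>\<^bsub>H\<^esub>) \<in> carrier S.A2"
        by (intro S.T2.T.minus_closed q.hom_closed)
    next
      fix t u assume tu: "t \<in> carrier S.A2" "u \<in> carrier S.A2"
      show "(t \<oplus>\<^bsub>S.A2\<^esub> u) \<ominus>\<^bsub>S.A2\<^esub> (?e (t \<oplus>\<^bsub>S.A2\<^esub> u) \<otimes>p \<one>\<^bsub>H\<^esub>) =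
        (t \<ominus>\<^bsub>S.A2\<^esub> (?e t \<otimes>p \<one>\<^bsub>H\<^esub>)) \<oplus>\<^bsub>S.A2\<^esub> (u \<ominus>\<^bsub>S.A2\<^esub> (?e u \<otimes>p \<one>\<^bsub>H\<^esub>))"
        unfolding q.hom_add[OF tu]
        by (rule S.T2.T.diff_add_diff[OF tu q.hom_closed[OF tu(1)] q.hom_closed[OF tu(2)]])
    qed
  qed
  show ?thesis
  proof (rule RL_hom[OF h L RL_subgroup[OF M(1)] _ t])
    fix a l assume al: "a \<in> carrier H" "l \<in> L"
    then have l: "l \<in> carrier H" using L.a_Hcarr by blast
    have "a \<otimes>p l \<ominus>\<^bsub>S.A2\<^esub> (?e (a \<otimes>p l) \<otimes>p \<one>\<^bsub>H\<^esub>) = a \<otimes>p l \<ominus>\<^bsub>S.A2\<^esub> (a \<otimes>p add_pow H (\<epsilon> l) \<one>\<^bsub>H\<^esub>)"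
      using al(1) l by (simp add: S.T2.tensor_lift_pure[OF bi] S.T2.pure_add_pow)
    also have "\<dots> = a \<otimes>p (l \<ominus>\<^bsub>H\<^esub> add_pow H (\<epsilon> l) \<one>\<^bsub>H\<^esub>)"
      using al(1) l by (simp add: S.T2.T.minus_eq H.minus_eq S.T2.pure_add_right S.T2.pure_minus)
    also have "\<dots> \<in> RL M" using al M(2) by (intro RL_pure)
    finally show "a \<otimes>p l \<ominus>\<^bsub>S.A2\<^esub> (?e (a \<otimes>p l) \<otimes>p \<one>\<^bsub>H\<^esub>) \<in> RL M" .
  qed
qed

section \<open>The ideal\<close>

lemma comult_mult: "x \<in> carrier H \<Longrightarrow> y \<in> carrier H \<Longrightarrow> \<Delta> (x \<otimes>\<^bsub>H\<^esub> y) = \<Delta> x \<otimes>\<^bsub>S.A2\<^esub> \<Delta> y"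
  by (rule ring_hom_mult[OF comult_ring_hom])

lemma comult_tau: "w \<in> carrier W \<Longrightarrow> \<Delta> (\<tau> w) = \<tau> w \<otimes>p \<tau> w"
proof (elim W_elem)
  fix u assume u: "set u \<subseteq> I" "w = val u"
  have "\<Delta> (sw u) = sw u \<otimes>p sw u"
    using u(1) by (induction u) (simp_all add: comult_one comult_mult comult_s)
  then show ?thesis using u by (simp add: tau_val)
qed

lemma comult_hconj:
  assumes "w \<in> carrier W" "x \<in> carrier H"
  shows "\<Delta> (hconj w x) = \<tau> w \<otimes>p \<tau> w \<otimes>\<^bsub>S.A2\<^esub> \<Delta> x \<otimes>\<^bsub>S.A2\<^esub> (\<tau> (inv\<^bsub>W\<^esub> w) \<otimes>p \<tau> (inv\<^bsub>W\<^esub> w))"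
  using assms by (simp add: hconj_def comult_mult comult_tau)

text \<open>\<open>\<tau> w\<close> is group-like, so conjugation by it acts on both tensor factors
  and carries the formula from the simple reflections to all.\<close>

lemma comult_D:
  assumes "t \<in> T"
  shows "\<Delta> (D t) = D t \<otimes>p \<one>\<^bsub>H\<^esub> \<oplus>\<^bsub>S.A2\<^esub> \<tau> t \<otimes>p D t"
proof -
  obtain w i where w: "w \<in> carrier W" "i \<in> I" "D t = hconj w (d i)" "\<tau> t = hconj w (s i)"
    using assms by (rule D_elem)
  show ?thesis
    unfolding w(3,4) comult_hconj[OF w(1) d_closed[OF w(2)]] comult_d[OF w(2)]
    using w(1,2) by (simp add: S.T2.T_distr hconj_def)
qed

section \<open>Left coideals attached to a parabolic subgroup\<close>

context
  fixes J :: "'i set"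
  assumes J: "J \<subseteq> I"
begin

abbreviation "WJ \<equiv> parabolic I m J"
abbreviation "DJ \<equiv> hatD I m J"
abbreviation "Deg \<equiv> hatD_degree_le I m J"
abbreviation "GJ \<equiv> D_gens I m J"

lemma WJ_closed: "w \<in> WJ \<Longrightarrow> w \<in> carrier W"
proof -
  have "r ` J \<subseteq> carrier W" using J by (intro image_subsetI r_closed) blast
  moreover assume "w \<in> WJ"
  ultimately show ?thesis using W.generate_incl unfolding parabolic_def by blast
qed

lemma GJ_elem:
  assumes "x \<in> GJ"
  obtains t where "t \<in> T" "x = D t"
  using assms by (auto simp: D_gens_def)

lemma GJ_closed: "GJ \<subseteq> carrier H"
  by (auto elim!: GJ_elem)

lemma DJ_subring: "subring DJ H"
  unfolding hatD_def by (rule H.generate_ring_is_subring[OF GJ_closed])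

interpretation DJ: subring DJ H by (rule DJ_subring)

lemma DJ_additive: "additive_subgroup DJ H"
  by (rule additive_subgroupI) (rule DJ.subgroup_axioms)

text \<open>The right factors of the coproduct of \<open>D t\<close> are 1 and \<open>D t\<close>,
  while the left factor \<open>\<tau> t\<close> is a group element and need not lie in the
  subalgebra. This is why only right factors are controlled.\<close>

lemma comult_DJ: "x \<in> DJ \<Longrightarrow> \<Delta> x \<in> RL DJ"
proof -
  interpret R: additive_subgroup "RL DJ" S.A2
    by (rule RL_subgroup) (use DJ.subset in simp)
  have c: "x \<in> carrier H" if "x \<in> DJ" for x using that DJ.subset by blast
  have one: "\<one>\<^bsub>H\<^esub> \<in> DJ" by (rule DJ.one_closed)
  assume "x \<in> DJ"
  then show "\<Delta> x \<in> RL DJ"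
    unfolding hatD_def
  proof (induction x rule: generate_ring.induct)
    case one
    then show ?case using RL_pure[OF H.one_closed \<open>\<one>\<^bsub>H\<^esub> \<in> DJ\<close>] unfolding hatD_def by (simp add: comult_one)
  next
    case (incl x)
    then obtain t where t: "t \<in> T" "x = D t" by (rule GJ_elem)
    have "x \<in> DJ" unfolding hatD_def by (rule generate_ring.incl[OF incl])
    then have "\<Delta> x \<in> RL DJ"
      using t c one unfolding t(2) by (simp only: comult_D) (intro R.a_closed RL_pure; simp)
    then show ?case unfolding hatD_def .
  next
    case (a_inv x)
    then have "x \<in> carrier H" using c unfolding hatD_def by blast
    then show ?case using a_inv R.a_inv_closed unfolding hatD_def by (simp add: cm.hom_a_inv)
  next
    case (eng_add x y)
    then have "x \<in> carrier H" "y \<in> carrier H" using c unfolding hatD_def by blast+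
    then show ?case using eng_add R.a_closed unfolding hatD_def by (simp add: cm.hom_add)
  next
    case (eng_mult x y)
    then have "x \<in> carrier H" "y \<in> carrier H" using c unfolding hatD_def by blast+
    then show ?case
      using eng_mult RL_mult[OF DJ_additive DJ_additive DJ_additive DJ.m_closed] unfolding hatD_def
      by (simp add: comult_mult)
  qed
qed

lemma hconj_hom: "w \<in> carrier W \<Longrightarrow> abelian_group_hom H H (hconj w)"
  by (rule abelian_group_homI')
    (simp_all add: H.is_abelian_group hconj_def H.l_distr H.r_distr)

lemma hconj_DJ_additive:
  assumes "w \<in> carrier W"
  shows "additive_subgroup (hconj w ` DJ) H"
proof (rule additive_subgroupI)
  have "subgroup (hconj w ` DJ) (add_monoid H)"
    using group_hom.subgroup_img_is_subgroup[OF abelian_group_hom.a_group_hom[OF hconj_hom[OF assms]]]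
      DJ.subgroup_axioms by blast
  then show "subgroup (hconj w ` DJ) (add_monoid H)" .
qed

lemma comult_hconj_DJ:
  assumes w: "w \<in> carrier W" and x: "x \<in> hconj w ` DJ"
  shows "\<Delta> x \<in> RL (hconj w ` DJ)"
proof -
  let ?w = "\<tau> w \<otimes>p \<tau> w" and ?w' = "\<tau> (inv\<^bsub>W\<^esub> w) \<otimes>p \<tau> (inv\<^bsub>W\<^esub> w)"
  obtain y where y: "y \<in> DJ" "x = hconj w y" using x by blast
  have yc: "y \<in> carrier H" using y DJ.subset by blast
  have wc: "?w \<in> carrier S.A2" "?w' \<in> carrier S.A2" using w by simp_all
  have h: "abelian_group_hom S.A2 S.A2 (\<lambda>t. ?w \<otimes>\<^bsub>S.A2\<^esub> t \<otimes>\<^bsub>S.A2\<^esub> ?w')"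
    by (rule abelian_group_homI') (use wc in \<open>simp_all add: S.T2.T.is_abelian_group S.T2.T_distr\<close>)
  have "?w \<otimes>\<^bsub>S.A2\<^esub> \<Delta> y \<otimes>\<^bsub>S.A2\<^esub> ?w' \<in> RL (hconj w ` DJ)"
  proof (rule RL_hom[OF h DJ_additive RL_subgroup _ comult_DJ[OF y(1)]])
    show "hconj w ` DJ \<subseteq> carrier H"
      by (rule additive_subgroup.a_subset[OF hconj_DJ_additive[OF w]])
    fix a l assume al: "a \<in> carrier H" "l \<in> DJ"
    then have "l \<in> carrier H" using DJ.subset by blast
    then have "?w \<otimes>\<^bsub>S.A2\<^esub> (a \<otimes>p l) \<otimes>\<^bsub>S.A2\<^esub> ?w' = hconj w a \<otimes>p hconj w l"
      using w al(1) by (simp add: hconj_def)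
    then show "?w \<otimes>\<^bsub>S.A2\<^esub> (a \<otimes>p l) \<otimes>\<^bsub>S.A2\<^esub> ?w' \<in> RL (hconj w ` DJ)"
      using al w by (simp add: RL_pure)
  qed
  then show ?thesis using w yc y(2) by (simp add: comult_hconj)
qed

lemma Deg_gens_carrier: "{list_prod H ds | ds. set ds \<subseteq> GJ \<and> length ds \<le> n} \<subseteq> carrier H"
  using GJ_closed by (auto intro!: H.list_prod_closed)

lemma Deg_additive: "additive_subgroup (Deg n) H"
  unfolding hatD_degree_le_def
  by (rule additive_subgroupI, rule H.int_span_subgroup, rule Deg_gens_carrier)

lemma Deg_prod: "set ds \<subseteq> GJ \<Longrightarrow> length ds \<le> n \<Longrightarrow> list_prod H ds \<in> Deg n"
  unfolding hatD_degree_le_def by (rule subsetD[OF H.int_span_superset]) blast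

lemma Deg_mono:
  assumes "k \<le> n"
  shows "Deg k \<subseteq> Deg n"
  unfolding hatD_degree_le_def[of I m J k]
proof (rule H.int_span_minimal)
  show "{list_prod H ds | ds. set ds \<subseteq> GJ \<and> length ds \<le> k} \<subseteq> Deg n"
    using assms Deg_prod order_trans by blast
qed (rule additive_subgroup.a_subgroup[OF Deg_additive])

lemma Deg_mult:
  assumes x: "x \<in> GJ" and y: "y \<in> Deg n"
  shows "x \<otimes>\<^bsub>H\<^esub> y \<in> Deg (Suc n)"
proof -
  interpret S: additive_subgroup "Deg (Suc n)" H by (rule Deg_additive)
  have xc: "x \<in> carrier H" using x GJ_closed by blast
  show ?thesis
    using y Deg_gens_carrier unfolding hatD_degree_le_def[of I m J n]
  proof (induction y rule: H.int_span_induct)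
    case (incl y)
    then obtain ds where "y = list_prod H ds" "set ds \<subseteq> GJ" "length ds \<le> n" by blast
    then show ?case using Deg_prod[of "x # ds" "Suc n"] x by simp
  next
    case (minus y)
    then have "y \<in> carrier H" using Deg_gens_carrier by blast
    then show ?case using minus xc S.a_inv_closed by (simp add: H.r_minus)
  next
    case (add y z)
    then show ?case using xc S.a_closed by (simp add: H.r_distr)
  next
    case zero
    then show ?case using xc S.zero_closed by simp
  qed
qed

text \<open>Multiplication by the coproduct of one \<open>D t\<close> either keeps the right factor
  or puts \<open>D t\<close> in front of it, so its degree grows by at most one per factor.\<close>

lemma comult_list_prod_Deg: "set ds \<subseteq> GJ \<Longrightarrow> \<Delta> (list_prod H ds) \<in> RL (Deg (length ds))"
proof (induction ds)
  case Nil
  then show ?case using RL_pure[OF H.one_closed Deg_prod[of "[]" 0]] by (simp add: comult_one)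
next
  case (Cons x ds)
  then obtain t where t: "t \<in> T" "x = D t" by (auto elim: GJ_elem)
  let ?n = "length ds"
  interpret L: additive_subgroup "Deg (length ds)" H by (rule Deg_additive)
  interpret R: additive_subgroup "RL (Deg (Suc ?n))" S.A2
    by (rule RL_subgroup) (rule additive_subgroup.a_subset[OF Deg_additive])
  have ds: "list_prod H ds \<in> carrier H" "x \<in> carrier H"
    using Cons.prems GJ_closed by (auto intro!: H.list_prod_closed)
  have h: "abelian_group_hom S.A2 S.A2 (\<lambda>u. \<Delta> x \<otimes>\<^bsub>S.A2\<^esub> u)"
    by (rule abelian_group_homI') (use ds(2) in \<open>simp_all add: S.T2.T.is_abelian_group S.T2.T_distr\<close>)
  have "\<Delta> x \<otimes>\<^bsub>S.A2\<^esub> \<Delta> (list_prod H ds) \<in> RL (Deg (Suc ?n))"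
  proof (rule RL_hom[OF h Deg_additive R.additive_subgroup_axioms])
    show "\<Delta> (list_prod H ds) \<in> RL (Deg ?n)" using Cons by simp
    fix a l assume al: "a \<in> carrier H" "l \<in> Deg ?n"
    have l: "l \<in> carrier H" "l \<in> Deg (Suc ?n)" "x \<otimes>\<^bsub>H\<^esub> l \<in> Deg (Suc ?n)"
      using al(2) L.a_Hcarr Deg_mono[of ?n "Suc ?n"] Deg_mult[of x l ?n] Cons.prems by auto
    have "\<Delta> x \<otimes>\<^bsub>S.A2\<^esub> (a \<otimes>p l) = (x \<otimes>\<^bsub>H\<^esub> a) \<otimes>p l \<oplus>\<^bsub>S.A2\<^esub> (\<tau> t \<otimes>\<^bsub>H\<^esub> a) \<otimes>p (x \<otimes>\<^bsub>H\<^esub> l)"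
      using t al(1) l(1) by (simp add: comult_D S.T2.T_distr)
    also have "\<dots> \<in> RL (Deg (Suc ?n))"
      using al(1) l ds(2) t(1) by (intro R.a_closed RL_pure) auto
    finally show "\<Delta> x \<otimes>\<^bsub>S.A2\<^esub> (a \<otimes>p l) \<in> RL (Deg (Suc ?n))" .
  qed
  then show ?case using ds by (simp add: comult_mult)
qed

lemma comult_Deg:
  assumes "x \<in> Deg n"
  shows "\<Delta> x \<in> RL (Deg n)"
proof -
  interpret R: additive_subgroup "RL (Deg n)" S.A2
    by (rule RL_subgroup) (rule additive_subgroup.a_subset[OF Deg_additive])
  have *: "\<Delta> x \<in> RL (Deg n)" if gx: "x \<in> {list_prod H ds | ds. set ds \<subseteq> GJ \<and> length ds \<le> n}" for x
  proof -
    obtain ds where ds: "x = list_prod H ds" "set ds \<subseteq> GJ" "length ds \<le> n" using gx by blast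
    then show ?thesis
      using comult_list_prod_Deg[OF ds(2)] RL_mono[OF Deg_mono[OF ds(3)]]
        additive_subgroup.a_subset[OF Deg_additive] by blast
  qed
  show ?thesis
    using assms Deg_gens_carrier unfolding hatD_degree_le_def[of I m J n]
  proof (induction x rule: H.int_span_induct)
    case (incl x)
    then show ?case using * unfolding hatD_degree_le_def[of I m J n] by blast
  next
    case (minus x)
    then have "x \<in> carrier H" using Deg_gens_carrier by blast
    then show ?case using minus R.a_inv_closed unfolding hatD_degree_le_def[of I m J n] by simp
  next
    case (add y z)
    then show ?case using R.a_closed unfolding hatD_degree_le_def[of I m J n] by simp
  next
    case zero
    then show ?case using R.zero_closed unfolding hatD_degree_le_def[of I m J n] by simp
  qed
qed

lemma K_alg_eq: "K_alg I m J = (\<Inter>w\<in>WJ. hconj w ` DJ)"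
  by (simp add: K_alg_def hconj_def)

text \<open>The condition on the counit is split off: \<open>KD\<close> contains the unit, so that
  scalars can be subtracted within it, while \<open>KP\<close> is the form that
  \<open>K_pair\<close> has.\<close>

abbreviation "KD n \<equiv> K_alg I m J \<inter> Deg n"
abbreviation "KP n \<equiv> {x \<in> K_alg I m J. \<epsilon> x = 0 \<and> x \<in> Deg n}"

lemma KD_additive: "additive_subgroup (KD n) H"
proof -
  have "subgroup (\<Inter>(insert (Deg n) ((\<lambda>w. hconj w ` DJ) ` WJ))) (add_monoid H)"
    by (rule H.add.subgroups_Inter)
      (use additive_subgroup.a_subgroup[OF Deg_additive]
        additive_subgroup.a_subgroup[OF hconj_DJ_additive] WJ_closed in auto)
  moreover have "\<Inter>(insert (Deg n) ((\<lambda>w. hconj w ` DJ) ` WJ)) = KD n"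
    unfolding K_alg_eq by blast
  ultimately show ?thesis by (intro additive_subgroupI) simp
qed

text \<open>By \<open>RL_sliceI\<close> it suffices that each slice lies in the intersection, and
  this can be checked for one subgroup at a time, however many there are.\<close>

lemma comult_KD:
  assumes "x \<in> KD n"
  shows "\<Delta> x \<in> RL (KD n)"
proof (rule RL_sliceI)
  interpret K: additive_subgroup "KD n" H by (rule KD_additive)
  show "\<Delta> x \<in> carrier S.A2" using K.a_Hcarr[OF assms] by simp
  show "KD n \<subseteq> carrier H" by (rule K.a_subset)
  fix b
  have "slice b (\<Delta> x) \<in> Deg n"
    using assms by (intro slice_mem[OF Deg_additive] comult_Deg) blast
  moreover have "slice b (\<Delta> x) \<in> hconj w ` DJ" if "w \<in> WJ" for w
    using assms that unfolding K_alg_eq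
    by (intro slice_mem[OF hconj_DJ_additive] comult_hconj_DJ WJ_closed) auto
  ultimately show "slice b (\<Delta> x) \<in> KD n" unfolding K_alg_eq by blast
qed

lemma KD_one: "\<one>\<^bsub>H\<^esub> \<in> KD n"
proof -
  have "\<one>\<^bsub>H\<^esub> \<in> hconj w ` DJ" if "w \<in> WJ" for w
    using WJ_closed[OF that] DJ.one_closed by (intro image_eqI[of _ _ "\<one>\<^bsub>H\<^esub>"]) (simp_all add: hconj_def)
  moreover have "\<one>\<^bsub>H\<^esub> \<in> Deg n" using Deg_prod[of "[]" n] by simp
  ultimately show ?thesis unfolding K_alg_eq by blast
qed

lemma KP_closed: "KP n \<subseteq> carrier H"
  using additive_subgroup.a_subset[OF KD_additive[of n]] by blast

lemma KD_remove_counit: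
  assumes "x \<in> KD n"
  shows "x \<ominus>\<^bsub>H\<^esub> add_pow H (\<epsilon> x) \<one>\<^bsub>H\<^esub> \<in> KP n"
proof -
  interpret K: additive_subgroup "KD n" H by (rule KD_additive)
  have p: "add_pow H (\<epsilon> x) \<one>\<^bsub>H\<^esub> \<in> KD n"
    by (rule K.add_pow_mem[OF H.is_abelian_group KD_one])
  then have "x \<ominus>\<^bsub>H\<^esub> add_pow H (\<epsilon> x) \<one>\<^bsub>H\<^esub> \<in> KD n"
    unfolding H.minus_eq using assms by (intro K.a_closed K.a_inv_closed)
  moreover have "\<epsilon> (x \<ominus>\<^bsub>H\<^esub> add_pow H (\<epsilon> x) \<one>\<^bsub>H\<^esub>) = 0"
  proof -
    have "\<epsilon> \<one>\<^bsub>H\<^esub> = 1" using ring_hom_one[OF counit_ring_hom] by simp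
    then have "\<epsilon> (add_pow H (\<epsilon> x) \<one>\<^bsub>H\<^esub>) = add_pow \<Z> (\<epsilon> x) 1"
      using cu.hom_add_pow[OF H.one_closed] by simp
    also have "\<dots> = \<epsilon> x"
    proof -
      have "add_pow \<Z> (int n) 1 = int n" for n
      proof (induction n)
        case (Suc n)
        then show ?case
          using abelian_group.int_add_pow_add[of \<Z> 1 1 "int n"] int.is_abelian_group
            abelian_group.int_add_pow_one[of \<Z> 1] by simp
      qed (use abelian_group.int_add_pow_zero[OF int.is_abelian_group] in simp)
      moreover have "add_pow \<Z> (- int n) 1 = - add_pow \<Z> (int n) 1" for n
        using abelian_group.int_add_pow_minus[OF int.is_abelian_group, of 1 "int n"]
        by (simp add: int_a_inv_eq)
      ultimately show ?thesis by (cases "\<epsilon> x" rule: int_cases2) simp_all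
    qed
    finally show ?thesis
      using cu.hom_minus[of x "add_pow H (\<epsilon> x) \<one>\<^bsub>H\<^esub>"] K.a_Hcarr[OF assms] by (simp add: int_a_minus_eq)
  qed
  ultimately show ?thesis by blast
qed

lemma comult_KP:
  assumes "x \<in> KP n"
  shows "\<Delta> x \<ominus>\<^bsub>S.A2\<^esub> (x \<otimes>p \<one>\<^bsub>H\<^esub>) \<in> RL (KP n)"
proof -
  have x: "x \<in> KD n" "x \<in> carrier H" using assms KP_closed by blast+
  show ?thesis
    using RL_remove_counit[OF KD_additive comult_KD[OF x(1)] KP_closed KD_remove_counit]
      hat_counit_left_right(2)[OF x(2)] by simp
qed

end

section \<open>The ideal generated by all K_ij and the axioms of a Hopf ideal\<close>

abbreviation "JW \<equiv> J_ideal I m"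

lemma K_pair_subset:
  assumes "i \<in> I" "j \<in> I"
  shows "K_pair I m i j \<subseteq> carrier H"
  unfolding K_pair_def using assms by (intro KP_closed) simp

lemma J_gens_carrier: "(\<Union>i\<in>I. \<Union>j\<in>I - {i}. K_pair I m i j) \<subseteq> carrier H"
  using K_pair_subset by blast

lemma JW_ideal: "ideal JW H"
  unfolding J_ideal_def by (rule H.genideal_ideal[OF J_gens_carrier])

interpretation JW: ideal JW H by (rule JW_ideal)

lemma J_gens_subset: "i \<in> I \<Longrightarrow> j \<in> I - {i} \<Longrightarrow> K_pair I m i j \<subseteq> JW"
  unfolding J_ideal_def using H.genideal_self[OF J_gens_carrier] by blast

lemma JW_minimal:
  assumes "ideal K H" "\<And>i j x. i \<in> I \<Longrightarrow> j \<in> I \<Longrightarrow> i \<noteq> j \<Longrightarrow> x \<in> K_pair I m i j \<Longrightarrow> x \<in> K"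
  shows "JW \<subseteq> K"
  unfolding J_ideal_def by (rule H.genideal_minimal[OF assms(1)]) (use assms(2) in blast)

definition JN where
  "JN = int_span S.A2 ({j \<otimes>p a | j a. j \<in> JW \<and> a \<in> carrier H} \<union> {a \<otimes>p j | a j. a \<in> carrier H \<and> j \<in> JW})"

lemma JN_gens_carrier:
  "{j \<otimes>p a | j a. j \<in> JW \<and> a \<in> carrier H} \<union> {a \<otimes>p j | a j. a \<in> carrier H \<and> j \<in> JW} \<subseteq> carrier S.A2"
  using JW.Icarr S.T2.pure_closed by blast

interpretation JN: additive_subgroup JN S.A2
  unfolding JN_def by (rule additive_subgroupI, rule S.T2.T.int_span_subgroup, rule JN_gens_carrier)

lemma JN_left: "j \<in> JW \<Longrightarrow> a \<in> carrier H \<Longrightarrow> j \<otimes>p a \<in> JN"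
  and JN_right: "a \<in> carrier H \<Longrightarrow> j \<in> JW \<Longrightarrow> a \<otimes>p j \<in> JN"
  unfolding JN_def by (rule subsetD[OF S.T2.T.int_span_superset]; blast)+

lemma JN_pure_mult:
  assumes "x \<in> JN" "a \<in> carrier H" "b \<in> carrier H"
  shows "(a \<otimes>p b) \<otimes>\<^bsub>S.A2\<^esub> x \<in> JN" "x \<otimes>\<^bsub>S.A2\<^esub> (a \<otimes>p b) \<in> JN"
proof -
  have ab: "a \<otimes>p b \<in> carrier S.A2" using assms by simp
  have g: "(a \<otimes>p b) \<otimes>\<^bsub>S.A2\<^esub> y \<in> JN \<and> y \<otimes>\<^bsub>S.A2\<^esub> (a \<otimes>p b) \<in> JN"
    if "y \<in> {j \<otimes>p a | j a. j \<in> JW \<and> a \<in> carrier H} \<union> {a \<otimes>p j | a j. a \<in> carrier H \<and> j \<in> JW}" for y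
    using that
  proof (elim UnE CollectE exE conjE)
    fix j c assume "y = j \<otimes>p c" "j \<in> JW" "c \<in> carrier H"
    then show ?thesis using assms(2,3) JW.Icarr
      by (simp add: JN_left JW.I_l_closed JW.I_r_closed)
  next
    fix c j assume "y = c \<otimes>p j" "c \<in> carrier H" "j \<in> JW"
    then show ?thesis using assms(2,3) JW.Icarr
      by (simp add: JN_right JW.I_l_closed JW.I_r_closed)
  qed
  have "x \<in> int_span S.A2 ({j \<otimes>p a | j a. j \<in> JW \<and> a \<in> carrier H} \<union> {a \<otimes>p j | a j. a \<in> carrier H \<and> j \<in> JW})"
    using assms(1) by (simp only: JN_def)
  then have "(a \<otimes>p b) \<otimes>\<^bsub>S.A2\<^esub> x \<in> JN \<and> x \<otimes>\<^bsub>S.A2\<^esub> (a \<otimes>p b) \<in> JN"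
    using JN_gens_carrier
  proof (induction x rule: S.T2.T.int_span_induct)
    case (incl y)
    then show ?case by (rule g)
  next
    case (minus y)
    have y: "y \<in> carrier S.A2" by (rule subsetD[OF JN_gens_carrier minus(1)])
    have "\<ominus>\<^bsub>S.A2\<^esub> ((a \<otimes>p b) \<otimes>\<^bsub>S.A2\<^esub> y) \<in> JN" "\<ominus>\<^bsub>S.A2\<^esub> (y \<otimes>\<^bsub>S.A2\<^esub> (a \<otimes>p b)) \<in> JN"
      using minus(2) JN.a_inv_closed by blast+
    then show ?case by (simp only: S.T2.T.r_minus[OF ab y] S.T2.T.l_minus[OF y ab] simp_thms)
  next
    case (add y z)
    then show ?case using ab JN.a_closed by (simp add: S.T2.T_distr)
  next
    case zero
    then show ?case using ab JN.zero_closed by simp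
  qed
  then show "(a \<otimes>p b) \<otimes>\<^bsub>S.A2\<^esub> x \<in> JN" "x \<otimes>\<^bsub>S.A2\<^esub> (a \<otimes>p b) \<in> JN" by blast+
qed

lemma JN_mult:
  assumes "x \<in> JN" "t \<in> carrier S.A2"
  shows "t \<otimes>\<^bsub>S.A2\<^esub> x \<in> JN \<and> x \<otimes>\<^bsub>S.A2\<^esub> t \<in> JN"
  using assms(2)
proof (induction t rule: S.T2.tensor_induct)
  case (pure a b)
  then show ?case using JN_pure_mult[OF assms(1)] by blast
next
  case (add t u)
  then show ?case using JN.a_Hcarr[OF assms(1)] by (simp add: S.T2.T_distr JN.a_closed)
qed

lemma RL_subset_JN:
  assumes "L \<subseteq> JW"
  shows "RL L \<subseteq> JN"
  unfolding RL_def
proof (rule S.T2.T.int_span_minimal)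
  show "{a \<otimes>p l | a l. a \<in> carrier H \<and> l \<in> L} \<subseteq> JN" using assms JN_right by blast
qed (rule JN.a_subgroup)

lemma K_pair_comult:
  assumes "i \<in> I" "j \<in> I" "i \<noteq> j" "x \<in> K_pair I m i j"
  shows "x \<in> carrier H" "x \<in> JW" "\<Delta> x \<ominus>\<^bsub>S.A2\<^esub> (x \<otimes>p \<one>\<^bsub>H\<^esub>) \<in> RL (K_pair I m i j)"
    "K_pair I m i j \<subseteq> JW" "\<epsilon> x = 0"
proof -
  show "x \<in> carrier H" using K_pair_subset assms by blast
  show "K_pair I m i j \<subseteq> JW" using J_gens_subset[of i j] assms by blast
  then show "x \<in> JW" using assms by blast
  have "{i, j} \<subseteq> I" using assms by blast
  from comult_KP[OF this, of x "m i j"] show "\<Delta> x \<ominus>\<^bsub>S.A2\<^esub> (x \<otimes>p \<one>\<^bsub>H\<^esub>) \<in> RL (K_pair I m i j)"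
    using assms(4) unfolding K_pair_def by blast
  show "\<epsilon> x = 0" using assms(4) unfolding K_pair_def by blast
qed

text \<open>The coproduct is a ring homomorphism and \<open>JN\<close> a two-sided ideal, so the
  preimage of \<open>JN\<close> is an ideal and only generators matter. For a generator x, the term
  x tensor 1 is added back to the difference controlled by \<open>K_pair_comult\<close>.\<close>

lemma comult_JW: "\<Delta> ` JW \<subseteq> JN"
proof -
  let ?K = "{x \<in> carrier H. \<Delta> x \<in> JN}"
  have "ideal ?K H"
  proof (rule idealI[OF H.ring_axioms])
    show "subgroup ?K (add_monoid H)"
      by (rule H.add.subgroupI) (use JN.zero_closed JN.a_closed JN.a_inv_closed cm.hom_zero in \<open>auto simp: cm.hom_add\<close>)
    fix a x assume "a \<in> ?K" "x \<in> carrier H"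
    then show "x \<otimes>\<^bsub>H\<^esub> a \<in> ?K" "a \<otimes>\<^bsub>H\<^esub> x \<in> ?K"
      using JN_mult[of "\<Delta> a" "\<Delta> x"] by (simp_all add: comult_mult)
  qed
  then have "JW \<subseteq> ?K"
  proof (rule JW_minimal)
    fix i j x assume x: "i \<in> I" "j \<in> I" "i \<noteq> j" "x \<in> K_pair I m i j"
    note K = K_pair_comult[OF x]
    have c: "\<Delta> x \<in> carrier S.A2" "x \<otimes>p \<one>\<^bsub>H\<^esub> \<in> carrier S.A2" using K(1) by simp_all
    have "\<Delta> x \<ominus>\<^bsub>S.A2\<^esub> (x \<otimes>p \<one>\<^bsub>H\<^esub>) \<oplus>\<^bsub>S.A2\<^esub> (x \<otimes>p \<one>\<^bsub>H\<^esub>) \<in> JN"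
      using K(3) RL_subset_JN[OF K(4)] JN_left[OF K(2) H.one_closed] by (intro JN.a_closed) blast+
    then have "\<Delta> x \<in> JN" using c by (simp add: S.T2.T.minus_eq S.T2.T.a_assoc S.T2.T.l_neg)
    then show "x \<in> ?K" using K(1) by blast
  qed
  then show ?thesis by blast
qed

lemma counit_JW: "j \<in> JW \<Longrightarrow> \<epsilon> j = 0"
proof -
  assume "j \<in> JW"
  then have j: "j \<in> Idl\<^bsub>H\<^esub> (\<Union>i\<in>I. \<Union>j\<in>I - {i}. K_pair I m i j)" by (simp only: J_ideal_def)
  have "\<epsilon> j = \<zero>\<^bsub>\<Z>\<^esub>"
    by (rule H.genideal_kernel[OF int.ring_axioms counit_ring_hom J_gens_carrier _ j])
      (use K_pair_comult(5) in \<open>simp only: int_zero_eq, blast\<close>)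
  then show ?thesis by simp
qed

text \<open>\<sigma> reverses products and \<open>JW\<close> is two-sided, so the preimage of
  \<open>JW\<close> under \<sigma> is an ideal, and again generators suffice.\<close>

lemma antipode_JW: "\<sigma> ` JW \<subseteq> JW"
proof -
  let ?K = "{x \<in> carrier H. \<sigma> x \<in> JW}"
  have "ideal ?K H"
  proof (rule idealI[OF H.ring_axioms])
    show "subgroup ?K (add_monoid H)"
      by (rule H.add.subgroupI) (use JW.zero_closed JW.a_closed JW.a_inv_closed an.hom_zero in \<open>auto simp: an.hom_add\<close>)
    fix a x assume "a \<in> ?K" "x \<in> carrier H"
    then show "x \<otimes>\<^bsub>H\<^esub> a \<in> ?K" "a \<otimes>\<^bsub>H\<^esub> x \<in> ?K"
      by (simp_all add: antipode_mult JW.I_l_closed JW.I_r_closed)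
  qed
  then have "JW \<subseteq> ?K"
  proof (rule JW_minimal)
    fix i j x assume x: "i \<in> I" "j \<in> I" "i \<noteq> j" "x \<in> K_pair I m i j"
    note K = K_pair_comult[OF x]
    let ?l = "tensor_lift H (\<lambda>a b. \<sigma> a \<otimes>\<^bsub>H\<^esub> b)"
    note bi = S.biadditive_antipode(1)[OF antipode_hom]
    interpret l: abelian_group_hom S.A2 H ?l by (rule S.T2.tensor_lift_hom[OF bi])
    have c: "\<Delta> x \<in> carrier S.A2" "x \<otimes>p \<one>\<^bsub>H\<^esub> \<in> carrier S.A2" using K(1) by simp_all
    \<comment> \<open>The antipode axiom with counit zero gives 0 here, and x tensor 1 is sent to
      \<sigma> x. The difference thus goes to minus \<sigma> x, while elements of H tensor
      \<open>K_pair\<close> are sent to sums of left multiples of elements of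
      \<open>K_pair\<close>.\<close>
    have "?l (\<Delta> x) = \<zero>\<^bsub>H\<^esub>"
      using hat_antipode_left_right(1)[OF K(1)] K(5) by simp
    then have eq: "?l (\<Delta> x \<ominus>\<^bsub>S.A2\<^esub> (x \<otimes>p \<one>\<^bsub>H\<^esub>)) = \<ominus>\<^bsub>H\<^esub> \<sigma> x"
      using K(1) l.hom_minus[OF c] by (simp add: S.T2.tensor_lift_pure[OF bi] H.minus_eq)
    have "?l t \<in> JW" if "t \<in> RL (K_pair I m i j)" for t
      using that RL_gens_carrier[OF K_pair_subset[OF x(1,2)]] unfolding RL_def
    proof (induction t rule: S.T2.T.int_span_induct)
      case (incl t)
      then obtain a k where ak: "t = a \<otimes>p k" "a \<in> carrier H" "k \<in> K_pair I m i j" by blast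
      then have k: "k \<in> JW" using K(4) by blast
      then show ?case using ak JW.Icarr[OF k] by (simp add: S.T2.tensor_lift_pure[OF bi] JW.I_l_closed)
    next
      case (minus t)
      then have "t \<in> carrier S.A2" using RL_gens_carrier[OF K_pair_subset[OF x(1,2)]] by blast
      then show ?case using minus by (simp add: JW.a_inv_closed)
    qed (simp_all add: JW.zero_closed JW.a_closed)
    from this[OF K(3)] have "\<ominus>\<^bsub>H\<^esub> (\<ominus>\<^bsub>H\<^esub> \<sigma> x) \<in> JW" unfolding eq by (rule JW.a_inv_closed)
    then show "x \<in> ?K" using K(1) by simp
  qed
  then show ?thesis by blast
qed

lemma hopf_ideal_JW: "hopf_ideal JW H \<Delta> \<epsilon> \<sigma>"
proof (intro hopf_ideal.intro hopf_ideal_axioms.intro)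
  show "\<Delta> ` JW \<subseteq> int_span S.A2 ({j \<otimes>p a | j a. j \<in> JW \<and> a \<in> carrier H} \<union>
      {a \<otimes>p j | a j. a \<in> carrier H \<and> j \<in> JW})"
    using comult_JW unfolding JN_def .
  show "\<epsilon> ` JW \<subseteq> {0}" using counit_JW by blast
qed (rule JW_ideal hopf_algebra_hat antipode_JW)+

end

theorem theorem1p24:
  fixes I :: "'i set" and m :: "'i \<Rightarrow> 'i \<Rightarrow> nat"
  assumes "coxeter_matrix I m"
  shows "hopf_ideal (J_ideal I m) (hatH I m)
           (hat_comult I m) hat_counit (hat_antipode I m) \<and>
         hopf_algebra (hatH I m Quot J_ideal I m)
           (quotient_comult (hatH I m) (J_ideal I m) (hat_comult I m))
           (quotient_counit hat_counit)
           (quotient_antipode (hatH I m) (J_ideal I m) (hat_antipode I m))"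
proof -
  interpret coxeter I m by (rule coxeter.intro) (rule assms)
  show ?thesis
    using hopf_ideal_JW hopf_ideal.hopf_algebra_quotient[OF hopf_ideal_JW] by blast
qed

end
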